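(* For a Newtonian dynamical system on a Riemannian manifold $M$ of dimension $n\geqslant 2$, the complete normality condition and the strong normality condition are equivalent to each other.
   Context: $M$ is a smooth Riemannian manifold with metric $\mathbf g$, scalar product $(\cdot\,|\,\cdot)$ and Levi-Civita connection with components $\Gamma^k_{ij}$. In a local chart $x^1,\ldots,x^n$ of $M$ the tangent bundle $TM$ has coordinates $(x^1,\ldots,x^n,v^1,\ldots,v^n)$. Newtonian dynamical system. A force field is a smooth extended vector field $\mathbf F$: to each $q=(p,\mathbf v)\in TM$ it assigns $\mathbf F(p,\mathbf v)\in T_pM$. The Newtonian dynamical system with force field $\mathbf F$ is $\dot x^k=v^k$, $\nabla_tv^k=F^k(x,v)$, where $\nabla_tv^k=\dot v^k+\sum_{i,j}\Gamma^k_{ij}v^iv^j$. Its trajectories are the curves $p(t)$ in $M$ with velocity $\mathbf v(t)=\dot p(t)$ solving these equations; $\nabla_t$ denotes covariant differentiation along the trajectory. Spatial gradient: $\nabla_iF^k=\frac{\partial F^k}{\partial x^i}-\sum_{a,b}v^a\Gamma^b_{ia}\frac{\partial F^k}{\partial v^b}+\sum_a\Gamma^k_{ia}F^a$; velocity gradient: $\tilde\nabla_iF^k=\frac{\partial F^k}{\partial v^i}$. Vector of variation: on a trajectory, a vector function $\boldsymbol\tau(t)$ along it solving $$\nabla_{tt}\tau^k=-\sum_{m,i,j}R^k_{mij}\tau^iv^jv^m+\sum_m\nabla_t\tau^m\,\tilde\nabla_mF^k+\sum_m\tau^m\nabla_mF^k,$$ where $\nabla_{tt}=\nabla_t\nabla_t$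 and $R$ is the curvature tensor, $\sum R^k_{mij}X^iY^jZ^m=(R(X,Y)Z)^k$ with $R(X,Y)=[\nabla_X,\nabla_Y]-\nabla_{[X,Y]}$. Derivatives $\partial x^k/\partial u$ of one-parameter families of trajectories are vectors of variation. The function of deviation is $\varphi(t)=(\mathbf v\,|\,\boldsymbol\tau)$. Weak normality condition: for each trajectory there is an ordinary differential equation $\ddot\varphi=\mathcal A(t)\dot\varphi+\mathcal B(t)\varphi$ such that every function of deviation on that trajectory, for any choice of vector of variation, is a solution of it. Transformation class. A hypersurface $S\subset M$ belongs to transformation class if it is a connected, simply connected, open hypersurface with compact closure and $S\Subset S'$ (the closure of $S$ is compact and contained in $S'$) for some other open hypersurface $S'$. A smooth function $\nu$ on such $S$ belongs to transformation class on $S$ if it extends smoothly to some bigger open hypersurface $S'$ with $S\Subset S'$ and is nonzero everywhere on the closure $\overline S$. Shift. Let $S$ be a hypersurface of transformation class with a fixed smooth field of unit normals $\mathbf n(p)$, and $\nu$ a function of transformation class on $S$. For each $p\in S$ take the trajectory with initial data $x^k(0)=x^k(p)$, $v^k(0)=\nu(p)\,n^k(p)$; let $f_t$ map $p$ to the point of this trajectory at time $t$, and $S_t=f_t(S)$; for $|t|$ small $f_t:S\to S_t$ is a diffeomorphism onto a hypersurface. The shift is a normal shift if for all $t$ in some interval $(-\varepsilon,+\varepsilon)$ the hypersurfaces $S_t$ are orthogonal to the trajectories used to shift $S$. If $u^1,\ldots,u^{n-1}$ are local coordinates on $S$ and $x^k(u^1,\ldots,u^{n-1},t)$ describe the shift,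 let $\boldsymbol\tau_k$ be the vectors with components $\partial x^j/\partial u^k$ and $\varphi_k=(\boldsymbol\tau_k\,|\,\mathbf v)$, $k=1,\ldots,n-1$. Additional normality condition: for any hypersurface $S$ in $M$, any point $p_0\in S$ and any real $\nu_0\neq0$ there exist a smaller piece $S'$ of $S$ belonging to transformation class and containing $p_0$, and a function $\nu$ of transformation class on $S'$ with $\nu(p_0)=\nu_0$, such that for the shift $f_t:S'\to S'_t$ it defines one has $\dot\varphi_k(t)|_{t=0}=0$ for $k=1,\ldots,n-1$. Complete normality condition: the weak normality condition and the additional normality condition both hold. Strong normality condition (the system "admits the normal shift"): for any hypersurface $S$ in $M$, any point $p_0\in S$ and any real $\nu_0\neq0$ there exist a piece $S'$ of $S$ belonging to transformation class and containing $p_0$, and a function $\nu$ of transformation class on $S'$ with $\nu(p_0)=\nu_0$, such that the shift $f_t:S'\to S'_t$ defined by this function is a normal shift along the trajectories of the dynamical system. *)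

theory Defs
  imports "HOL-Analysis.Analysis"
begin

section \<open>Smooth maps between normed spaces\<close>

text \<open>These notions are meant for open sets and finite-dimensional domains, where they
  give the usual classes \<open>C\<^sup>k\<close> and \<open>C\<^sup>\<infinity>\<close>.\<close>

primrec Ck_on ::
  "nat \<Rightarrow> ('a::real_normed_vector \<Rightarrow> 'b::real_normed_vector) \<Rightarrow> 'a set \<Rightarrow> bool" where
  "Ck_on 0 f S = continuous_on S f"
| "Ck_on (Suc k) f S =
    ((\<forall>x\<in>S. f differentiable (at x)) \<and> (\<forall>v. Ck_on k (\<lambda>x. frechet_derivative f (at x) v) S))"

definition smooth_on ::
  "'a::real_normed_vector set \<Rightarrow> ('a \<Rightarrow> 'b::real_normed_vector) \<Rightarrow> bool" where
  "smooth_on S f \<longleftrightarrow> (\<forall>k. Ck_on k f S)"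

definition pd :: "'n::finite \<Rightarrow> (real^'n \<Rightarrow> real) \<Rightarrow> real^'n \<Rightarrow> real" where
  "pd i f x = frechet_derivative f (at x) (axis i 1)"


section \<open>Smooth manifolds\<close>

text \<open>A chart is a pair of its domain and its coordinate map; the values of the coordinate map
  outside of the domain are irrelevant.\<close>

type_synonym ('a, 'n) chart = "'a set \<times> ('a \<Rightarrow> real^'n)"

abbreviation cdom :: "('a, 'n) chart \<Rightarrow> 'a set" where
  "cdom c \<equiv> fst c"

abbreviation coord :: "('a, 'n) chart \<Rightarrow> 'a \<Rightarrow> real^'n" where
  "coord c \<equiv> snd c"

definition cinv :: "('a, 'n) chart \<Rightarrow> real^'n \<Rightarrow> 'a" where
  "cinv c = inv_into (cdom c) (coord c)"

definition is_chart :: "('a::topological_space, 'n::finite) chart \<Rightarrow> bool" where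
  "is_chart c \<longleftrightarrow> open (cdom c) \<and> open (coord c ` cdom c) \<and>
     homeomorphism (cdom c) (coord c ` cdom c) (coord c) (cinv c)"

definition trans_map :: "('a, 'n) chart \<Rightarrow> ('a, 'n) chart \<Rightarrow> real^'n \<Rightarrow> real^'n" where
  "trans_map c d x = coord d (cinv c x)"

definition jac ::
  "('a, 'n::finite) chart \<Rightarrow> ('a, 'n) chart \<Rightarrow> real^'n \<Rightarrow> real^'n \<Rightarrow> real^'n" where
  "jac c d x = frechet_derivative (trans_map c d) (at x)"

definition compatible :: "('a, 'n::finite) chart \<Rightarrow> ('a, 'n) chart \<Rightarrow> bool" where
  "compatible c d \<longleftrightarrow>
     smooth_on (coord c ` (cdom c \<inter> cdom d)) (trans_map c d) \<and>
     smooth_on (coord d ` (cdom c \<inter> cdom d)) (trans_map d c)"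

text \<open>The manifold is the whole type \<open>'a\<close>; its smooth structure is a maximal atlas, so that
  ``chart of the manifold'' just means ``element of \<open>atlas\<close>''. Its dimension is \<open>CARD('n)\<close>.\<close>

locale smooth_manifold =
  fixes atlas :: "('a::{t2_space, second_countable_topology}, 'n::finite) chart set"
  assumes charts: "\<And>c. c \<in> atlas \<Longrightarrow> is_chart c"
    and covering: "\<And>p. \<exists>c\<in>atlas. p \<in> cdom c"
    and compatible: "\<And>c d. c \<in> atlas \<Longrightarrow> d \<in> atlas \<Longrightarrow> compatible c d"
    and maximal: "\<And>c. is_chart c \<Longrightarrow> (\<And>d. d \<in> atlas \<Longrightarrow> compatible c d) \<Longrightarrow> c \<in> atlas"
begin

text \<open>A tangent vector at \<open>p\<close> is given by its components in all charts around \<open>p\<close>, related by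
  the usual transformation rule.\<close>

definition tangent_vector :: "'a \<Rightarrow> (('a, 'n) chart \<Rightarrow> real^'n) \<Rightarrow> bool" where
  "tangent_vector p X \<longleftrightarrow>
     (\<forall>c\<in>atlas. \<forall>d\<in>atlas. p \<in> cdom c \<inter> cdom d \<longrightarrow> X d = jac c d (coord c p) (X c))"


subsection \<open>Hypersurfaces\<close>

text \<open>In a slice chart \<open>(c, i)\<close> of \<open>S\<close> the set \<open>S\<close> is given by the vanishing of the \<open>i\<close>-th
  coordinate. The remaining \<open>n - 1\<close> coordinates are local coordinates \<open>u\<close> on \<open>S\<close>, and the
  coordinate vectors \<open>axis k 1\<close>, \<open>k \<noteq> i\<close>, of \<open>c\<close> span the tangent space of \<open>S\<close>.
  A hypersurface is an embedded submanifold of codimension one, without boundary.\<close>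

definition slice_chart :: "'a set \<Rightarrow> ('a, 'n) chart \<Rightarrow> 'n \<Rightarrow> bool" where
  "slice_chart S c i \<longleftrightarrow> c \<in> atlas \<and> S \<inter> cdom c = {q \<in> cdom c. coord c q $ i = 0}"

definition hypersurface :: "'a set \<Rightarrow> bool" where
  "hypersurface S \<longleftrightarrow> (\<forall>p\<in>S. \<exists>c i. slice_chart S c i \<and> p \<in> cdom c)"

text \<open>Local parametrization of \<open>S\<close> by the coordinates \<open>u\<^sup>k\<close>, \<open>k \<noteq> i\<close>, of a slice chart. To stay
  within \<open>real^'n\<close> the parameter \<open>u\<close> has a dummy \<open>i\<close>-th component, on which nothing depends; hence
  smoothness in \<open>u\<close> is smoothness in the \<open>n - 1\<close> coordinates on \<open>S\<close>.\<close>

definition flat :: "'n \<Rightarrow> real^'n \<Rightarrow> real^'n" where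
  "flat i u = (\<chi> k. if k = i then 0 else u $ k)"

definition slice_dom :: "('a, 'n) chart \<Rightarrow> 'n \<Rightarrow> (real^'n) set" where
  "slice_dom c i = {u. flat i u \<in> coord c ` cdom c}"

definition slice_param :: "('a, 'n) chart \<Rightarrow> 'n \<Rightarrow> real^'n \<Rightarrow> 'a" where
  "slice_param c i u = cinv c (flat i u)"

definition smooth_fun_on :: "'a set \<Rightarrow> ('a \<Rightarrow> real) \<Rightarrow> bool" where
  "smooth_fun_on S \<nu> \<longleftrightarrow>
     (\<forall>c i. slice_chart S c i \<longrightarrow> smooth_on (slice_dom c i) (\<lambda>u. \<nu> (slice_param c i u)))"

text \<open>Vector fields of the manifold along \<open>S\<close>, not necessarily tangent to \<open>S\<close>.\<close>

definition smooth_field_on :: "'a set \<Rightarrow> (('a, 'n) chart \<Rightarrow> 'a \<Rightarrow> real^'n) \<Rightarrow> bool" where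
  "smooth_field_on S X \<longleftrightarrow>
     (\<forall>p\<in>S. tangent_vector p (\<lambda>c. X c p)) \<and>
     (\<forall>c i. slice_chart S c i \<longrightarrow> smooth_on (slice_dom c i) (\<lambda>u. X c (slice_param c i u)))"

definition smooth_map_on :: "'a set \<Rightarrow> ('a \<Rightarrow> 'a) \<Rightarrow> bool" where
  "smooth_map_on S h \<longleftrightarrow> continuous_on S h \<and>
     (\<forall>c i. \<forall>d\<in>atlas. slice_chart S c i \<longrightarrow>
        smooth_on {u \<in> slice_dom c i. h (slice_param c i u) \<in> cdom d}
                  (\<lambda>u. coord d (h (slice_param c i u))))"

definition diffeomorphism :: "'a set \<Rightarrow> 'a set \<Rightarrow> ('a \<Rightarrow> 'a) \<Rightarrow> bool" where
  "diffeomorphism S T h \<longleftrightarrow>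
     bij_betw h S T \<and> smooth_map_on S h \<and> smooth_map_on T (inv_into S h)"

text \<open>\<open>S \<Subset> T\<close>\<close>

definition compactly_contained :: "'a set \<Rightarrow> 'a set \<Rightarrow> bool" where
  "compactly_contained S T \<longleftrightarrow> compact (closure S) \<and> closure S \<subseteq> T"

definition transformation_class :: "'a set \<Rightarrow> bool" where
  "transformation_class S \<longleftrightarrow>
     hypersurface S \<and> connected S \<and> simply_connected S \<and>
     (\<exists>T. hypersurface T \<and> compactly_contained S T)"

definition transformation_class_fun :: "'a set \<Rightarrow> ('a \<Rightarrow> real) \<Rightarrow> bool" where
  "transformation_class_fun S \<nu> \<longleftrightarrow>
     (\<exists>T \<mu>. hypersurface T \<and> compactly_contained S T \<and> smooth_fun_on T \<mu> \<and>
        (\<forall>p\<in>S. \<mu> p = \<nu> p) \<and> (\<forall>p\<in>closure S. \<mu> p \<noteq> 0))"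

text \<open>Pieces of a hypersurface are taken relatively open in it.\<close>

definition piece_around :: "'a \<Rightarrow> 'a set \<Rightarrow> 'a set \<Rightarrow> bool" where
  "piece_around p S S' \<longleftrightarrow>
     openin (top_of_set S) S' \<and> p \<in> S' \<and> transformation_class S'"

subsection \<open>Curves\<close>

definition vel :: "('a, 'n) chart \<Rightarrow> (real \<Rightarrow> 'a) \<Rightarrow> real \<Rightarrow> real^'n" where
  "vel c \<gamma> t = vector_derivative (\<lambda>s. coord c (\<gamma> s)) (at t)"

text \<open>A vector function along a curve is given by its components \<open>X c t\<close> in the charts \<open>c\<close>
  around the point \<open>\<gamma> t\<close>.\<close>

definition vector_along ::
  "real set \<Rightarrow> (real \<Rightarrow> 'a) \<Rightarrow> (('a, 'n) chart \<Rightarrow> real \<Rightarrow> real^'n) \<Rightarrow> bool" where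
  "vector_along I \<gamma> X \<longleftrightarrow> (\<forall>t\<in>I. tangent_vector (\<gamma> t) (\<lambda>c. X c t))"

end


section \<open>Riemannian manifolds\<close>

text \<open>\<open>g c x\<close> is the matrix of components of the metric in the chart \<open>c\<close> at the point with
  coordinates \<open>x\<close>.\<close>

definition scalar_prod :: "real^'n^'n \<Rightarrow> real^'n \<Rightarrow> real^'n \<Rightarrow> real" where
  "scalar_prod G X Y = (\<Sum>i\<in>UNIV. \<Sum>j\<in>UNIV. G $ i $ j * X $ i * Y $ j)"

locale riemannian_manifold = smooth_manifold atlas
  for atlas :: "('a::{t2_space, second_countable_topology}, 'n::finite) chart set" +
  fixes g :: "('a, 'n) chart \<Rightarrow> real^'n \<Rightarrow> real^'n^'n"
  assumes metric_smooth: "\<And>c. c \<in> atlas \<Longrightarrow> smooth_on (coord c ` cdom c) (g c)"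
    and metric_sym: "\<And>c x i j. c \<in> atlas \<Longrightarrow> x \<in> coord c ` cdom c \<Longrightarrow> g c x $ i $ j = g c x $ j $ i"
    and metric_pos: "\<And>c x X. c \<in> atlas \<Longrightarrow> x \<in> coord c ` cdom c \<Longrightarrow> X \<noteq> 0
        \<Longrightarrow> scalar_prod (g c x) X X > 0"
    and metric_tensor: "\<And>c d x X Y. c \<in> atlas \<Longrightarrow> d \<in> atlas \<Longrightarrow> x \<in> coord c ` (cdom c \<inter> cdom d)
        \<Longrightarrow> scalar_prod (g d (trans_map c d x)) (jac c d x X) (jac c d x Y)
          = scalar_prod (g c x) X Y"
begin

text \<open>\<open>\<Gamma>\<^sup>k\<^sub>i\<^sub>j\<close> at the point with coordinates \<open>x\<close>\<close>

definition Christoffel :: "('a, 'n) chart \<Rightarrow> real^'n \<Rightarrow> 'n \<Rightarrow> 'n \<Rightarrow> 'n \<Rightarrow> real" where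
  "Christoffel c x k i j = (\<Sum>l\<in>UNIV. 1/2 * matrix_inv (g c x) $ k $ l *
     (pd i (\<lambda>y. g c y $ l $ j) x + pd j (\<lambda>y. g c y $ i $ l) x - pd l (\<lambda>y. g c y $ i $ j) x))"

text \<open>\<open>R\<^sup>k\<^sub>m\<^sub>i\<^sub>j\<close>, with the sign convention
  \<open>R\<^sup>k\<^sub>m\<^sub>i\<^sub>j X\<^sup>i Y\<^sup>j Z\<^sup>m = (R(X,Y)Z)\<^sup>k\<close> for \<open>R(X,Y) = [\<nabla>\<^sub>X, \<nabla>\<^sub>Y] - \<nabla>\<^bsub>[X,Y]\<^esub>\<close>: it is the \<open>k\<close>-th component of
  \<open>\<nabla>\<^sub>i \<nabla>\<^sub>j \<partial>\<^sub>m - \<nabla>\<^sub>j \<nabla>\<^sub>i \<partial>\<^sub>m\<close>, where \<open>\<nabla>\<^sub>j \<partial>\<^sub>m = \<Sum>\<^sub>k \<Gamma>\<^sup>k\<^sub>j\<^sub>m \<partial>\<^sub>k\<close>.\<close>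

definition curvature :: "('a, 'n) chart \<Rightarrow> real^'n \<Rightarrow> 'n \<Rightarrow> 'n \<Rightarrow> 'n \<Rightarrow> 'n \<Rightarrow> real" where
  "curvature c x k m i j =
     pd i (\<lambda>y. Christoffel c y k j m) x - pd j (\<lambda>y. Christoffel c y k i m) x +
     (\<Sum>a\<in>UNIV. Christoffel c x k i a * Christoffel c x a j m
             - Christoffel c x k j a * Christoffel c x a i m)"

text \<open>Components in the chart \<open>c\<close> of the covariant derivative \<open>\<nabla>\<^sub>t X\<close> along \<open>\<gamma>\<close>, where \<open>X\<close> lists the
  components in \<open>c\<close> of a vector function along \<open>\<gamma>\<close>.\<close>

definition nabla_t ::
  "('a, 'n) chart \<Rightarrow> (real \<Rightarrow> 'a) \<Rightarrow> (real \<Rightarrow> real^'n) \<Rightarrow> real \<Rightarrow> real^'n" where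
  "nabla_t c \<gamma> X t = vector_derivative X (at t) +
     (\<chi> k. \<Sum>i\<in>UNIV. \<Sum>j\<in>UNIV. Christoffel c (coord c (\<gamma> t)) k i j * vel c \<gamma> t $ i * X t $ j)"

definition unit_normal :: "'a set \<Rightarrow> 'a \<Rightarrow> (('a, 'n) chart \<Rightarrow> real^'n) \<Rightarrow> bool" where
  "unit_normal S p X \<longleftrightarrow> tangent_vector p X \<and>
     (\<forall>c\<in>atlas. p \<in> cdom c \<longrightarrow> scalar_prod (g c (coord c p)) (X c) (X c) = 1) \<and>
     (\<forall>c i k. slice_chart S c i \<longrightarrow> p \<in> cdom c \<longrightarrow> k \<noteq> i \<longrightarrow>
        scalar_prod (g c (coord c p)) (X c) (axis k 1) = 0)"

definition unit_normal_field :: "'a set \<Rightarrow> (('a, 'n) chart \<Rightarrow> 'a \<Rightarrow> real^'n) \<Rightarrow> bool" where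
  "unit_normal_field S n \<longleftrightarrow>
     smooth_field_on S n \<and> (\<forall>p\<in>S. unit_normal S p (\<lambda>c. n c p))"

end


section \<open>Newtonian dynamical systems\<close>

text \<open>\<open>F c x v\<close> lists the components of the force in the chart \<open>c\<close> at the point of the tangent
  bundle with coordinates \<open>(x, v)\<close>.\<close>

locale newtonian_system = riemannian_manifold atlas g
  for atlas :: "('a::{t2_space, second_countable_topology}, 'n::finite) chart set"
    and g :: "('a, 'n) chart \<Rightarrow> real^'n \<Rightarrow> real^'n^'n" +
  fixes F :: "('a, 'n) chart \<Rightarrow> real^'n \<Rightarrow> real^'n \<Rightarrow> real^'n"
  assumes force_smooth:
      "\<And>c. c \<in> atlas \<Longrightarrow> smooth_on ((coord c ` cdom c) \<times> UNIV) (\<lambda>(x, v). F c x v)"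
    and force_vector: "\<And>c d x v. c \<in> atlas \<Longrightarrow> d \<in> atlas \<Longrightarrow> x \<in> coord c ` (cdom c \<inter> cdom d)
        \<Longrightarrow> F d (trans_map c d x) (jac c d x v) = jac c d x (F c x v)"
begin

text \<open>Curves are defined on open intervals \<open>I\<close>; values outside of \<open>I\<close> are irrelevant.\<close>

definition trajectory :: "real set \<Rightarrow> (real \<Rightarrow> 'a) \<Rightarrow> bool" where
  "trajectory I \<gamma> \<longleftrightarrow> open I \<and> connected I \<and> continuous_on I \<gamma> \<and>
     (\<forall>c\<in>atlas. \<forall>t\<in>I. \<gamma> t \<in> cdom c \<longrightarrow>
        (\<lambda>s. coord c (\<gamma> s)) differentiable (at t) \<and>
        vel c \<gamma> differentiable (at t) \<and>
        nabla_t c \<gamma> (vel c \<gamma>) t = F c (coord c (\<gamma> t)) (vel c \<gamma> t))"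

text \<open>\<open>\<nabla>\<^sub>i F\<^sup>k\<close> and the velocity gradient of \<open>F\<^sup>k\<close>\<close>

definition spatial_grad ::
  "('a, 'n) chart \<Rightarrow> real^'n \<Rightarrow> real^'n \<Rightarrow> 'n \<Rightarrow> 'n \<Rightarrow> real" where
  "spatial_grad c x v i k = pd i (\<lambda>y. F c y v $ k) x
     - (\<Sum>a\<in>UNIV. \<Sum>b\<in>UNIV. v $ a * Christoffel c x b i a * pd b (\<lambda>w. F c x w $ k) v)
     + (\<Sum>a\<in>UNIV. Christoffel c x k i a * F c x v $ a)"

definition velocity_grad ::
  "('a, 'n) chart \<Rightarrow> real^'n \<Rightarrow> real^'n \<Rightarrow> 'n \<Rightarrow> 'n \<Rightarrow> real" where
  "velocity_grad c x v i k = pd i (\<lambda>w. F c x w $ k) v"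

definition vector_of_variation ::
  "real set \<Rightarrow> (real \<Rightarrow> 'a) \<Rightarrow> (('a, 'n) chart \<Rightarrow> real \<Rightarrow> real^'n) \<Rightarrow> bool" where
  "vector_of_variation I \<gamma> \<tau> \<longleftrightarrow> vector_along I \<gamma> \<tau> \<and>
     (\<forall>c\<in>atlas. \<forall>t\<in>I. \<gamma> t \<in> cdom c \<longrightarrow>
        \<tau> c differentiable (at t) \<and>
        nabla_t c \<gamma> (\<tau> c) differentiable (at t) \<and>
        (let x = coord c (\<gamma> t); v = vel c \<gamma> t in
         \<forall>k. nabla_t c \<gamma> (nabla_t c \<gamma> (\<tau> c)) t $ k =
           - (\<Sum>m\<in>UNIV. \<Sum>i\<in>UNIV. \<Sum>j\<in>UNIV. curvature c x k m i j * \<tau> c t $ i * v $ j * v $ m)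
           + (\<Sum>m\<in>UNIV. nabla_t c \<gamma> (\<tau> c) t $ m * velocity_grad c x v m k)
           + (\<Sum>m\<in>UNIV. \<tau> c t $ m * spatial_grad c x v m k)))"

definition function_of_deviation :: "real set \<Rightarrow> (real \<Rightarrow> 'a) \<Rightarrow> (real \<Rightarrow> real) \<Rightarrow> bool" where
  "function_of_deviation I \<gamma> \<phi> \<longleftrightarrow>
     (\<exists>\<tau>. vector_of_variation I \<gamma> \<tau> \<and>
        (\<forall>t\<in>I. \<forall>c\<in>atlas. \<gamma> t \<in> cdom c \<longrightarrow>
           \<phi> t = scalar_prod (g c (coord c (\<gamma> t))) (vel c \<gamma> t) (\<tau> c t)))"

definition weak_normality :: bool where
  "weak_normality \<longleftrightarrow>
     (\<forall>I \<gamma>. trajectory I \<gamma> \<longrightarrow>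
       (\<exists>A B. continuous_on I A \<and> continuous_on I B \<and>
         (\<forall>\<phi>. function_of_deviation I \<gamma> \<phi> \<longrightarrow>
           (\<exists>\<phi>'. \<forall>t\<in>I. (\<phi> has_real_derivative \<phi>' t) (at t) \<and>
                       (\<phi>' has_real_derivative A t * \<phi>' t + B t * \<phi> t) (at t)))))"

text \<open>\<open>f p\<close> is the trajectory issuing from \<open>p\<close>, and \<open>\<lambda>p. f p t\<close> is the map \<open>f\<^sub>t\<close> of \<open>S\<close> onto the
  hypersurface \<open>S\<^sub>t\<close>.\<close>

definition is_shift ::
  "'a set \<Rightarrow> (('a, 'n) chart \<Rightarrow> 'a \<Rightarrow> real^'n) \<Rightarrow> ('a \<Rightarrow> real) \<Rightarrow> real \<Rightarrow>
   ('a \<Rightarrow> real \<Rightarrow> 'a) \<Rightarrow> bool" where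
  "is_shift S n \<nu> \<epsilon> f \<longleftrightarrow> \<epsilon> > 0 \<and>
     (\<forall>p\<in>S. trajectory {-\<epsilon><..<\<epsilon>} (f p) \<and> f p 0 = p \<and>
        (\<forall>c\<in>atlas. p \<in> cdom c \<longrightarrow> vel c (f p) 0 = \<nu> p *\<^sub>R n c p)) \<and>
     (\<forall>t\<in>{-\<epsilon><..<\<epsilon>}. hypersurface ((\<lambda>p. f p t) ` S) \<and>
        diffeomorphism S ((\<lambda>p. f p t) ` S) (\<lambda>p. f p t))"

text \<open>At \<open>f\<^sub>t p\<close> the tangent space of \<open>S\<^sub>t\<close> is spanned by the coordinate vectors \<open>axis k 1\<close>, \<open>k \<noteq> i\<close>,
  of a slice chart \<open>(c, i)\<close> of \<open>S\<^sub>t\<close>.\<close>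

definition is_normal_shift ::
  "'a set \<Rightarrow> (('a, 'n) chart \<Rightarrow> 'a \<Rightarrow> real^'n) \<Rightarrow> ('a \<Rightarrow> real) \<Rightarrow> real \<Rightarrow>
   ('a \<Rightarrow> real \<Rightarrow> 'a) \<Rightarrow> bool" where
  "is_normal_shift S n \<nu> \<epsilon> f \<longleftrightarrow> is_shift S n \<nu> \<epsilon> f \<and>
     (\<forall>t\<in>{-\<epsilon><..<\<epsilon>}. \<forall>p\<in>S. \<forall>c i k.
        slice_chart ((\<lambda>q. f q t) ` S) c i \<longrightarrow> f p t \<in> cdom c \<longrightarrow> k \<noteq> i \<longrightarrow>
        scalar_prod (g c (coord c (f p t))) (axis k 1) (vel c (f p) t) = 0)"

text \<open>Components of \<open>\<tau>\<^sub>k\<close> in the chart \<open>d\<close>: the derivatives \<open>\<partial>x\<^sup>j/\<partial>u\<^sup>k\<close>, for the local coordinates \<open>u\<close> on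
  the shifted hypersurface coming from a slice chart \<open>(c, i)\<close>; \<open>x\<close> are the coordinates of \<open>d\<close>.\<close>

definition shift_variation ::
  "('a \<Rightarrow> real \<Rightarrow> 'a) \<Rightarrow> ('a, 'n) chart \<Rightarrow> 'n \<Rightarrow> ('a, 'n) chart \<Rightarrow> 'n \<Rightarrow> real^'n \<Rightarrow> real
    \<Rightarrow> real^'n" where
  "shift_variation f c i d k u t =
     vector_derivative (\<lambda>s. coord d (f (slice_param c i (u + s *\<^sub>R axis k 1)) t)) (at 0)"

definition shift_deviation ::
  "('a \<Rightarrow> real \<Rightarrow> 'a) \<Rightarrow> ('a, 'n) chart \<Rightarrow> 'n \<Rightarrow> ('a, 'n) chart \<Rightarrow> 'n \<Rightarrow> real^'n \<Rightarrow> real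
    \<Rightarrow> real" where
  "shift_deviation f c i d k u t =
     (let p = slice_param c i u in
      scalar_prod (g d (coord d (f p t))) (shift_variation f c i d k u t) (vel d (f p) t))"

text \<open>The field of unit normals that enters the shift is fixed through its value \<open>n\<^sub>0\<close> at \<open>p\<^sub>0\<close>, which
  may be either of the two unit normals. This matters for the sign of \<open>\<nu>\<^sub>0\<close>. The whole hypersurface
  \<open>S\<close> need not carry a global field of unit normals.\<close>

definition additional_normality :: bool where
  "additional_normality \<longleftrightarrow>
     (\<forall>S p\<^sub>0 n\<^sub>0 \<nu>\<^sub>0. hypersurface S \<and> p\<^sub>0 \<in> S \<and> unit_normal S p\<^sub>0 n\<^sub>0 \<and> \<nu>\<^sub>0 \<noteq> 0 \<longrightarrow>
       (\<exists>S' n \<nu> \<epsilon> f. piece_around p\<^sub>0 S S' \<and>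
          unit_normal_field S' n \<and> (\<forall>c\<in>atlas. p\<^sub>0 \<in> cdom c \<longrightarrow> n c p\<^sub>0 = n\<^sub>0 c) \<and>
          transformation_class_fun S' \<nu> \<and> \<nu> p\<^sub>0 = \<nu>\<^sub>0 \<and>
          is_shift S' n \<nu> \<epsilon> f \<and>
          (\<forall>c i k u. \<forall>d\<in>atlas.
             slice_chart S' c i \<and> k \<noteq> i \<and> u \<in> slice_dom c i \<and> slice_param c i u \<in> cdom d \<longrightarrow>
             ((\<lambda>t. shift_deviation f c i d k u t) has_real_derivative 0) (at 0))))"

definition complete_normality :: bool where
  "complete_normality \<longleftrightarrow> weak_normality \<and> additional_normality"

definition strong_normality :: bool where
  "strong_normality \<longleftrightarrow>
     (\<forall>S p\<^sub>0 n\<^sub>0 \<nu>\<^sub>0. hypersurface S \<and> p\<^sub>0 \<in> S \<and> unit_normal S p\<^sub>0 n\<^sub>0 \<and> \<nu>\<^sub>0 \<noteq> 0 \<longrightarrow>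
       (\<exists>S' n \<nu> \<epsilon> f. piece_around p\<^sub>0 S S' \<and>
          unit_normal_field S' n \<and> (\<forall>c\<in>atlas. p\<^sub>0 \<in> cdom c \<longrightarrow> n c p\<^sub>0 = n\<^sub>0 c) \<and>
          transformation_class_fun S' \<nu> \<and> \<nu> p\<^sub>0 = \<nu>\<^sub>0 \<and>
          is_normal_shift S' n \<nu> \<epsilon> f))"

end

end

theory Submission
  imports Defs
begin

text \<open>In a chart a trajectory is an integral curve of a first-order system, and difference quotients of
  a family of trajectories converge, by Gronwall's inequality, to a solution of the linearised system; so
  the derivatives of a shift are vectors of variation. No existence theorem for differential equations
  is needed, since both normality conditions already supply the shifts. If the additional condition
  holds, the functions \<open>\<phi>\<^sub>k\<close> have zero initial data for the equation of the weak condition and therefore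
  vanish, which is normality.

  Conversely, for \<open>\<phi> = (v|\<tau>)\<close> one has \<open>\<phi>'' = \<beta>(\<tau>) + \<alpha>(\<nabla>\<^sub>t \<tau>)\<close> with covectors \<open>\<alpha>\<close>, \<open>\<beta>\<close> depending on the
  point and the velocity. Normal shifts of hypersurfaces with a prescribed tangent space and a varying second
  fundamental form force \<open>\<alpha> = A v\<close>, and then \<open>\<beta> = A F + B v\<close>, wherever \<open>v \<noteq> 0\<close>: this is the weak condition
  along trajectories of nonvanishing velocity, with \<open>A\<close> and \<open>B\<close> read off from \<open>\<tau> = v\<close>. Letting \<open>v\<close> tend to
  zero gives \<open>F(p, 0) = 0\<close> when \<open>n \<ge> 2\<close>, so all other trajectories are constant.\<close>


section \<open>Calculus of smooth maps\<close>

text \<open>The obstacle is that weak normality quantifies over all vectors of variation on all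
  trajectories, whereas normal shifts produce only special ones. It is met by a pointwise statement
  about \<alpha> and \<beta>: each phase point (x, v) with v \<noteq> 0 is the initial point of some
  normal shift, and only the values of \<phi>, \<phi>', \<phi>'' at t = 0 are needed. Let T be
  tangent to the test hypersurface and K = \<nabla>_t \<tau> at t = 0. Differentiating the normality
  of the initial velocity along T determines K up to a multiple of v; that multiple reflects the
  unknown derivative of \<nu> and is fixed by \<phi>' = 0. The second fundamental form in the
  direction T can be prescribed, so for fixed T the differences of the possible K fill the
  orthogonal complement of v. As \<phi>'' = 0 reads \<beta>(T) + \<alpha>(K) = 0 for all of them,
  \<alpha> vanishes there. A tangent direction T exists only when n \<ge> 2. The quotients by |v|^2
  that define A and B break down where v = 0. Once F(p, 0) = 0 is known, uniqueness of trajectories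
  excludes that a nonconstant one ever reaches velocity zero.\<close>

lemma Ck_on_imp_continuous_on: "Ck_on k f S \<Longrightarrow> continuous_on S f"
  by (cases k) (auto intro!: continuous_at_imp_continuous_on differentiable_imp_continuous_within)

lemma Ck_on_SucD: "Ck_on (Suc k) f S \<Longrightarrow> Ck_on k f S"
proof (induction k arbitrary: f)
  case 0
  show ?case using Ck_on_imp_continuous_on[OF 0] by simp
next
  case (Suc k)
  from Suc.prems have "\<forall>x\<in>S. f differentiable (at x)"
    and "\<And>v. Ck_on (Suc k) (\<lambda>x. frechet_derivative f (at x) v) S" by auto
  then show ?case using Suc.IH by auto
qed

lemma Ck_on_subset: "Ck_on k f S \<Longrightarrow> T \<subseteq> S \<Longrightarrow> Ck_on k f T"
  by (induction k arbitrary: f) (auto intro: continuous_on_subset)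

lemma Ck_on_cong:
  assumes "open S" "\<And>x. x \<in> S \<Longrightarrow> f x = g x" "Ck_on k f S"
  shows "Ck_on k g S"
  using assms(2,3)
proof (induction k arbitrary: f g)
  case 0
  then show ?case by (simp cong: continuous_on_cong)
next
  case (Suc k)
  have d: "f differentiable (at x)" if "x \<in> S" for x
    using Suc.prems that by auto
  have d': "g differentiable (at x)" if "x \<in> S" for x
    using d[OF that] Suc.prems(1) assms(1) that
    by (meson differentiable_def has_derivative_transform_within_open)
  have eq: "frechet_derivative f (at x) = frechet_derivative g (at x)" if "x \<in> S" for x
    using frechet_derivative_transform_within_open[OF d[OF that] assms(1) that Suc.prems(1)] by simp
  have "Ck_on k (\<lambda>x. frechet_derivative g (at x) v) S" for v
    by (rule Suc.IH[of "\<lambda>x. frechet_derivative f (at x) v"]) (use Suc.prems eq in auto)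
  then show ?case using d' by auto
qed

text \<open>Frees later proofs from \<open>frechet_derivative\<close>: by uniqueness of derivatives
  on an open set, the conditions of \<open>Ck_on\<close> may be checked on any explicit
  derivative.\<close>

lemma Ck_on_SucI:
  assumes "open S" "\<And>x. x \<in> S \<Longrightarrow> (f has_derivative f' x) (at x)"
    and "\<And>v. Ck_on k (\<lambda>x. f' x v) S"
  shows "Ck_on (Suc k) f S"
proof -
  have "f' x = frechet_derivative f (at x)" if "x \<in> S" for x
    using frechet_derivative_at[OF assms(2)[OF that]] .
  then have "Ck_on k (\<lambda>x. frechet_derivative f (at x) v) S" for v
    by (intro Ck_on_cong[OF assms(1) _ assms(3)[of v]]) auto
  then show ?thesis using assms(2) by (auto simp: differentiable_def)
qed

lemma Ck_on_has_derivative: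
  assumes "Ck_on (Suc k) f S" "x \<in> S"
  shows "(f has_derivative frechet_derivative f (at x)) (at x)"
  using assms frechet_derivative_works by auto

lemma Ck_on_const [simp]: "Ck_on k (\<lambda>x. c) S"
  by (induction k arbitrary: c) auto

lemma Ck_on_linear:
  assumes "bounded_linear f" "open S"
  shows "Ck_on k f S"
proof (cases k)
  case 0
  then show ?thesis using assms by (auto intro: linear_continuous_on)
next
  case (Suc j)
  show ?thesis unfolding Suc
    by (rule Ck_on_SucI[OF assms(2), of _ "\<lambda>_. f"])
       (use assms(1) bounded_linear_imp_has_derivative in auto)
qed

lemma Ck_on_add:
  assumes "open S" "Ck_on k f S" "Ck_on k g S"
  shows "Ck_on k (\<lambda>x. f x + g x) S"
  using assms(2,3)
proof (induction k arbitrary: f g)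
  case 0
  then show ?case by (auto intro: continuous_on_add)
next
  case (Suc k)
  show ?case
    by (rule Ck_on_SucI[OF assms(1) has_derivative_add[OF Ck_on_has_derivative[OF Suc.prems(1)]
          Ck_on_has_derivative[OF Suc.prems(2)]]]) (use Suc in auto)
qed

lemma Ck_on_bilinear:
  assumes "bounded_bilinear p" "open S" "Ck_on k f S" "Ck_on k g S"
  shows "Ck_on k (\<lambda>x. p (f x) (g x)) S"
  using assms(3,4)
proof (induction k arbitrary: f g)
  case 0
  then show ?case using bounded_bilinear.continuous_on[OF assms(1)] by auto
next
  case (Suc k)
  have f: "Ck_on k f S" and g: "Ck_on k g S" using Suc.prems Ck_on_SucD by blast+
  show ?case
    by (rule Ck_on_SucI[OF assms(2) bounded_bilinear.FDERIV[OF assms(1)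
          Ck_on_has_derivative[OF Suc.prems(1)] Ck_on_has_derivative[OF Suc.prems(2)]]])
       (use Suc f g in \<open>auto intro!: Ck_on_add[OF assms(2)]\<close>)
qed

lemma Ck_on_sum:
  assumes "open S" "\<And>i. i \<in> A \<Longrightarrow> Ck_on k (f i) S"
  shows "Ck_on k (\<lambda>x. \<Sum>i\<in>A. f i x) S"
  using assms(2) by (induction A rule: infinite_finite_induct) (auto intro!: Ck_on_add[OF assms(1)])

text \<open>The chain rule produces a derivative of \<open>f\<close> in a direction that varies with
  the point, while \<open>Ck_on\<close> controls derivatives in fixed directions only. Expanding the
  direction in the basis of the Euclidean domain of \<open>f\<close> leaves products with
  fixed-direction derivatives, to which the induction hypothesis applies.\<close>

lemma Ck_on_compose:
  fixes f :: "'a::euclidean_space \<Rightarrow> 'b::real_normed_vector"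
  assumes "open S" "open T" "g ` S \<subseteq> T" "Ck_on k f T" "Ck_on k g S"
  shows "Ck_on k (\<lambda>x. f (g x)) S"
  using assms(4,5)
proof (induction k arbitrary: f)
  case 0
  then show ?case using assms(3) continuous_on_compose2 by auto
next
  case (Suc k)
  have g: "Ck_on k g S" using Suc.prems Ck_on_SucD by blast
  define f' where "f' x = (\<lambda>v. \<Sum>b\<in>Basis. (frechet_derivative g (at x) v \<bullet> b) *\<^sub>R
      frechet_derivative f (at (g x)) b)" for x
  have der: "((\<lambda>x. f (g x)) has_derivative f' x) (at x)" if "x \<in> S" for x
  proof -
    have fg: "(f has_derivative frechet_derivative f (at (g x))) (at (g x))"
      using Ck_on_has_derivative[OF Suc.prems(1)] assms(3) that by auto
    have "((\<lambda>x. f (g x)) has_derivative (\<lambda>v. frechet_derivative f (at (g x))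
        (frechet_derivative g (at x) v))) (at x)"
      by (rule has_derivative_compose[OF Ck_on_has_derivative[OF Suc.prems(2) that] fg])
    moreover have "frechet_derivative f (at (g x)) (frechet_derivative g (at x) v) = f' x v" for v
    proof -
      let ?w = "frechet_derivative g (at x) v"
      have "frechet_derivative f (at (g x)) (\<Sum>b\<in>Basis. (?w \<bullet> b) *\<^sub>R b) = f' x v"
        unfolding f'_def
        by (simp add: linear_sum[OF has_derivative_linear[OF fg]] linear_scale[OF has_derivative_linear[OF fg]])
      then show ?thesis by (simp add: euclidean_representation)
    qed
    ultimately show ?thesis by simp
  qed
  have "Ck_on k (\<lambda>x. (frechet_derivative g (at x) v \<bullet> b)) S" for v b
    by (rule Ck_on_bilinear[OF bounded_bilinear_inner assms(1)]) (use Suc.prems in auto)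
  moreover have "Ck_on k (\<lambda>x. frechet_derivative f (at (g x)) b) S" for b
    by (rule Suc.IH) (use Suc.prems g in auto)
  ultimately have "Ck_on k (\<lambda>x. f' x v) S" for v
    unfolding f'_def
    by (intro Ck_on_sum[OF assms(1)] Ck_on_bilinear[OF bounded_bilinear_scaleR assms(1)]) auto
  then show ?case by (intro Ck_on_SucI[OF assms(1) der])
qed

text \<open>The derivative -f'/f^2 contains 1/f again, but only to the order that the induction
  hypothesis covers.\<close>

lemma Ck_on_inverse:
  fixes f :: "'a::real_normed_vector \<Rightarrow> real"
  assumes "open S" "\<And>x. x \<in> S \<Longrightarrow> f x \<noteq> 0" "Ck_on k f S"
  shows "Ck_on k (\<lambda>x. inverse (f x)) S"
  using assms(3)
proof (induction k)
  case 0
  then show ?case using assms(2) by (auto intro!: continuous_intros)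
next
  case (Suc k)
  have IH: "Ck_on k (\<lambda>x. inverse (f x)) S" using Suc Ck_on_SucD by blast
  have D: "Ck_on k (\<lambda>x. frechet_derivative f (at x) v) S" for v using Suc.prems by auto
  show ?case
  proof (rule Ck_on_SucI[OF assms(1), of _ "\<lambda>x v. (-1) * (inverse (f x) * frechet_derivative f (at x) v * inverse (f x))"])
    show "((\<lambda>x. inverse (f x)) has_derivative
        (\<lambda>v. (-1) * (inverse (f x) * frechet_derivative f (at x) v * inverse (f x)))) (at x)" if "x \<in> S" for x
      using Deriv.has_derivative_inverse[OF assms(2)[OF that] Ck_on_has_derivative[OF Suc.prems that]] by simp
  qed (intro Ck_on_bilinear[OF bounded_bilinear_mult assms(1)] IH D Ck_on_const)
qed

section \<open>Smooth maps: closure properties and inverse matrices\<close>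

lemma smooth_on_subset: "smooth_on S f \<Longrightarrow> T \<subseteq> S \<Longrightarrow> smooth_on T f"
  unfolding smooth_on_def using Ck_on_subset by blast

lemma smooth_on_cong:
  "open S \<Longrightarrow> (\<And>x. x \<in> S \<Longrightarrow> f x = g x) \<Longrightarrow> smooth_on S f \<Longrightarrow> smooth_on S g"
  unfolding smooth_on_def using Ck_on_cong by blast

lemma smooth_on_const: "smooth_on S (\<lambda>x. c)"
  by (simp add: smooth_on_def)

lemma smooth_on_linear: "bounded_linear f \<Longrightarrow> open S \<Longrightarrow> smooth_on S f"
  by (simp add: smooth_on_def Ck_on_linear)

lemma smooth_on_add:
  "open S \<Longrightarrow> smooth_on S f \<Longrightarrow> smooth_on S g \<Longrightarrow> smooth_on S (\<lambda>x. f x + g x)"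
  by (simp add: smooth_on_def Ck_on_add)

lemma smooth_on_bilinear:
  "bounded_bilinear p \<Longrightarrow> open S \<Longrightarrow> smooth_on S f \<Longrightarrow> smooth_on S g \<Longrightarrow>
    smooth_on S (\<lambda>x. p (f x) (g x))"
  by (simp add: smooth_on_def Ck_on_bilinear)

lemmas smooth_on_scaleR = smooth_on_bilinear[OF bounded_bilinear_scaleR]

lemma smooth_on_mult:
  fixes f :: "'a::real_normed_vector \<Rightarrow> real"
  shows "open S \<Longrightarrow> smooth_on S f \<Longrightarrow> smooth_on S g \<Longrightarrow> smooth_on S (\<lambda>x. f x * g x)"
  by (rule smooth_on_bilinear[OF bounded_bilinear_mult])

lemma smooth_on_sum:
  "open S \<Longrightarrow> (\<And>i. i \<in> A \<Longrightarrow> smooth_on S (f i)) \<Longrightarrow> smooth_on S (\<lambda>x. \<Sum>i\<in>A. f i x)"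
  by (simp add: smooth_on_def Ck_on_sum)

lemma smooth_on_diff:
  assumes "open S" "smooth_on S f" "smooth_on S g"
  shows "smooth_on S (\<lambda>x. f x - g x)"
  using smooth_on_add[OF assms(1,2) smooth_on_scaleR[OF assms(1) smooth_on_const[of _ "-1"] assms(3)]]
  by simp

lemma smooth_on_compose:
  fixes f :: "'a::euclidean_space \<Rightarrow> 'b::real_normed_vector"
  shows "open S \<Longrightarrow> open T \<Longrightarrow> g ` S \<subseteq> T \<Longrightarrow> smooth_on T f \<Longrightarrow> smooth_on S g \<Longrightarrow>
    smooth_on S (\<lambda>x. f (g x))"
  by (simp add: smooth_on_def Ck_on_compose)

lemma smooth_on_inverse:
  fixes f :: "'a::real_normed_vector \<Rightarrow> real"
  shows "open S \<Longrightarrow> (\<And>x. x \<in> S \<Longrightarrow> f x \<noteq> 0) \<Longrightarrow> smooth_on S f \<Longrightarrow> smooth_on S (\<lambda>x. inverse (f x))"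
  by (simp add: smooth_on_def Ck_on_inverse)

lemma smooth_on_prod:
  fixes f :: "'i \<Rightarrow> 'a::real_normed_vector \<Rightarrow> real"
  assumes "open S" "\<And>i. i \<in> A \<Longrightarrow> smooth_on S (f i)"
  shows "smooth_on S (\<lambda>x. \<Prod>i\<in>A. f i x)"
  using assms(2)
  by (induction A rule: infinite_finite_induct)
     (auto intro!: smooth_on_mult[OF assms(1)] smooth_on_const)

text \<open>Kept apart from \<open>smooth_on_compose\<close> because the values of \<open>f\<close>
  may lie in a space that is not Euclidean.\<close>

lemma smooth_on_bounded_linear:
  assumes "bounded_linear h" "open S" "smooth_on S f"
  shows "smooth_on S (\<lambda>x. h (f x))"
proof -
  have "Ck_on k (\<lambda>x. h (f x)) S" if "Ck_on k f S" for k
    using that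
  proof (induction k arbitrary: f)
    case 0
    then show ?case using bounded_linear.continuous_on[OF assms(1)] by auto
  next
    case (Suc k)
    show ?case
      by (rule Ck_on_SucI[OF assms(2) bounded_linear.has_derivative[OF assms(1)
            Ck_on_has_derivative[OF Suc.prems]]]) (use Suc in auto)
  qed
  then show ?thesis using assms(3) by (simp add: smooth_on_def)
qed

lemma smooth_on_nth:
  fixes f :: "'a::real_normed_vector \<Rightarrow> 'b::real_normed_vector ^ 'n"
  shows "open S \<Longrightarrow> smooth_on S f \<Longrightarrow> smooth_on S (\<lambda>x. f x $ i)"
  by (rule smooth_on_bounded_linear[OF bounded_linear_vec_nth])

lemma smooth_on_vec:
  fixes f :: "'a::real_normed_vector \<Rightarrow> real ^ 'n"
  assumes "open S" "\<And>i. smooth_on S (\<lambda>x. f x $ i)"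
  shows "smooth_on S f"
proof -
  have "smooth_on S (\<lambda>x. \<Sum>i\<in>UNIV. (f x $ i) *\<^sub>R (axis i 1 :: real ^ 'n))"
    by (intro smooth_on_sum smooth_on_scaleR assms smooth_on_const)
  moreover have "(\<lambda>x. \<Sum>i\<in>UNIV. (f x $ i) *\<^sub>R (axis i 1 :: real ^ 'n)) = f"
    by (rule ext) (simp add: vec_eq_iff axis_def if_distrib cong: if_cong)
  ultimately show ?thesis by simp
qed

lemma smooth_on_continuous: "smooth_on S f \<Longrightarrow> continuous_on S f"
  unfolding smooth_on_def using Ck_on_imp_continuous_on by blast

lemma smooth_on_has_derivative:
  "smooth_on S f \<Longrightarrow> x \<in> S \<Longrightarrow> (f has_derivative frechet_derivative f (at x)) (at x)"
  unfolding smooth_on_def using Ck_on_has_derivative by blast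

lemma smooth_on_frechet_derivative:
  "smooth_on S f \<Longrightarrow> smooth_on S (\<lambda>x. frechet_derivative f (at x) v)"
  unfolding smooth_on_def using Ck_on.simps(2) by blast

lemma smooth_on_det:
  fixes A :: "'a::real_normed_vector \<Rightarrow> real^'n^'n"
  assumes "open S" "\<And>i j. smooth_on S (\<lambda>x. A x $ i $ j)"
  shows "smooth_on S (\<lambda>x. det (A x))"
  unfolding det_def
  by (intro smooth_on_sum smooth_on_mult smooth_on_prod smooth_on_const assms)

text \<open>Cramer's rule. Smoothness of the inverse metric thereby reduces to that of determinants
  and of a reciprocal.\<close>

lemma matrix_inv_nth:
  fixes A :: "real^'n^'n"
  assumes "invertible A"
  shows "matrix_inv A $ k $ l = det (\<chi> i j. if j = k then axis l 1 $ i else A $ i $ j) * inverse (det A)"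
proof -
  have "A ** matrix_inv A = mat 1"
    using assms unfolding invertible_def matrix_inv_def by (metis (mono_tags, lifting) someI_ex)
  then have "A *v (matrix_inv A *v axis l 1) = axis l 1"
    by (simp add: matrix_vector_mul_assoc)
  moreover have "det A \<noteq> 0" using assms invertible_det_nz by blast
  ultimately have "matrix_inv A *v axis l 1 =
      (\<chi> k. det (\<chi> i j. if j = k then axis l 1 $ i else A $ i $ j) / det A)"
    using cramer by blast
  moreover have "(matrix_inv A *v axis l 1) $ k = matrix_inv A $ k $ l"
    by (simp add: matrix_vector_mult_def axis_def if_distrib cong: if_cong)
  ultimately show ?thesis by (simp add: divide_inverse)
qed

lemma smooth_on_matrix_inv:
  fixes A :: "'a::real_normed_vector \<Rightarrow> real^'n^'n"
  assumes "open S" "\<And>i j. smooth_on S (\<lambda>x. A x $ i $ j)" "\<And>x. x \<in> S \<Longrightarrow> invertible (A x)"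
  shows "smooth_on S (\<lambda>x. matrix_inv (A x) $ k $ l)"
proof (rule smooth_on_cong[OF assms(1)])
  show "det (\<chi> i j. if j = k then axis l 1 $ i else A x $ i $ j) * inverse (det (A x))
      = matrix_inv (A x) $ k $ l" if "x \<in> S" for x
    using matrix_inv_nth[OF assms(3)[OF that]] by simp
  have "smooth_on S (\<lambda>x. if j = k then axis l 1 $ i else A x $ i $ j)" for i j
    by (cases "j = k") (auto intro: assms smooth_on_const)
  then show "smooth_on S (\<lambda>x. det (\<chi> i j. if j = k then axis l 1 $ i else A x $ i $ j) * inverse (det (A x)))"
    by (intro smooth_on_mult smooth_on_det smooth_on_inverse)
       (use assms in \<open>auto simp flip: invertible_det_nz\<close>)
qed


section \<open>Gronwall estimates and differentiable dependence on initial data\<close>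

text \<open>The squared norm is used because it is differentiable even where y vanishes. Since 2 |y|
  \<eta> \<le> |y|^2 + \<eta>^2, its derivative is at most (2L + 1) |y|^2 + \<eta>^2, and the weight
  exp(-(2L + 1)(t - a)) turns this into monotonicity.\<close>

lemma gronwall_forward:
  fixes y :: "real \<Rightarrow> 'a::real_inner"
  assumes "a \<le> b" "0 \<le> L"
    and y: "\<And>t. t \<in> {a..b} \<Longrightarrow> (y has_vector_derivative y' t) (at t within {a..b})"
    and le: "\<And>t. t \<in> {a..b} \<Longrightarrow> norm (y' t) \<le> L * norm (y t) + \<eta>"
  shows "(norm (y b))\<^sup>2 \<le> ((norm (y a))\<^sup>2 + \<eta>\<^sup>2 * (b - a)) * exp ((2 * L + 1) * (b - a))"
proof -
  define M where "M = 2 * L + 1"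
  define h where "h t = exp (- M * (t - a)) * (y t \<bullet> y t) - \<eta>\<^sup>2 * (t - a)" for t
  define h' where "h' t = exp (- M * (t - a)) * (2 * (y t \<bullet> y' t)) - M * exp (- M * (t - a)) * (y t \<bullet> y t) - \<eta>\<^sup>2" for t
  have cont: "continuous_on {a..b} h"
  proof -
    have "continuous_on {a..b} y"
      unfolding continuous_on_eq_continuous_within
      by (intro ballI has_vector_derivative_continuous[OF y])
    then show ?thesis unfolding h_def by (intro continuous_intros)
  qed
  have "h b \<le> h a"
  proof (rule DERIV_nonpos_imp_decreasing_open[OF assms(1) _ cont])
    fix t assume t: "a < t" "t < b"
    have "(y has_vector_derivative y' t) (at t)"
      using y[of t] t by (simp add: at_within_Icc_at)
    then have "((\<lambda>t. y t \<bullet> y t) has_vector_derivative (y t \<bullet> y' t + y' t \<bullet> y t)) (at t)"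
      by (intro bounded_bilinear.has_vector_derivative[OF bounded_bilinear_inner])
    then have i: "((\<lambda>t. y t \<bullet> y t) has_real_derivative (2 * (y t \<bullet> y' t))) (at t)"
      by (simp add: has_real_derivative_iff_has_vector_derivative inner_commute)
    have d: "(h has_real_derivative h' t) (at t)"
      unfolding h_def h'_def
      by (rule derivative_eq_intros i refl)+ (simp add: algebra_simps)
    have "2 * (y t \<bullet> y' t) \<le> 2 * (norm (y t) * norm (y' t))"
      using norm_cauchy_schwarz[of "y t" "y' t"] by simp
    also have "\<dots> \<le> 2 * (norm (y t) * (L * norm (y t) + \<eta>))"
      using le[of t] t by (intro mult_left_mono) auto
    also have "\<dots> \<le> M * (y t \<bullet> y t) + \<eta>\<^sup>2"
    proof -
      have "0 \<le> (norm (y t) - \<eta>)\<^sup>2" by simp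
      then show ?thesis
        by (simp add: M_def power2_norm_eq_inner[symmetric] power2_eq_square algebra_simps)
    qed
    finally have "2 * (y t \<bullet> y' t) - M * (y t \<bullet> y t) \<le> \<eta>\<^sup>2" by simp
    then have "exp (- M * (t - a)) * (2 * (y t \<bullet> y' t) - M * (y t \<bullet> y t)) \<le> exp (- M * (t - a)) * \<eta>\<^sup>2"
      by (intro mult_left_mono) auto
    also have "\<dots> \<le> 1 * \<eta>\<^sup>2"
      using t assms(2) by (intro mult_right_mono) (auto simp: M_def intro!: mult_nonpos_nonneg)
    finally have "h' t \<le> 0" by (simp add: h'_def algebra_simps)
    with d show "\<exists>z. (h has_real_derivative z) (at t) \<and> z \<le> 0" by blast
  qed
  then have "exp (- M * (b - a)) * (norm (y b))\<^sup>2 \<le> (norm (y a))\<^sup>2 + \<eta>\<^sup>2 * (b - a)"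
    by (simp add: h_def power2_norm_eq_inner)
  then have "exp (M * (b - a)) * (exp (- M * (b - a)) * (norm (y b))\<^sup>2)
      \<le> exp (M * (b - a)) * ((norm (y a))\<^sup>2 + \<eta>\<^sup>2 * (b - a))"
    by (intro mult_left_mono) auto
  moreover have "exp (M * (b - a)) * (exp (- M * (b - a)) * (norm (y b))\<^sup>2) = (norm (y b))\<^sup>2"
    by (simp add: exp_minus)
  ultimately have "(norm (y b))\<^sup>2 \<le> exp (M * (b - a)) * ((norm (y a))\<^sup>2 + \<eta>\<^sup>2 * (b - a))"
    by metis
  then show ?thesis unfolding M_def by (metis mult.commute)
qed

text \<open>Serves base points inside the interval, in both directions of time; the full length b -
  a makes the constant uniform in t1.\<close>

lemma gronwall:
  fixes y :: "real \<Rightarrow> 'a::real_inner"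
  assumes "0 \<le> L" "t0 \<in> {a..b}" "t1 \<in> {a..b}"
    and y: "\<And>t. t \<in> {a..b} \<Longrightarrow> (y has_vector_derivative y' t) (at t within {a..b})"
    and le: "\<And>t. t \<in> {a..b} \<Longrightarrow> norm (y' t) \<le> L * norm (y t) + \<eta>"
  shows "(norm (y t1))\<^sup>2 \<le> ((norm (y t0))\<^sup>2 + \<eta>\<^sup>2 * (b - a)) * exp ((2 * L + 1) * (b - a))"
proof -
  define d where "d = \<bar>t1 - t0\<bar>"
  have d: "0 \<le> d" "d \<le> b - a" using assms by (auto simp: d_def)
  have "(norm (y t1))\<^sup>2 \<le> ((norm (y t0))\<^sup>2 + \<eta>\<^sup>2 * d) * exp ((2 * L + 1) * d)"
  proof (cases "t0 \<le> t1")
    case True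
    have "(norm (y t1))\<^sup>2 \<le> ((norm (y t0))\<^sup>2 + \<eta>\<^sup>2 * (t1 - t0)) * exp ((2 * L + 1) * (t1 - t0))"
    proof (rule gronwall_forward[OF True assms(1)])
      show "(y has_vector_derivative y' t) (at t within {t0..t1})" if "t \<in> {t0..t1}" for t
        using that assms by (intro has_vector_derivative_within_subset[OF y]) auto
      show "norm (y' t) \<le> L * norm (y t) + \<eta>" if "t \<in> {t0..t1}" for t
        using that assms by (intro le) auto
    qed
    then show ?thesis using True by (simp add: d_def)
  next
    case False
    \<comment> \<open>Backward in time: the reflected curve satisfies the same bound and runs
      forward from -t0 to -t1.\<close>
    define z where "z s = y (- s)" for s
    have "(norm (z (- t1)))\<^sup>2 \<le> ((norm (z (- t0)))\<^sup>2 + \<eta>\<^sup>2 * (- t1 - - t0)) * exp ((2 * L + 1) * (- t1 - - t0))"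
    proof (rule gronwall_forward[OF _ assms(1)])
      show "- t0 \<le> - t1" using False by simp
      show "(z has_vector_derivative - y' (- s)) (at s within {- t0..- t1})" if "s \<in> {- t0..- t1}" for s
      proof -
        have m: "- s \<in> {a..b}" using that assms by auto
        have sub: "uminus ` {- t0..- t1} \<subseteq> {a..b}" using assms by auto
        have "((\<lambda>s. - s :: real) has_vector_derivative -1) (at s within {- t0..- t1})"
          by (auto intro!: derivative_eq_intros)
        then have "(y \<circ> uminus has_vector_derivative (-1) *\<^sub>R y' (- s)) (at s within {- t0..- t1})"
          by (rule vector_diff_chain_within)
             (rule has_vector_derivative_within_subset[OF y[OF m] sub])
        then show ?thesis by (simp add: z_def[abs_def] o_def)
      qed
      show "norm (- y' (- s)) \<le> L * norm (z s) + \<eta>" if "s \<in> {- t0..- t1}" for s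
        using le[of "- s"] that assms by (auto simp: z_def)
    qed
    then show ?thesis using False by (simp add: d_def z_def)
  qed
  also have "\<dots> \<le> ((norm (y t0))\<^sup>2 + \<eta>\<^sup>2 * (b - a)) * exp ((2 * L + 1) * (b - a))"
    using d assms(1) by (intro mult_mono add_mono mult_left_mono) auto
  finally show ?thesis .
qed

text \<open>By the mean value inequality the remainder is bounded by the oscillation of
  \<open>DY\<close> on a small ball. Only directional derivatives are assumed continuous, so the
  oscillation is controlled on each basis vector and summed.\<close>

lemma C1_uniform:
  fixes Y :: "'a::euclidean_space \<Rightarrow> 'b::real_normed_vector"
  assumes "open U" "compact C" "C \<subseteq> U"
    and der: "\<And>x. x \<in> U \<Longrightarrow> (Y has_derivative DY x) (at x)"
    and cont: "\<And>v. continuous_on U (\<lambda>x. DY x v)"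
    and "0 < e"
  obtains r where "0 < r" "\<And>x z. x \<in> C \<Longrightarrow> norm (z - x) \<le> r \<Longrightarrow> z \<in> U"
    "\<And>x z. x \<in> C \<Longrightarrow> norm (z - x) \<le> r \<Longrightarrow> norm (Y z - Y x - DY x (z - x)) \<le> e * norm (z - x)"
proof -
  obtain r0 where r0: "0 < r0" "(\<Union>x\<in>C. cball x r0) \<subseteq> U"
    using compact_subset_open_imp_cball_epsilon_subset[OF assms(2,1,3)] by blast
  \<comment> \<open>Closed r0-neighbourhood of \<open>C\<close>, compact as a sum of compact sets:
    uniform continuity must also cover the points \<open>z\<close> near \<open>C\<close>.\<close>
  define C' where "C' = (\<Union>x\<in>C. \<Union>h\<in>cball 0 r0. {x + h})"
  have "compact C'" unfolding C'_def by (rule compact_sums') (use assms(2) in auto)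
  have sub: "cball x r0 \<subseteq> C'" if "x \<in> C" for x
  proof
    fix z assume "z \<in> cball x r0"
    then have "z = x + (z - x)" "z - x \<in> cball 0 r0" by (auto simp: dist_norm norm_minus_commute)
    then show "z \<in> C'" unfolding C'_def using that by blast
  qed
  have C'U: "C' \<subseteq> U"
  proof
    fix z assume "z \<in> C'"
    then obtain x h where "x \<in> C" "h \<in> cball 0 r0" "z = x + h" by (auto simp: C'_def)
    then show "z \<in> U" using r0(2) by (force simp: subset_iff dist_norm)
  qed
  \<comment> \<open>The share of \<open>e\<close> available to each basis direction.\<close>
  define m where "m = e / real DIM('a)"
  have m: "0 < m" using assms(6) by (simp add: m_def)
  have "\<exists>d>0. \<forall>x\<in>C'. \<forall>z\<in>C'. dist z x < d \<longrightarrow> dist (DY z b) (DY x b) < m" for b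
    using compact_uniformly_continuous[OF continuous_on_subset[OF cont C'U] \<open>compact C'\<close>, of b] m
    unfolding uniformly_continuous_on_def by blast
  then obtain d where d: "\<And>b. d b > 0"
    "\<And>b x z. x \<in> C' \<Longrightarrow> z \<in> C' \<Longrightarrow> dist z x < d b \<Longrightarrow> dist (DY z b) (DY x b) < m"
    by metis
  define r where "r = min r0 (Min (d ` Basis) / 2)"
  have Mn: "Min (d ` (Basis::'a set)) > 0" using d(1) by (subst Min_gr_iff) auto
  have r: "0 < r" "r \<le> r0" using r0(1) Mn by (auto simp: r_def)
  have rd: "r < d b" if "b \<in> Basis" for b
  proof -
    have "Min (d ` Basis) \<le> d b" using that by simp
    with Mn have "Min (d ` Basis) / 2 < d b" by linarith
    then show ?thesis by (auto simp: r_def)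
  qed
  have lin: "norm (DY z h - DY x h) \<le> e * norm h" if x: "x \<in> C" and z: "z \<in> cball x r" for x z h
  proof -
    have mem: "x \<in> C'" "z \<in> C'" using sub[OF x] r r0(1) z by (auto simp: subset_iff)
    have lz: "linear (DY z)" and lx: "linear (DY x)"
      using der mem C'U has_derivative_linear by blast+
    have "DY z h = (\<Sum>b\<in>Basis. (h \<bullet> b) *\<^sub>R DY z b)" and "DY x h = (\<Sum>b\<in>Basis. (h \<bullet> b) *\<^sub>R DY x b)"
      using linear_sum[OF lz, of "\<lambda>b. (h \<bullet> b) *\<^sub>R b" Basis] linear_sum[OF lx, of "\<lambda>b. (h \<bullet> b) *\<^sub>R b" Basis]
      by (simp_all add: euclidean_representation linear_scale[OF lz] linear_scale[OF lx])
    then have "norm (DY z h - DY x h) = norm (\<Sum>b\<in>Basis. (h \<bullet> b) *\<^sub>R (DY z b - DY x b))"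
      by (simp add: sum_subtractf scaleR_diff_right)
    also have "\<dots> \<le> (\<Sum>b\<in>(Basis::'a set). norm h * m)"
    proof (rule sum_norm_le)
      fix b :: 'a assume b: "b \<in> Basis"
      have "dist z x < d b" using z rd[OF b] by (simp add: dist_commute)
      then have "norm (DY z b - DY x b) < m" using d(2) mem by (simp add: dist_norm)
      then show "norm ((h \<bullet> b) *\<^sub>R (DY z b - DY x b)) \<le> norm h * m"
        using Basis_le_norm[OF b, of h] by (auto intro: mult_mono)
    qed
    also have "\<dots> = e * norm h" by (simp add: m_def)
    finally show ?thesis .
  qed
  show ?thesis
  proof (rule that[OF r(1)])
    fix x z assume x: "x \<in> C" and z: "norm (z - x) \<le> r"
    have zb: "z \<in> cball x r" using z by (simp add: dist_norm norm_minus_commute)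
    have cb: "cball x r \<subseteq> U" using r(2) sub[OF x] C'U by (auto simp: subset_iff)
    then show "z \<in> U" using zb by blast
    have "norm (Y z - Y x - DY x (z - x)) \<le> norm (z - x) * e"
    proof (rule differentiable_bound_linearization[where S = "cball x r" and f' = DY])
      fix t :: real assume t: "t \<in> {0..1}"
      have "norm (t *\<^sub>R (z - x)) \<le> 1 * r" unfolding norm_scaleR using t z by (intro mult_mono) auto
      then show "x + t *\<^sub>R (z - x) \<in> cball x r"
        by (simp add: dist_norm)
    next
      fix w assume w: "w \<in> cball x r"
      then show "(Y has_derivative DY w) (at w within cball x r)"
        using der cb has_derivative_at_withinI by blast
      show "onorm (DY w - DY x) \<le> e"
        using lin[OF x w] by (intro onorm_le) auto
    qed (use r(1) in auto)
    then show "norm (Y z - Y x - DY x (z - x)) \<le> e * norm (z - x)" by (simp add: mult.commute)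
  qed
qed

text \<open>One of the two points always lies in \<open>C\<close>, so the difference can be compared
  with the linear part there and no convexity of \<open>U\<close> enters. The constant is a bound of
  the derivative on \<open>C\<close> plus the 1 from \<open>C1_uniform\<close> with e = 1.\<close>

lemma C1_Lipschitz_near_compact:
  fixes Y :: "'a::euclidean_space \<Rightarrow> 'b::real_normed_vector"
  assumes "open U" "compact C" "C \<subseteq> U"
    and der: "\<And>x. x \<in> U \<Longrightarrow> (Y has_derivative DY x) (at x)"
    and cont: "\<And>v. continuous_on U (\<lambda>x. DY x v)"
  obtains r L where "0 < r" "0 \<le> L" "\<And>x z. x \<in> C \<Longrightarrow> norm (z - x) \<le> r \<Longrightarrow> z \<in> U"
    "\<And>x z. x \<in> C \<Longrightarrow> norm (z - x) \<le> r \<Longrightarrow> norm (Y z - Y x) \<le> L * norm (z - x)"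
    "\<And>x h. x \<in> C \<Longrightarrow> norm (DY x h) \<le> L * norm h"
proof -
  obtain r where r: "0 < r" "\<And>x z. x \<in> C \<Longrightarrow> norm (z - x) \<le> r \<Longrightarrow> z \<in> U"
    "\<And>x z. x \<in> C \<Longrightarrow> norm (z - x) \<le> r \<Longrightarrow> norm (Y z - Y x - DY x (z - x)) \<le> 1 * norm (z - x)"
    using C1_uniform[OF assms, of 1] by auto
  have "\<exists>B. \<forall>x\<in>C. norm (DY x b) \<le> B" for b
    using compact_imp_bounded[OF compact_continuous_image[OF continuous_on_subset[OF cont assms(3)] assms(2)], of b]
    by (auto simp: bounded_iff)
  then obtain B where B: "\<And>b x. x \<in> C \<Longrightarrow> norm (DY x b) \<le> B b" by metis
  define L where "L = (\<Sum>b\<in>(Basis::'a set). \<bar>B b\<bar>)"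
  have L0: "0 \<le> L" by (auto simp: L_def intro: sum_nonneg)
  have L: "norm (DY x h) \<le> L * norm h" if "x \<in> C" for x h
  proof -
    have lx: "linear (DY x)" using der that assms(3) has_derivative_linear by blast
    have "DY x h = (\<Sum>b\<in>Basis. (h \<bullet> b) *\<^sub>R DY x b)"
      using linear_sum[OF lx, of "\<lambda>b. (h \<bullet> b) *\<^sub>R b" Basis]
      by (simp add: euclidean_representation linear_scale[OF lx])
    also have "norm \<dots> \<le> (\<Sum>b\<in>Basis. norm h * \<bar>B b\<bar>)"
    proof (rule sum_norm_le)
      fix b :: 'a assume b: "b \<in> Basis"
      show "norm ((h \<bullet> b) *\<^sub>R DY x b) \<le> norm h * \<bar>B b\<bar>"
        using Basis_le_norm[OF b, of h] B[OF that, of b] by (auto intro!: mult_mono)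
    qed
    finally show ?thesis by (simp add: L_def sum_distrib_left mult.commute)
  qed
  show ?thesis
  proof (rule that[of r "L + 1"])
    fix x z assume x: "x \<in> C" and z: "norm (z - x) \<le> r"
    have "norm (Y z - Y x) \<le> norm (Y z - Y x - DY x (z - x)) + norm (DY x (z - x))"
      by (metis diff_add_cancel norm_triangle_ineq)
    then show "norm (Y z - Y x) \<le> (L + 1) * norm (z - x)"
      using r(3)[OF x z] L[OF x, of "z - x"] by (simp add: algebra_simps)
  next
    fix x h assume "x \<in> C"
    then show "norm (DY x h) \<le> (L + 1) * norm h"
      using L[of x h] norm_ge_zero[of h] unfolding distrib_right by linarith
  qed (use r L0 in auto)
qed


text \<open>The difference quotients \<open>q s\<close> solve the linearised equation up to a small error, so they are
  uniformly Cauchy by Gronwall's inequality.\<close>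

lemma flow_derivative:
  fixes Y :: "'a::euclidean_space \<Rightarrow> 'a" and y :: "real \<Rightarrow> real \<Rightarrow> 'a"
  assumes U: "open U"
    and der: "\<And>x. x \<in> U \<Longrightarrow> (Y has_derivative DY x) (at x)"
    and cont: "\<And>v. continuous_on U (\<lambda>x. DY x v)"
    and t1: "t1 \<in> {a..b}"
    and y0U: "\<And>t. t \<in> {a..b} \<Longrightarrow> y0 t \<in> U"
    and y0: "\<And>t. t \<in> {a..b} \<Longrightarrow> (y0 has_vector_derivative Y (y0 t)) (at t)"
    and y: "\<forall>\<^sub>F s in at 0. \<forall>t\<in>{a..b}. (y s has_vector_derivative Y (y s t)) (at t)"
    and near: "\<forall>\<^sub>F s in at 0. \<forall>t\<in>{a..b}. norm (y s t - y0 t) \<le> K * norm (y s t1 - y0 t1)"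
    and z1: "((\<lambda>s. (y s t1 - y0 t1) /\<^sub>R s) \<longlongrightarrow> z1) (at 0)"
  obtains z where "z t1 = z1"
    "\<And>t. t \<in> {a..b} \<Longrightarrow> (z has_vector_derivative DY (y0 t) (z t)) (at t within {a..b})"
    "\<And>t. t \<in> {a..b} \<Longrightarrow> ((\<lambda>s. (y s t - y0 t) /\<^sub>R s) \<longlongrightarrow> z t) (at 0)"
proof -
  define C where "C = y0 ` {a..b}"
  have "continuous_on {a..b} y0"
    using y0 has_vector_derivative_continuous has_vector_derivative_at_within
    by (metis continuous_on_eq_continuous_within)
  then have C: "compact C" "C \<subseteq> U" using y0U by (auto simp: C_def intro: compact_continuous_image)
  obtain L where L: "0 \<le> L" "\<And>x h. x \<in> C \<Longrightarrow> norm (DY x h) \<le> L * norm h"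
    using C1_Lipschitz_near_compact[OF U C der cont] by metis
  have lin: "linear (DY (y0 t))" if "t \<in> {a..b}" for t
    using der[OF y0U[OF that]] has_derivative_linear by blast
  define q where "q s t = (y s t - y0 t) /\<^sub>R s" for s t
  define q' where "q' s t = (Y (y s t) - Y (y0 t)) /\<^sub>R s" for s t
  \<comment> \<open>Bound for the quotients on the whole interval: \<open>near\<close> multiplies
    the quotient at t1, which tends to z1, by at most K.\<close>
  define B where "B = \<bar>K\<bar> * (norm z1 + 1)"
  have qd: "\<forall>\<^sub>F s in at 0. \<forall>t\<in>{a..b}. (q s has_vector_derivative q' s t) (at t within {a..b})"
    using y
  proof eventually_elim
    case (elim s)
    show ?case
    proof
      fix t assume t: "t \<in> {a..b}"
      have "(q s has_vector_derivative q' s t) (at t)"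
        unfolding q_def q'_def
        using bspec[OF elim t] y0[OF t]
        by (intro bounded_linear.has_vector_derivative[OF bounded_linear_scaleR_right]
            has_vector_derivative_diff)
      then show "(q s has_vector_derivative q' s t) (at t within {a..b})"
        by (rule has_vector_derivative_at_within)
    qed
  qed
  have b1: "\<forall>\<^sub>F s in at 0. norm (q s t1) < norm z1 + 1"
    using order_tendstoD(2)[OF tendsto_norm[OF z1], of "norm z1 + 1"] by (simp add: q_def)
  have qB: "\<forall>\<^sub>F s in at 0. \<forall>t\<in>{a..b}. norm (q s t) \<le> B"
    using near b1
  proof eventually_elim
    case (elim s)
    show ?case
    proof
      fix t assume t: "t \<in> {a..b}"
      have "norm (q s t) = norm (y s t - y0 t) / \<bar>s\<bar>" by (simp add: q_def divide_inverse mult.commute)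
      also have "\<dots> \<le> K * norm (y s t1 - y0 t1) / \<bar>s\<bar>"
        using bspec[OF elim(1) t] by (intro divide_right_mono) auto
      also have "\<dots> = K * norm (q s t1)" by (simp add: q_def divide_inverse mult_ac)
      also have "\<dots> \<le> \<bar>K\<bar> * (norm z1 + 1)" using elim(2) by (intro mult_mono) auto
      finally show "norm (q s t) \<le> B" by (simp add: B_def)
    qed
  qed
  have err: "\<forall>\<^sub>F s in at 0. \<forall>t\<in>{a..b}. norm (q' s t - DY (y0 t) (q s t)) \<le> e" if e: "0 < e" for e
  proof -
    \<comment> \<open>The linearisation error is e' times the norm of a quotient, hence at most e'
      |B|; the 1 keeps the denominator positive.\<close>
    define e' where "e' = e / (\<bar>B\<bar> + 1)"
    have e': "0 < e'" "e' * \<bar>B\<bar> \<le> e" using e by (auto simp: e'_def field_simps)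
    obtain r where r: "0 < r" "\<And>x z. x \<in> C \<Longrightarrow> norm (z - x) \<le> r \<Longrightarrow>
        norm (Y z - Y x - DY x (z - x)) \<le> e' * norm (z - x)"
      using C1_uniform[OF U C der cont e'(1)] by metis
    have "\<forall>\<^sub>F s in at 0. \<bar>s\<bar> * \<bar>B\<bar> \<le> r \<and> s \<noteq> (0::real)"
    proof -
      have "((\<lambda>s::real. \<bar>s\<bar> * \<bar>B\<bar>) \<longlongrightarrow> \<bar>0\<bar> * \<bar>B\<bar>) (at 0)" by (intro tendsto_intros)
      then have "\<forall>\<^sub>F s in at 0. \<bar>s\<bar> * \<bar>B\<bar> < r" using r(1) by (intro order_tendstoD) auto
      then show ?thesis using eventually_at_ball'[of 1 0 UNIV]
        by (auto elim!: eventually_elim2 simp: eventually_at_filter)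
    qed
    then show ?thesis using qB
    proof eventually_elim
      case (elim s)
      show ?case
      proof
        fix t assume t: "t \<in> {a..b}"
        have yq: "y s t - y0 t = s *\<^sub>R q s t" using elim(1) by (simp add: q_def)
        have B: "norm (q s t) \<le> \<bar>B\<bar>" using elim(2) t by fastforce
        have "norm (y s t - y0 t) \<le> r"
          using elim(1) order_trans[OF mult_left_mono[OF B, of "\<bar>s\<bar>"]] by (simp add: yq)
        then have "norm (Y (y s t) - Y (y0 t) - DY (y0 t) (y s t - y0 t)) \<le> e' * norm (y s t - y0 t)"
          using t by (intro r(2)) (auto simp: C_def)
        then have "norm ((Y (y s t) - Y (y0 t) - DY (y0 t) (y s t - y0 t)) /\<^sub>R s) \<le> (e' * norm (y s t - y0 t)) / \<bar>s\<bar>"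
          by (simp add: divide_inverse mult.commute mult_left_mono)
        moreover have "(Y (y s t) - Y (y0 t) - DY (y0 t) (y s t - y0 t)) /\<^sub>R s = q' s t - DY (y0 t) (q s t)"
          using elim(1) by (simp add: q'_def yq linear_scale[OF lin[OF t]] scaleR_diff_right)
        moreover have "(e' * norm (y s t - y0 t)) / \<bar>s\<bar> = e' * norm (q s t)"
          using elim(1) by (simp add: yq)
        moreover have "e' * norm (q s t) \<le> e"
          using mult_left_mono[OF B, of e'] e' by linarith
        ultimately show "norm (q' s t - DY (y0 t) (q s t)) \<le> e" by simp
      qed
    qed
  qed
  define Ex where "Ex = exp ((2 * L + 1) * (b - a))"
  have ab: "a \<le> b" using t1 by auto
  have Ex: "Ex > 0" by (simp add: Ex_def)
  \<comment> \<open>The limit function is first constructed along one sequence, where the theorem on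
    limits of derivatives applies; convergence for all s \<rightarrow> 0 comes at the end.\<close>
  define \<sigma> where "\<sigma> n = 1 / real (Suc n)" for n
  have \<sigma>: "filterlim \<sigma> (at 0) sequentially"
    unfolding filterlim_at \<sigma>_def[abs_def] using LIMSEQ_inverse_real_of_nat
    by (auto simp: inverse_eq_divide)
  have seq: "\<forall>\<^sub>F n in sequentially. P (\<sigma> n)" if "\<forall>\<^sub>F s in at 0. P s" for P
    using \<sigma> that by (simp add: filterlim_iff)
  \<comment> \<open>The difference of two quotients solves the linear equation up to 2e, one e from
    each.\<close>
  have diffs: "(norm (q s t - q r t))\<^sup>2 \<le> ((norm (q s t1 - q r t1))\<^sup>2 + (2*e)\<^sup>2 * (b - a)) * Ex"
    if d: "\<forall>t\<in>{a..b}. (q s has_vector_derivative q' s t) (at t within {a..b})"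
      "\<forall>t\<in>{a..b}. (q r has_vector_derivative q' r t) (at t within {a..b})"
      and le: "\<forall>t\<in>{a..b}. norm (q' s t - DY (y0 t) (q s t)) \<le> e"
      "\<forall>t\<in>{a..b}. norm (q' r t - DY (y0 t) (q r t)) \<le> e"
      and t: "t \<in> {a..b}" for s r e t
    unfolding Ex_def
  proof (rule gronwall[OF L(1) t1 t])
    fix t assume t: "t \<in> {a..b}"
    show "((\<lambda>t. q s t - q r t) has_vector_derivative q' s t - q' r t) (at t within {a..b})"
      using d t by (intro has_vector_derivative_diff) auto
    have "q' s t - q' r t = (q' s t - DY (y0 t) (q s t)) - (q' r t - DY (y0 t) (q r t)) + DY (y0 t) (q s t - q r t)"
      by (simp add: linear_diff[OF lin[OF t]])
    also have "norm \<dots> \<le> norm (q' s t - DY (y0 t) (q s t)) + norm (q' r t - DY (y0 t) (q r t))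
        + norm (DY (y0 t) (q s t - q r t))"
      by (intro order_trans[OF norm_triangle_ineq] add_right_mono norm_triangle_ineq4)
    also have "\<dots> \<le> e + e + L * norm (q s t - q r t)"
      using le t by (intro add_mono L(2)) (auto simp: C_def)
    finally show "norm (q' s t - q' r t) \<le> L * norm (q s t - q r t) + 2 * e" by simp
  qed
  have sq: "(e / (2 * sqrt P))\<^sup>2 * P = (e/2)\<^sup>2" if "0 < P" for e P :: real
    using that by (simp add: power_divide power_mult_distrib)
  have "uniformly_Cauchy_on {a..b} (\<lambda>n. q (\<sigma> n))"
  proof (rule uniformly_Cauchy_onI)
    fix e :: real assume e: "0 < e"
    \<comment> \<open>With initial difference e2 and error 2 e2 the Gronwall bound is exactly
      (e/2)^2.\<close>
    define e2 where "e2 = e / (2 * sqrt ((1 + 4 * (b - a)) * Ex))"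
    have pos: "0 < (1 + 4 * (b - a)) * Ex" using ab Ex by simp
    then have e2: "0 < e2" using e by (simp add: e2_def)
    have "(e2\<^sup>2 + (2*e2)\<^sup>2 * (b - a)) * Ex = e2\<^sup>2 * ((1 + 4 * (b - a)) * Ex)"
      by (simp add: algebra_simps power2_eq_square)
    also have "\<dots> = (e/2)\<^sup>2" unfolding e2_def by (rule sq[OF pos])
    finally have e2e: "(e2\<^sup>2 + (2*e2)\<^sup>2 * (b - a)) * Ex = (e/2)\<^sup>2" .
    have "Cauchy (\<lambda>n. q (\<sigma> n) t1)"
      using filterlim_compose[OF z1 \<sigma>] by (auto simp: q_def intro: LIMSEQ_imp_Cauchy)
    then obtain N1 where N1: "\<And>m n. m \<ge> N1 \<Longrightarrow> n \<ge> N1 \<Longrightarrow> norm (q (\<sigma> m) t1 - q (\<sigma> n) t1) < e2"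
      using e2 by (metis Cauchy_iff)
    obtain N2 where N2: "\<And>n. n \<ge> N2 \<Longrightarrow> \<forall>t\<in>{a..b}. (q (\<sigma> n) has_vector_derivative q' (\<sigma> n) t) (at t within {a..b})"
      using seq[OF qd] by (auto simp: eventually_sequentially)
    obtain N3 where N3: "\<And>n. n \<ge> N3 \<Longrightarrow> \<forall>t\<in>{a..b}. norm (q' (\<sigma> n) t - DY (y0 t) (q (\<sigma> n) t)) \<le> e2"
      using seq[OF err[OF e2]] by (auto simp: eventually_sequentially)
    show "\<exists>M. \<forall>x\<in>{a..b}. \<forall>m\<ge>M. \<forall>n\<ge>M. dist (q (\<sigma> m) x) (q (\<sigma> n) x) < e"
    proof (intro exI[of _ "max N1 (max N2 N3)"] ballI allI impI)
      fix t m n assume t: "t \<in> {a..b}" and mn: "max N1 (max N2 N3) \<le> m" "max N1 (max N2 N3) \<le> n"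
      have "(norm (q (\<sigma> m) t - q (\<sigma> n) t))\<^sup>2 \<le> ((norm (q (\<sigma> m) t1 - q (\<sigma> n) t1))\<^sup>2 + (2*e2)\<^sup>2 * (b - a)) * Ex"
        by (rule diffs) (use N2 N3 mn t in auto)
      also have "\<dots> \<le> (e2\<^sup>2 + (2*e2)\<^sup>2 * (b - a)) * Ex"
        using N1[of m n] mn Ex by (intro mult_right_mono add_right_mono power_mono) auto
      also have "\<dots> = (e/2)\<^sup>2" by (rule e2e)
      finally have "norm (q (\<sigma> m) t - q (\<sigma> n) t) \<le> e/2"
        by (rule power2_le_imp_le) (use e in auto)
      then show "dist (q (\<sigma> m) t) (q (\<sigma> n) t) < e" using e by (simp add: dist_norm)
    qed
  qed
  then obtain z where z: "uniform_limit {a..b} (\<lambda>n. q (\<sigma> n)) z sequentially"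
    using Cauchy_uniformly_convergent uniformly_convergent_on_def by blast
  have zt1: "z t1 = z1"
    using LIMSEQ_unique tendsto_uniform_limitI[OF z t1] filterlim_compose[OF z1 \<sigma>] by (auto simp: q_def)
  have zd: "(z has_vector_derivative DY (y0 t) (z t)) (at t within {a..b})" if t: "t \<in> {a..b}" for t
  proof -
    obtain N2 where N2: "\<And>n. n \<ge> N2 \<Longrightarrow> \<forall>t\<in>{a..b}. (q (\<sigma> n) has_vector_derivative q' (\<sigma> n) t) (at t within {a..b})"
      using seq[OF qd] by (auto simp: eventually_sequentially)
    \<comment> \<open>\<open>has_derivative_sequence\<close> asks for the derivative at every index,
      so the indices below \<open>N2\<close> are dropped.\<close>
    define \<rho> where "\<rho> n = \<sigma> (n + N2)" for n
    have r_ev: "\<forall>\<^sub>F n in sequentially. P (\<rho> n)" if "\<forall>\<^sub>F n in sequentially. P (\<sigma> n)" for P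
      using that unfolding \<rho>_def by (simp add: eventually_sequentially_seg[of "\<lambda>n. P (\<sigma> n)"])
    have "\<exists>g. \<forall>x\<in>{a..b}. (\<lambda>n. q (\<rho> n) x) \<longlonglongrightarrow> g x \<and>
        (g has_derivative (\<lambda>h. h *\<^sub>R DY (y0 x) (z x))) (at x within {a..b})"
    proof (rule has_derivative_sequence[OF convex_real_interval(5)])
      show "(q (\<rho> n) has_derivative (\<lambda>h. h *\<^sub>R q' (\<rho> n) x)) (at x within {a..b})" if "x \<in> {a..b}" for n x
        using N2[of "n + N2"] that by (auto simp: \<rho>_def has_vector_derivative_def)
      show "\<forall>\<^sub>F n in sequentially. \<forall>x\<in>{a..b}. \<forall>h. norm (h *\<^sub>R q' (\<rho> n) x - h *\<^sub>R DY (y0 x) (z x)) \<le> e * norm h"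
        if e: "0 < e" for e
      proof (rule r_ev)
        define d where "d = e / (2 * (L + 1))"
        have d: "0 < d" "L * d \<le> e / 2" using e L(1) by (auto simp: d_def field_simps)
        have e2: "0 < e/2" using e by simp
        have c: "\<forall>\<^sub>F n in sequentially. \<forall>x\<in>{a..b}. norm (q (\<sigma> n) x - z x) < d"
          using z d(1) unfolding uniform_limit_iff dist_norm by blast
        show "\<forall>\<^sub>F n in sequentially. \<forall>x\<in>{a..b}. \<forall>h. norm (h *\<^sub>R q' (\<sigma> n) x - h *\<^sub>R DY (y0 x) (z x)) \<le> e * norm h"
          using seq[OF err[OF e2]] c
        proof eventually_elim
          case (elim n)
          show ?case
          proof (intro ballI allI)
            fix x h assume x: "x \<in> {a..b}"
            have "q' (\<sigma> n) x - DY (y0 x) (z x) = (q' (\<sigma> n) x - DY (y0 x) (q (\<sigma> n) x)) + DY (y0 x) (q (\<sigma> n) x - z x)"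
              by (simp add: linear_diff[OF lin[OF x]])
            then have "norm (q' (\<sigma> n) x - DY (y0 x) (z x)) \<le> norm (q' (\<sigma> n) x - DY (y0 x) (q (\<sigma> n) x)) + norm (DY (y0 x) (q (\<sigma> n) x - z x))"
              by (metis norm_triangle_ineq)
            also have "\<dots> \<le> e/2 + L * norm (q (\<sigma> n) x - z x)"
              using elim x by (intro add_mono L(2)) (auto simp: C_def)
            also have "\<dots> \<le> e/2 + L * d"
              using elim x L(1) by (intro add_left_mono mult_left_mono) (auto intro: less_imp_le)
            also have "\<dots> \<le> e" using d by simp
            finally show "norm (h *\<^sub>R q' (\<sigma> n) x - h *\<^sub>R DY (y0 x) (z x)) \<le> e * norm h"
              by (simp add: scaleR_diff_right[symmetric] mult.commute[of e] mult_left_mono)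
          qed
        qed
      qed
      show "t1 \<in> {a..b}" by (rule t1)
      show "(\<lambda>n. q (\<rho> n) t1) \<longlonglongrightarrow> z1"
        unfolding \<rho>_def using filterlim_compose[OF z1 \<sigma>]
        by (intro LIMSEQ_ignore_initial_segment[of "\<lambda>n. q (\<sigma> n) t1"]) (simp add: q_def)
    qed
    then obtain g where g: "\<And>x. x \<in> {a..b} \<Longrightarrow> (\<lambda>n. q (\<rho> n) x) \<longlonglongrightarrow> g x"
      "\<And>x. x \<in> {a..b} \<Longrightarrow> (g has_derivative (\<lambda>h. h *\<^sub>R DY (y0 x) (z x))) (at x within {a..b})" by blast
    have "g x = z x" if "x \<in> {a..b}" for x
      using LIMSEQ_unique[OF g(1)[OF that]] tendsto_uniform_limitI[OF z that]
        LIMSEQ_ignore_initial_segment[of "\<lambda>n. q (\<sigma> n) x" "z x" N2] by (auto simp: \<rho>_def)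
    then show ?thesis unfolding has_vector_derivative_def
      by (intro has_derivative_transform[OF t _ g(2)[OF t]]) auto
  qed
  \<comment> \<open>Now that \<open>z\<close> is known to solve the linear equation, each quotient
    is compared with \<open>z\<close> directly; this gives convergence for all s and not only along
    \<sigma>.\<close>
  have "((\<lambda>s. q s t) \<longlongrightarrow> z t) (at 0)" if t: "t \<in> {a..b}" for t
  proof (rule tendstoI)
    fix e :: real assume e: "0 < e"
    define e2 where "e2 = e / (2 * sqrt ((1 + (b - a)) * Ex))"
    have pos: "0 < (1 + (b - a)) * Ex" using ab Ex by simp
    then have e2: "0 < e2" using e by (simp add: e2_def)
    have "(e2\<^sup>2 + e2\<^sup>2 * (b - a)) * Ex = e2\<^sup>2 * ((1 + (b - a)) * Ex)"
      by (simp add: algebra_simps power2_eq_square)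
    also have "\<dots> = (e/2)\<^sup>2" unfolding e2_def by (rule sq[OF pos])
    finally have e2e: "(e2\<^sup>2 + e2\<^sup>2 * (b - a)) * Ex = (e/2)\<^sup>2" .
    have "\<forall>\<^sub>F s in at 0. norm (q s t1 - z1) < e2"
      using tendstoD[OF z1 e2] by (simp add: q_def dist_norm)
    then show "\<forall>\<^sub>F s in at 0. dist (q s t) (z t) < e"
      using qd err[OF e2]
    proof eventually_elim
      case (elim s)
      have "(norm (q s t - z t))\<^sup>2 \<le> ((norm (q s t1 - z t1))\<^sup>2 + e2\<^sup>2 * (b - a)) * Ex"
        unfolding Ex_def
      proof (rule gronwall[OF L(1) t1 t])
        fix t assume t: "t \<in> {a..b}"
        show "((\<lambda>t. q s t - z t) has_vector_derivative q' s t - DY (y0 t) (z t)) (at t within {a..b})"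
          using elim t zd by (intro has_vector_derivative_diff) auto
        have "q' s t - DY (y0 t) (z t) = (q' s t - DY (y0 t) (q s t)) + DY (y0 t) (q s t - z t)"
          by (simp add: linear_diff[OF lin[OF t]])
        then have "norm (q' s t - DY (y0 t) (z t)) \<le> norm (q' s t - DY (y0 t) (q s t)) + norm (DY (y0 t) (q s t - z t))"
          by (metis norm_triangle_ineq)
        also have "\<dots> \<le> e2 + L * norm (q s t - z t)"
          using elim t by (intro add_mono L(2)) (auto simp: C_def)
        finally show "norm (q' s t - DY (y0 t) (z t)) \<le> L * norm (q s t - z t) + e2" by simp
      qed
      also have "\<dots> \<le> (e2\<^sup>2 + e2\<^sup>2 * (b - a)) * Ex"
        using elim(1) Ex zt1 by (intro mult_right_mono add_right_mono power_mono) auto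
      also have "\<dots> = (e/2)\<^sup>2" by (rule e2e)
      finally have "norm (q s t - z t) \<le> e/2"
        by (rule power2_le_imp_le) (use e in auto)
      then show ?case using e by (simp add: dist_norm)
    qed
  qed
  then show ?thesis using that zt1 zd by (simp add: q_def)
qed


section \<open>Charts and slices\<close>

text \<open>Matches derivatives in the parameter of a family with the difference quotients of
  \<open>flow_derivative\<close>.\<close>

lemma has_vector_derivative_at_0_iff:
  "(f has_vector_derivative D) (at 0) \<longleftrightarrow> ((\<lambda>s. (f s - f 0) /\<^sub>R s) \<longlongrightarrow> D) (at 0)"
proof -
  have "(f has_vector_derivative D) (at 0) \<longleftrightarrow> ((\<lambda>h. norm (f h - f 0 - h *\<^sub>R D) / norm h) \<longlongrightarrow> 0) (at 0)"
    by (simp add: has_vector_derivative_def has_derivative_at bounded_linear_scaleR_left)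
  also have "\<dots> \<longleftrightarrow> ((\<lambda>s. norm ((f s - f 0) /\<^sub>R s - D)) \<longlongrightarrow> 0) (at 0)"
  proof (rule filterlim_cong[OF refl refl])
    have "norm (f h - f 0 - h *\<^sub>R D) / norm h = norm ((f h - f 0) /\<^sub>R h - D)" if "h \<noteq> 0" for h
    proof -
      have "(f h - f 0) /\<^sub>R h - D = (f h - f 0 - h *\<^sub>R D) /\<^sub>R h"
        using that by (simp add: scaleR_diff_right)
      then show ?thesis by (simp add: divide_inverse mult.commute)
    qed
    then show "\<forall>\<^sub>F h in at 0. norm (f h - f 0 - h *\<^sub>R D) / norm h = norm ((f h - f 0) /\<^sub>R h - D)"
      by (simp add: eventually_at_filter)
  qed
  also have "\<dots> \<longleftrightarrow> ((\<lambda>s. (f s - f 0) /\<^sub>R s) \<longlongrightarrow> D) (at 0)"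
    by (simp add: tendsto_norm_zero_iff LIM_zero_iff)
  finally show ?thesis .
qed

lemma has_vector_derivative_cong_eventually:
  assumes "(f has_vector_derivative D) (at t)" "\<forall>\<^sub>F s in nhds t. f s = g s"
  shows "(g has_vector_derivative D) (at t)"
  using assms(1) has_vector_derivative_cong_ev[of UNIV f g t D] assms(2) eventually_nhds_x_imp_x[OF assms(2)]
  by simp

lemma has_vector_derivative_tendsto:
  assumes "(f has_vector_derivative D) (at t)"
  shows "(f \<longlongrightarrow> f t) (nhds t)"
  using has_vector_derivative_continuous[OF assms] tendsto_at_iff_tendsto_nhds[of f t]
  by (simp add: isCont_def)

lemma has_derivative_vector_compose:
  assumes "(f has_vector_derivative v) (at t)" "(g has_derivative g') (at (f t))"
  shows "((\<lambda>s. g (f s)) has_vector_derivative g' v) (at t)"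
  using vector_derivative_diff_chain_within[of f v t UNIV g g'] assms
  by (auto simp: o_def dest: has_derivative_at_withinI)

lemma tendsto_compose_eventually_mem:
  assumes "(f \<longlongrightarrow> l) F" "open W" "l \<in> W"
  shows "\<forall>\<^sub>F s in F. f s \<in> W"
  using assms topological_tendstoD by blast

lemma linear_apply_axis_sum:
  fixes f :: "real^'n \<Rightarrow> 'b::real_vector"
  assumes "linear f"
  shows "f v = (\<Sum>k\<in>UNIV. v $ k *\<^sub>R f (axis k 1))"
proof -
  have "f (\<Sum>k\<in>UNIV. v $ k *\<^sub>R axis k 1) = (\<Sum>k\<in>UNIV. v $ k *\<^sub>R f (axis k 1))"
    by (simp add: linear_sum[OF assms] linear_scale[OF assms])
  moreover have "(\<Sum>k\<in>UNIV. v $ k *\<^sub>R axis k 1) = v"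
    by (simp add: vec_eq_iff axis_def if_distrib cong: if_cong)
  ultimately show ?thesis by simp
qed

lemma scalar_prod_bilinear: "bounded_bilinear (scalar_prod (G :: real^'n^'n))"
proof -
  have "bilinear (scalar_prod G)"
    unfolding bilinear_def scalar_prod_def
    by (auto intro!: linearI simp: algebra_simps sum.distrib sum_distrib_left)
  then show ?thesis by (simp add: bilinear_conv_bounded_bilinear)
qed

interpretation scalar_prod: bounded_bilinear "scalar_prod (G :: real^'n^'n)" for G
  by (rule scalar_prod_bilinear)

section \<open>Transition maps and changes of chart\<close>

context smooth_manifold
begin

lemma open_cdom: "c \<in> atlas \<Longrightarrow> open (cdom c)"
  and coord_homeomorphism: "c \<in> atlas \<Longrightarrow> homeomorphism (cdom c) (coord c ` cdom c) (coord c) (cinv c)"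
  and open_coord_cdom: "c \<in> atlas \<Longrightarrow> open (coord c ` cdom c)"
  using charts by (auto simp: is_chart_def)

lemma cinv_coord [simp]: "c \<in> atlas \<Longrightarrow> p \<in> cdom c \<Longrightarrow> cinv c (coord c p) = p"
  using coord_homeomorphism by (auto simp: homeomorphism_def)

lemma coord_cinv:
  assumes "c \<in> atlas" "x \<in> coord c ` cdom c"
  shows "cinv c x \<in> cdom c" "coord c (cinv c x) = x"
  using assms coord_homeomorphism[OF assms(1)] by (auto simp: homeomorphism_def)

lemma continuous_on_coord: "c \<in> atlas \<Longrightarrow> continuous_on (cdom c) (coord c)"
  and continuous_on_cinv: "c \<in> atlas \<Longrightarrow> continuous_on (coord c ` cdom c) (cinv c)"
  using coord_homeomorphism by (auto simp: homeomorphism_def)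

lemma open_coord_image:
  assumes "c \<in> atlas" "open W"
  shows "open (coord c ` (cdom c \<inter> W))"
proof -
  have "coord c ` (cdom c \<inter> W) = coord c ` cdom c \<inter> cinv c -` W"
    using assms(1) by force
  then show ?thesis
    using continuous_open_preimage[OF continuous_on_cinv[OF assms(1)] open_coord_cdom[OF assms(1)] assms(2)]
    by (simp add: vimage_def)
qed

lemma open_overlap: "c \<in> atlas \<Longrightarrow> d \<in> atlas \<Longrightarrow> open (coord c ` (cdom c \<inter> cdom d))"
  using open_coord_image open_cdom by blast

lemma trans_map_coord [simp]: "c \<in> atlas \<Longrightarrow> p \<in> cdom c \<Longrightarrow> trans_map c d (coord c p) = coord d p"
  by (simp add: trans_map_def)

lemma trans_map_smooth:
  "c \<in> atlas \<Longrightarrow> d \<in> atlas \<Longrightarrow> smooth_on (coord c ` (cdom c \<inter> cdom d)) (trans_map c d)"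
  using compatible by (auto simp: compatible_def)

lemma trans_map_has_derivative:
  assumes "c \<in> atlas" "d \<in> atlas" "p \<in> cdom c" "p \<in> cdom d"
  shows "(trans_map c d has_derivative jac c d (coord c p)) (at (coord c p))"
  unfolding jac_def using assms by (intro smooth_on_has_derivative[OF trans_map_smooth]) auto

lemma linear_jac:
  assumes "c \<in> atlas" "d \<in> atlas" "p \<in> cdom c" "p \<in> cdom d"
  shows "linear (jac c d (coord c p))"
  using trans_map_has_derivative[OF assms] has_derivative_linear by blast

text \<open>Chain rule: close to \<open>coord c p\<close> the transition map from c to e factors
  through d.\<close>

lemma jac_comp:
  assumes "c \<in> atlas" "d \<in> atlas" "e \<in> atlas" "p \<in> cdom c" "p \<in> cdom d" "p \<in> cdom e"
  shows "jac d e (coord d p) (jac c d (coord c p) X) = jac c e (coord c p) X"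
proof -
  have "((\<lambda>x. trans_map d e (trans_map c d x)) has_derivative
      (\<lambda>X. jac d e (coord d p) (jac c d (coord c p) X))) (at (coord c p))"
    using assms trans_map_has_derivative[of d e p]
    by (intro has_derivative_compose[OF trans_map_has_derivative]) auto
  then have "(trans_map c e has_derivative (\<lambda>X. jac d e (coord d p) (jac c d (coord c p) X))) (at (coord c p))"
  proof (rule has_derivative_transform_within_open)
    show "open (coord c ` (cdom c \<inter> cdom d))" using assms open_overlap by blast
    show "coord c p \<in> coord c ` (cdom c \<inter> cdom d)" using assms by auto
  qed (use assms in auto)
  then show ?thesis
    using has_derivative_unique[OF trans_map_has_derivative[OF assms(1,3,4,6)]] by metis
qed

lemma jac_self:
  assumes "c \<in> atlas" "p \<in> cdom c"
  shows "jac c c (coord c p) X = X"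
proof -
  have "(trans_map c c has_derivative (\<lambda>X. X)) (at (coord c p))"
    by (rule has_derivative_transform_within_open[OF has_derivative_ident open_coord_cdom[OF assms(1)]])
       (use assms in auto)
  then show ?thesis
    using has_derivative_unique[OF trans_map_has_derivative[OF assms(1,1,2,2)]] by metis
qed

lemma jac_inverse:
  assumes "c \<in> atlas" "d \<in> atlas" "p \<in> cdom c" "p \<in> cdom d"
  shows "jac d c (coord d p) (jac c d (coord c p) X) = X"
  using jac_comp[OF assms(1,2,1,3,4,3)] jac_self assms by simp

lemma coord_curve_change:
  assumes "c \<in> atlas" "d \<in> atlas" "\<sigma> t \<in> cdom d"
    and "\<forall>\<^sub>F s in nhds t. \<sigma> s \<in> cdom c"
    and "((\<lambda>s. coord c (\<sigma> s)) has_vector_derivative v) (at t)"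
  shows "((\<lambda>s. coord d (\<sigma> s)) has_vector_derivative jac c d (coord c (\<sigma> t)) v) (at t)"
proof -
  have "\<sigma> t \<in> cdom c" using assms(4) eventually_nhds_x_imp_x by fast
  then have "((\<lambda>s. trans_map c d (coord c (\<sigma> s))) has_vector_derivative jac c d (coord c (\<sigma> t)) v) (at t)"
    using has_derivative_vector_compose[OF assms(5) trans_map_has_derivative] assms by blast
  then show ?thesis
    by (rule has_vector_derivative_cong_eventually) (use assms in \<open>auto elim!: eventually_mono\<close>)
qed

text \<open>The curve itself is not assumed continuous. What is known is one coordinate
  representation, whose continuity is carried back by the homeomorphism of the chart.\<close>

lemma curve_eventually_in_open:
  assumes "c \<in> atlas" "open W" "\<sigma> t \<in> W"
    and "\<forall>\<^sub>F s in nhds t. \<sigma> s \<in> cdom c" "((\<lambda>s. coord c (\<sigma> s)) has_vector_derivative v) (at t)"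
  shows "\<forall>\<^sub>F s in nhds t. \<sigma> s \<in> W"
proof -
  have \<sigma>c: "\<sigma> t \<in> cdom c" using assms(4) eventually_nhds_x_imp_x by fast
  then have "\<forall>\<^sub>F s in nhds t. coord c (\<sigma> s) \<in> coord c ` (cdom c \<inter> W)"
    using open_coord_image[OF assms(1,2)] \<sigma>c assms(3)
    by (intro tendsto_compose_eventually_mem[OF has_vector_derivative_tendsto[OF assms(5)]]) auto
  then show ?thesis using assms(4)
    by eventually_elim (use assms(1) in \<open>metis (no_types, lifting) IntD1 IntD2 cinv_coord imageE\<close>)
qed

lemmas curve_eventually_in_chart = curve_eventually_in_open[OF _ open_cdom]

text \<open>Meant for velocities, whose transformation rule involves a Jacobian that moves with the
  curve. On each axis vector the Jacobian is a smooth function of the point, and the product rule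
  does the rest; later only the existence of the derivative matters.\<close>

lemma vector_jac_has_derivative:
  assumes "c \<in> atlas" "d \<in> atlas" "\<sigma> t \<in> cdom d"
    and \<sigma>: "\<forall>\<^sub>F s in nhds t. \<sigma> s \<in> cdom c"
      "((\<lambda>s. coord c (\<sigma> s)) has_vector_derivative v) (at t)"
    and w: "(w has_vector_derivative w') (at t)"
  shows "\<exists>D. ((\<lambda>s. jac c d (coord c (\<sigma> s)) (w s)) has_vector_derivative D) (at t)"
proof -
  have \<sigma>c: "\<sigma> t \<in> cdom c" using \<sigma>(1) eventually_nhds_x_imp_x by fast
  have "\<exists>D. ((\<lambda>s. jac c d (coord c (\<sigma> s)) (axis k 1)) has_vector_derivative D) (at t)" for k
  proof -
    have "coord c (\<sigma> t) \<in> coord c ` (cdom c \<inter> cdom d)" using \<sigma>c assms(3) by auto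
    from has_derivative_vector_compose[OF \<sigma>(2) smooth_on_has_derivative[OF
        smooth_on_frechet_derivative[OF trans_map_smooth[OF assms(1,2)]] this]]
    show ?thesis unfolding jac_def by blast
  qed
  then obtain J where J: "\<And>k. ((\<lambda>s. jac c d (coord c (\<sigma> s)) (axis k 1)) has_vector_derivative J k) (at t)"
    by metis
  have 1: "((\<lambda>s. \<Sum>k\<in>UNIV. w s $ k *\<^sub>R jac c d (coord c (\<sigma> s)) (axis k 1)) has_vector_derivative
      (\<Sum>k\<in>UNIV. w t $ k *\<^sub>R J k + w' $ k *\<^sub>R jac c d (coord c (\<sigma> t)) (axis k 1))) (at t)"
    by (intro has_vector_derivative_sum bounded_bilinear.has_vector_derivative[OF bounded_bilinear_scaleR] J
        bounded_linear.has_vector_derivative[OF bounded_linear_vec_nth w])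
  have 2: "\<forall>\<^sub>F s in nhds t. (\<Sum>k\<in>UNIV. w s $ k *\<^sub>R jac c d (coord c (\<sigma> s)) (axis k 1))
      = jac c d (coord c (\<sigma> s)) (w s)"
    using \<sigma>(1) curve_eventually_in_chart[OF assms(1-5)]
    by eventually_elim (rule linear_apply_axis_sum[symmetric], use linear_jac assms(1,2) in blast)
  from has_vector_derivative_cong_eventually[OF 1 2] show ?thesis by (rule exI)
qed

text \<open>By maximality of the atlas, a chart followed by a diffeomorphism of the coordinate space
  is again a chart. This will straighten a curved hypersurface, and \<open>W\<close> restricts the
  new chart to a piece of it.\<close>

lemma atlas_modify:
  assumes c: "c \<in> atlas" and W: "open W"
    and \<psi>: "smooth_on UNIV \<psi>" and \<theta>: "smooth_on UNIV \<theta>"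
    and inv: "\<And>x. \<theta> (\<psi> x) = x" "\<And>y. \<psi> (\<theta> y) = y"
  shows "(cdom c \<inter> W, \<lambda>p. \<psi> (coord c p)) \<in> atlas"
proof -
  define d :: "('a, 'n) chart" where "d = (cdom c \<inter> W, \<lambda>p. \<psi> (coord c p))"
  have dd: "cdom d = cdom c \<inter> W" "\<And>p. coord d p = \<psi> (coord c p)" by (auto simp: d_def)
  have cont: "continuous_on UNIV \<psi>" "continuous_on UNIV \<theta>"
    using \<psi> \<theta> smooth_on_continuous by blast+
  \<comment> \<open>Images under the new coordinates become preimages under \<theta>, so openness
    follows from continuity of \<theta>.\<close>
  have im: "coord d ` V = \<theta> -` (coord c ` V)" for V
    by (auto simp: dd inv image_iff) (metis inv(2))
  have op: "open (coord d ` (cdom d \<inter> V))" if "open V" for V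
  proof -
    have "open (coord c ` (cdom c \<inter> (W \<inter> V)))" using open_coord_image[OF c] W that by blast
    then have "open (\<theta> -` (coord c ` (cdom c \<inter> (W \<inter> V))))"
      using continuous_open_vimage cont(2) by (metis continuous_on_eq_continuous_at open_UNIV UNIV_I)
    then show ?thesis by (simp only: im dd(1) Int_assoc)
  qed
  have cinv: "cinv d y = cinv c (\<theta> y)" if y: "y \<in> coord d ` cdom d" for y
  proof -
    obtain p where p: "p \<in> cdom d" "y = coord d p" using y by blast
    have "inj_on (coord d) (cdom d)"
      by (rule inj_onI) (metis dd IntD1 c cinv_coord inv(1))
    then have "cinv d y = p" using p by (simp add: cinv_def inv_into_f_f)
    then show ?thesis using p c by (simp add: dd inv)
  qed
  have ch: "is_chart d"
    unfolding is_chart_def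
  proof (intro conjI)
    show "open (cdom d)" using open_cdom[OF c] W by (auto simp: dd)
    show "open (coord d ` cdom d)" using op[of UNIV] by simp
    show "homeomorphism (cdom d) (coord d ` cdom d) (coord d) (cinv d)"
      unfolding homeomorphism_def
    proof (intro conjI ballI)
      show cd: "cinv d (coord d p) = p" if "p \<in> cdom d" for p
        using cinv[of "coord d p"] that c by (auto simp: dd inv)
      then show "coord d (cinv d y) = y" if "y \<in> coord d ` cdom d" for y using that by auto
      show "cinv d ` coord d ` cdom d = cdom d" using cd by force
      show "continuous_on (cdom d) (coord d)"
        using continuous_on_subset[OF continuous_on_coord[OF c], of "cdom d"]
        by (auto simp: dd cong: continuous_on_cong intro!: continuous_on_compose2[OF cont(1)])
      have "continuous_on (coord d ` cdom d) (\<lambda>y. cinv c (\<theta> y))"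
        by (rule continuous_on_compose2[OF continuous_on_cinv[OF c] continuous_on_subset[OF cont(2)]])
           (auto simp: dd inv)
      then show "continuous_on (coord d ` cdom d) (cinv d)"
        using cinv by (simp cong: continuous_on_cong)
    qed auto
  qed
  have "compatible d e" if e: "e \<in> atlas" for e
    unfolding compatible_def
  proof
    have o: "open (coord d ` (cdom d \<inter> cdom e))" using op open_cdom[OF e] by blast
    have "smooth_on (coord d ` (cdom d \<inter> cdom e)) (\<lambda>y. trans_map c e (\<theta> y))"
      by (rule smooth_on_compose[OF o open_overlap[OF c e] _ trans_map_smooth[OF c e] smooth_on_subset[OF \<theta>]])
         (auto simp: dd inv)
    then show "smooth_on (coord d ` (cdom d \<inter> cdom e)) (trans_map d e)"
      by (rule smooth_on_cong[OF o, rotated]) (use cinv in \<open>auto simp: trans_map_def\<close>)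
    have o': "open (coord e ` (cdom d \<inter> cdom e))"
      using open_coord_image[OF e, of "cdom d"] ch by (simp add: is_chart_def Int_commute)
    have sub: "coord e ` (cdom d \<inter> cdom e) \<subseteq> coord e ` (cdom e \<inter> cdom c)" by (auto simp: dd)
    have "smooth_on (coord e ` (cdom d \<inter> cdom e)) (\<lambda>y. \<psi> (trans_map e c y))"
      by (rule smooth_on_compose[OF o' open_UNIV _ \<psi> smooth_on_subset[OF trans_map_smooth[OF e c] sub]]) auto
    then show "smooth_on (coord e ` (cdom d \<inter> cdom e)) (trans_map e d)"
      by (simp add: trans_map_def[abs_def] dd)
  qed
  then show ?thesis using maximal[OF ch] by (simp add: d_def)
qed

section \<open>Slice coordinates on a hypersurface, and tangency\<close>

lemma bounded_linear_flat: "bounded_linear (flat (i :: 'n))"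
  unfolding flat_def by (auto intro!: linear_conv_bounded_linear[THEN iffD1] linearI simp: vec_eq_iff)

lemma open_slice_dom: "c \<in> atlas \<Longrightarrow> open (slice_dom c i)"
  using continuous_open_vimage[OF open_coord_cdom linear_continuous_at[OF bounded_linear_flat]]
  by (simp add: slice_dom_def vimage_def)

lemma slice_chart_atlas: "slice_chart S c i \<Longrightarrow> c \<in> atlas"
  by (simp add: slice_chart_def)

lemma slice_param_props:
  assumes "slice_chart S c i" "u \<in> slice_dom c i"
  shows "slice_param c i u \<in> S" "slice_param c i u \<in> cdom c" "coord c (slice_param c i u) = flat i u"
proof -
  have x: "flat i u \<in> coord c ` cdom c" using assms(2) by (simp add: slice_dom_def)
  show "slice_param c i u \<in> cdom c" "coord c (slice_param c i u) = flat i u"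
    using coord_cinv[OF slice_chart_atlas[OF assms(1)] x] by (auto simp: slice_param_def)
  then have "slice_param c i u \<in> {q \<in> cdom c. coord c q $ i = 0}" by (simp add: flat_def)
  also have "\<dots> = S \<inter> cdom c" using assms(1) by (simp add: slice_chart_def)
  finally show "slice_param c i u \<in> S" by simp
qed

lemma slice_param_coord:
  assumes "slice_chart S c i" "p \<in> S" "p \<in> cdom c"
  shows "coord c p \<in> slice_dom c i" "slice_param c i (coord c p) = p" "coord c p $ i = 0"
proof -
  have "p \<in> S \<inter> cdom c" using assms by simp
  also have "\<dots> = {q \<in> cdom c. coord c q $ i = 0}" using assms(1) by (simp add: slice_chart_def)
  finally show 0: "coord c p $ i = 0" by simp
  then have "flat i (coord c p) = coord c p" by (auto simp: flat_def vec_eq_iff)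
  then show "coord c p \<in> slice_dom c i" "slice_param c i (coord c p) = p"
    using assms slice_chart_atlas by (auto simp: slice_dom_def slice_param_def)
qed

text \<open>The i-th coordinate vanishes identically along the curve. This is how tangency to a
  hypersurface and to its shifted copies is used.\<close>

lemma curve_in_slice:
  assumes "slice_chart S c i" "\<forall>\<^sub>F s in nhds t. \<sigma> s \<in> S" "\<forall>\<^sub>F s in nhds t. \<sigma> s \<in> cdom c"
    and "((\<lambda>s. coord c (\<sigma> s)) has_vector_derivative v) (at t)"
  shows "v $ i = 0"
proof -
  have "((\<lambda>s. coord c (\<sigma> s) $ i) has_vector_derivative v $ i) (at t)"
    by (rule bounded_linear.has_vector_derivative[OF bounded_linear_vec_nth assms(4)])
  moreover have "\<forall>\<^sub>F s in nhds t. coord c (\<sigma> s) $ i = 0"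
    using assms(2,3) by eventually_elim (use slice_param_coord(3)[OF assms(1)] in auto)
  ultimately have "((\<lambda>s. 0) has_vector_derivative v $ i) (at t)"
    by (rule has_vector_derivative_cong_eventually)
  then show ?thesis
    using vector_derivative_unique_at has_vector_derivative_const by blast
qed

lemma slice_line_eventually:
  assumes "c \<in> atlas" "u \<in> slice_dom c i"
  shows "\<forall>\<^sub>F s in nhds (0::real). u + s *\<^sub>R w \<in> slice_dom c i"
  by (rule tendsto_compose_eventually_mem[OF _ open_slice_dom[OF assms(1)], of _ u])
     (use assms(2) in \<open>auto intro!: tendsto_eq_intros filterlim_ident\<close>)

lemma slice_line_has_derivative:
  assumes "slice_chart S c i" "u \<in> slice_dom c i"
  shows "((\<lambda>s. coord c (slice_param c i (u + s *\<^sub>R w))) has_vector_derivative flat i w) (at 0)"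
proof (rule has_vector_derivative_cong_eventually)
  show "((\<lambda>s. flat i (u + s *\<^sub>R w)) has_vector_derivative flat i w) (at 0)"
    by (rule bounded_linear.has_vector_derivative[OF bounded_linear_flat]) (auto intro!: derivative_eq_intros)
  show "\<forall>\<^sub>F s in nhds 0. flat i (u + s *\<^sub>R w) = coord c (slice_param c i (u + s *\<^sub>R w))"
    using slice_line_eventually[OF slice_chart_atlas[OF assms(1)] assms(2), of w]
    by eventually_elim (use slice_param_props[OF assms(1)] in auto)
qed

lemma tangent_vectorD:
  "tangent_vector p X \<Longrightarrow> c \<in> atlas \<Longrightarrow> d \<in> atlas \<Longrightarrow> p \<in> cdom c \<Longrightarrow> p \<in> cdom d \<Longrightarrow>
    X d = jac c d (coord c p) (X c)"
  unfolding tangent_vector_def by blast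

text \<open>By the cocycle rule \<open>jac_comp\<close>, comparison with one reference chart
  suffices.\<close>

lemma tangent_vectorI:
  assumes c: "c \<in> atlas" "p \<in> cdom c"
    and X: "\<And>d. d \<in> atlas \<Longrightarrow> p \<in> cdom d \<Longrightarrow> X d = jac c d (coord c p) (X c)"
  shows "tangent_vector p X"
  unfolding tangent_vector_def
proof (intro ballI impI)
  fix d e assume d: "d \<in> atlas" "e \<in> atlas" "p \<in> cdom d \<inter> cdom e"
  then show "X e = jac d e (coord d p) (X d)"
    using X[of d] X[of e] jac_comp[OF c(1) d(1,2) c(2)] by simp
qed

end


section \<open>Local Riemannian geometry\<close>

text \<open>Common shape of the metric and of each component of the Christoffel symbols, so that one
  product rule serves both.\<close>

definition bil :: "('n \<Rightarrow> 'n \<Rightarrow> real) \<Rightarrow> real^'n \<Rightarrow> real^'n \<Rightarrow> real" where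
  "bil a X Y = (\<Sum>i\<in>UNIV. \<Sum>j\<in>UNIV. a i j * X $ i * Y $ j)"

lemma bilinear_bil: "bilinear (bil a)"
  unfolding bilinear_def bil_def
  by (auto intro!: linearI simp: algebra_simps sum.distrib sum_distrib_left)

lemma bil_has_derivative:
  assumes a: "\<And>i j. ((\<lambda>t. a t i j) has_derivative a' i j) (at t)"
    and X: "(X has_derivative X') (at t)" and Y: "(Y has_derivative Y') (at t)"
  shows "((\<lambda>t. bil (a t) (X t) (Y t)) has_derivative
    (\<lambda>h. bil (\<lambda>i j. a' i j h) (X t) (Y t) + bil (a t) (X' h) (Y t) + bil (a t) (X t) (Y' h))) (at t)"
proof -
  have X: "((\<lambda>t. X t $ i) has_derivative (\<lambda>h. X' h $ i)) (at t)" for i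
    by (rule bounded_linear.has_derivative[OF bounded_linear_vec_nth X])
  have Y: "((\<lambda>t. Y t $ i) has_derivative (\<lambda>h. Y' h $ i)) (at t)" for i
    by (rule bounded_linear.has_derivative[OF bounded_linear_vec_nth Y])
  have "((\<lambda>t. bil (a t) (X t) (Y t)) has_derivative (\<lambda>h. \<Sum>i\<in>UNIV. \<Sum>j\<in>UNIV.
      a t i j * X t $ i * Y' h $ j + (a t i j * X' h $ i + a' i j h * X t $ i) * Y t $ j)) (at t)"
    unfolding bil_def by (intro has_derivative_sum has_derivative_mult a X Y)
  then show ?thesis
    by (rule has_derivative_eq_rhs) (simp add: bil_def sum.distrib algebra_simps fun_eq_iff)
qed

section \<open>Christoffel symbols without indices, metric compatibility, curvature\<close>

context riemannian_manifold
begin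

text \<open>The Christoffel symbols as a vector-valued bilinear map; together with
  \<open>DGam\<close>, its derivative in the base point with both arguments frozen, it allows
  calculations without indices.\<close>

definition Gam :: "('a, 'n) chart \<Rightarrow> real^'n \<Rightarrow> real^'n \<Rightarrow> real^'n \<Rightarrow> real^'n" where
  "Gam c x X Y = (\<chi> k. bil (Christoffel c x k) X Y)"

definition DGam :: "('a, 'n) chart \<Rightarrow> real^'n \<Rightarrow> real^'n \<Rightarrow> real^'n \<Rightarrow> real^'n \<Rightarrow> real^'n" where
  "DGam c x h X Y =
    (\<chi> k. bil (\<lambda>i j. frechet_derivative (\<lambda>y. Christoffel c y k i j) (at x) h) X Y)"

lemma nabla_t_Gam:
  "nabla_t c \<gamma> X t = vector_derivative X (at t) + Gam c (coord c (\<gamma> t)) (vel c \<gamma> t) (X t)"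
  by (simp add: nabla_t_def Gam_def bil_def)

lemma scalar_prod_bil: "scalar_prod G = bil (\<lambda>i j. G $ i $ j)"
  by (simp add: fun_eq_iff scalar_prod_def bil_def)

lemma Gam_bilinear: "bounded_bilinear (Gam c x)"
proof -
  have "bilinear (Gam c x)"
    unfolding bilinear_def linear_iff Gam_def
    by (simp add: vec_eq_iff bilinear_ladd[OF bilinear_bil] bilinear_radd[OF bilinear_bil]
        bilinear_lmul[OF bilinear_bil] bilinear_rmul[OF bilinear_bil])
  then show ?thesis by (simp add: bilinear_conv_bounded_bilinear)
qed

lemma metric_nth_smooth:
  "c \<in> atlas \<Longrightarrow> smooth_on (coord c ` cdom c) (\<lambda>x. g c x $ i $ j)"
  by (intro smooth_on_nth open_coord_cdom metric_smooth)

lemma scalar_prod_sym: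
  assumes "c \<in> atlas" "x \<in> coord c ` cdom c"
  shows "scalar_prod (g c x) X Y = scalar_prod (g c x) Y X"
  unfolding scalar_prod_def
  by (subst sum.swap) (simp add: metric_sym[OF assms] mult_ac)

lemma scalar_prod_inner: "scalar_prod G X Y = X \<bullet> (G *v Y)"
  by (simp add: scalar_prod_def inner_vec_def matrix_vector_mult_def sum_distrib_left mult_ac)

text \<open>A vector in the kernel would have length zero.\<close>

lemma metric_invertible:
  assumes "c \<in> atlas" "x \<in> coord c ` cdom c"
  shows "invertible (g c x)"
proof -
  have "X = 0" if "g c x *v X = 0" for X
    using metric_pos[OF assms, of X] that by (force simp: scalar_prod_inner)
  then have "\<exists>B. B ** g c x = mat 1" using matrix_left_invertible_ker by blast
  then show ?thesis using invertible_left_inverse by blast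
qed

lemma Christoffel_smooth:
  assumes "c \<in> atlas"
  shows "smooth_on (coord c ` cdom c) (\<lambda>x. Christoffel c x k i j)"
  unfolding Christoffel_def pd_def using assms
  by (intro smooth_on_sum smooth_on_mult smooth_on_add smooth_on_diff smooth_on_const
      smooth_on_matrix_inv smooth_on_frechet_derivative metric_nth_smooth open_coord_cdom
      metric_invertible) auto

lemma pd_metric_sym:
  assumes "c \<in> atlas" "x \<in> coord c ` cdom c"
  shows "pd l (\<lambda>y. g c y $ i $ j) x = pd l (\<lambda>y. g c y $ j $ i) x"
proof -
  have "(\<lambda>y. g c y $ i $ j) differentiable (at x)"
    using smooth_on_has_derivative[OF metric_nth_smooth[OF assms(1)] assms(2)]
    unfolding differentiable_def by blast
  from frechet_derivative_transform_within_open[OF this open_coord_cdom[OF assms(1)] assms(2),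
      of "\<lambda>y. g c y $ j $ i"]
  show ?thesis unfolding pd_def using metric_sym[OF assms(1)] by simp
qed

lemma Christoffel_sym:
  assumes "c \<in> atlas" "x \<in> coord c ` cdom c"
  shows "Christoffel c x k i j = Christoffel c x k j i"
  unfolding Christoffel_def
  using pd_metric_sym[OF assms] by (intro sum.cong refl) (simp add: algebra_simps)

lemma Gam_sym:
  assumes "c \<in> atlas" "x \<in> coord c ` cdom c"
  shows "Gam c x X Y = Gam c x Y X"
proof -
  have "bil (Christoffel c x k) X Y = bil (Christoffel c x k) Y X" for k
    unfolding bil_def by (subst sum.swap) (simp add: Christoffel_sym[OF assms, of k] mult_ac)
  then show ?thesis by (simp add: Gam_def)
qed

text \<open>Lowering the index cancels the inverse metric and leaves the Christoffel symbols of the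
  first kind.\<close>

lemma lower_Christoffel:
  assumes "c \<in> atlas" "x \<in> coord c ` cdom c"
  shows "(\<Sum>k\<in>UNIV. g c x $ a $ k * Christoffel c x k i j) = 1/2 *
     (pd i (\<lambda>y. g c y $ a $ j) x + pd j (\<lambda>y. g c y $ i $ a) x - pd a (\<lambda>y. g c y $ i $ j) x)"
proof -
  define T where "T l = 1/2 * (pd i (\<lambda>y. g c y $ l $ j) x + pd j (\<lambda>y. g c y $ i $ l) x - pd l (\<lambda>y. g c y $ i $ j) x)" for l
  have "g c x ** matrix_inv (g c x) = mat 1"
    using metric_invertible[OF assms] unfolding invertible_def matrix_inv_def
    by (metis (mono_tags, lifting) someI_ex)
  then have inv: "(\<Sum>k\<in>UNIV. g c x $ a $ k * matrix_inv (g c x) $ k $ l) = (if a = l then 1 else 0)" for l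
    by (auto simp: matrix_matrix_mult_def mat_def vec_eq_iff)
  have "(\<Sum>k\<in>UNIV. g c x $ a $ k * Christoffel c x k i j) =
      (\<Sum>k\<in>UNIV. \<Sum>l\<in>UNIV. g c x $ a $ k * matrix_inv (g c x) $ k $ l * T l)"
    unfolding Christoffel_def T_def by (simp add: sum_distrib_left mult_ac)
  also have "\<dots> = (\<Sum>l\<in>UNIV. (\<Sum>k\<in>UNIV. g c x $ a $ k * matrix_inv (g c x) $ k $ l) * T l)"
    by (subst sum.swap) (simp add: sum_distrib_right)
  also have "\<dots> = T a" by (simp add: inv if_distrib[of "\<lambda>z. z * _"] cong: if_cong)
  finally show ?thesis by (simp add: T_def)
qed

text \<open>This is \<nabla>g = 0: in the sum of the two symbols of the first kind all terms cancel
  by symmetry except two equal halves.\<close>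

lemma metric_compatible_index:
  assumes "c \<in> atlas" "x \<in> coord c ` cdom c"
  shows "pd l (\<lambda>y. g c y $ i $ j) x = (\<Sum>k\<in>UNIV. g c x $ j $ k * Christoffel c x k l i)
      + (\<Sum>k\<in>UNIV. g c x $ i $ k * Christoffel c x k l j)"
  unfolding lower_Christoffel[OF assms]
  using pd_metric_sym[OF assms, of l i j] pd_metric_sym[OF assms, of i l j] pd_metric_sym[OF assms, of j l i]
  by (simp add: field_simps)

lemma metric_compatible:
  assumes "c \<in> atlas" "x \<in> coord c ` cdom c"
  shows "bil (\<lambda>i j. frechet_derivative (\<lambda>y. g c y $ i $ j) (at x) w) X Y
    = scalar_prod (g c x) (Gam c x w X) Y + scalar_prod (g c x) X (Gam c x w Y)"
proof -
  have D: "frechet_derivative (\<lambda>y. g c y $ i $ j) (at x) w = (\<Sum>l\<in>UNIV. w $ l * pd l (\<lambda>y. g c y $ i $ j) x)" for i j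
    unfolding pd_def real_scaleR_def[symmetric]
    by (rule linear_apply_axis_sum[OF has_derivative_linear[OF smooth_on_has_derivative[OF metric_nth_smooth[OF assms(1)] assms(2)]]])
  have e: "(\<Sum>l\<in>UNIV. \<Sum>i\<in>UNIV. \<Sum>j\<in>UNIV. w $ l * X $ i * Y $ j * (\<Sum>k\<in>UNIV. g c x $ j $ k * Christoffel c x k l i))
      = scalar_prod (g c x) (Gam c x w X) Y" for X Y
  proof -
    have "scalar_prod (g c x) (Gam c x w X) Y = (\<Sum>j\<in>UNIV. \<Sum>k\<in>UNIV. g c x $ j $ k * Y $ j * Gam c x w X $ k)"
      using scalar_prod_sym[OF assms, of "Gam c x w X" Y] by (simp add: scalar_prod_def)
    also have "\<dots> = (\<Sum>j\<in>UNIV. \<Sum>k\<in>UNIV. \<Sum>l\<in>UNIV. \<Sum>i\<in>UNIV. w $ l * X $ i * Y $ j * (g c x $ j $ k * Christoffel c x k l i))"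
      unfolding Gam_def bil_def vec_lambda_beta sum_distrib_left
      by (intro sum.cong refl) (simp only: mult_ac)
    also have "\<dots> = (\<Sum>j\<in>UNIV. \<Sum>l\<in>UNIV. \<Sum>k\<in>UNIV. \<Sum>i\<in>UNIV. w $ l * X $ i * Y $ j * (g c x $ j $ k * Christoffel c x k l i))"
      by (rule sum.cong[OF refl], rule sum.swap)
    also have "\<dots> = (\<Sum>j\<in>UNIV. \<Sum>l\<in>UNIV. \<Sum>i\<in>UNIV. \<Sum>k\<in>UNIV. w $ l * X $ i * Y $ j * (g c x $ j $ k * Christoffel c x k l i))"
      by (rule sum.cong[OF refl], rule sum.cong[OF refl], rule sum.swap)
    also have "\<dots> = (\<Sum>l\<in>UNIV. \<Sum>j\<in>UNIV. \<Sum>i\<in>UNIV. \<Sum>k\<in>UNIV. w $ l * X $ i * Y $ j * (g c x $ j $ k * Christoffel c x k l i))"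
      by (rule sum.swap)
    also have "\<dots> = (\<Sum>l\<in>UNIV. \<Sum>i\<in>UNIV. \<Sum>j\<in>UNIV. \<Sum>k\<in>UNIV. w $ l * X $ i * Y $ j * (g c x $ j $ k * Christoffel c x k l i))"
      by (rule sum.cong[OF refl], rule sum.swap)
    finally show ?thesis by (simp add: sum_distrib_left)
  qed
  have "bil (\<lambda>i j. frechet_derivative (\<lambda>y. g c y $ i $ j) (at x) w) X Y
     = (\<Sum>i\<in>UNIV. \<Sum>j\<in>UNIV. \<Sum>l\<in>UNIV. w $ l * X $ i * Y $ j * pd l (\<lambda>y. g c y $ i $ j) x)"
    unfolding bil_def D sum_distrib_right by (intro sum.cong refl) (simp only: mult_ac)
  also have "\<dots> = (\<Sum>i\<in>UNIV. \<Sum>l\<in>UNIV. \<Sum>j\<in>UNIV. w $ l * X $ i * Y $ j * pd l (\<lambda>y. g c y $ i $ j) x)"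
    by (rule sum.cong[OF refl], rule sum.swap)
  also have "\<dots> = (\<Sum>l\<in>UNIV. \<Sum>i\<in>UNIV. \<Sum>j\<in>UNIV. w $ l * X $ i * Y $ j * pd l (\<lambda>y. g c y $ i $ j) x)"
    by (rule sum.swap)
  also have "\<dots> = (\<Sum>l\<in>UNIV. \<Sum>i\<in>UNIV. \<Sum>j\<in>UNIV. w $ l * X $ i * Y $ j * (\<Sum>k\<in>UNIV. g c x $ j $ k * Christoffel c x k l i))
     + (\<Sum>l\<in>UNIV. \<Sum>i\<in>UNIV. \<Sum>j\<in>UNIV. w $ l * X $ i * Y $ j * (\<Sum>k\<in>UNIV. g c x $ i $ k * Christoffel c x k l j))"
    unfolding metric_compatible_index[OF assms] by (simp add: distrib_left sum.distrib)
  \<comment> \<open>After renaming i and j the second half is the first with \<open>X\<close> and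
    \<open>Y\<close> exchanged, so \<open>e\<close> covers both.\<close>
  also have "(\<Sum>l\<in>UNIV. \<Sum>i\<in>UNIV. \<Sum>j\<in>UNIV. w $ l * X $ i * Y $ j * (\<Sum>k\<in>UNIV. g c x $ i $ k * Christoffel c x k l j))
     = (\<Sum>l\<in>UNIV. \<Sum>i\<in>UNIV. \<Sum>j\<in>UNIV. w $ l * Y $ i * X $ j * (\<Sum>k\<in>UNIV. g c x $ j $ k * Christoffel c x k l i))"
    by (rule sum.cong[OF refl], subst sum.swap) (intro sum.cong refl, simp only: mult_ac)
  finally show ?thesis unfolding e using scalar_prod_sym[OF assms, of "Gam c x w Y" X] by simp
qed

text \<open>The derivative of the metric coefficients is exactly what completes X' and Y' to
  covariant derivatives.\<close>

lemma metric_leibniz: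
  assumes c: "c \<in> atlas" "\<xi> t \<in> coord c ` cdom c"
    and x: "(\<xi> has_vector_derivative v) (at t)"
    and X: "(X has_vector_derivative X') (at t)" and Y: "(Y has_vector_derivative Y') (at t)"
  shows "((\<lambda>s. scalar_prod (g c (\<xi> s)) (X s) (Y s)) has_real_derivative
     scalar_prod (g c (\<xi> t)) (X' + Gam c (\<xi> t) v (X t)) (Y t)
     + scalar_prod (g c (\<xi> t)) (X t) (Y' + Gam c (\<xi> t) v (Y t))) (at t)"
proof -
  have "((\<lambda>s. g c (\<xi> s) $ i $ j) has_derivative
      (\<lambda>h. h * frechet_derivative (\<lambda>y. g c y $ i $ j) (at (\<xi> t)) v)) (at t)" for i j
    using has_derivative_vector_compose[OF x smooth_on_has_derivative[OF metric_nth_smooth[OF c(1)] c(2)]]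
    by (simp add: has_vector_derivative_def)
  from bil_has_derivative[OF this X[unfolded has_vector_derivative_def] Y[unfolded has_vector_derivative_def]]
  have "((\<lambda>s. scalar_prod (g c (\<xi> s)) (X s) (Y s)) has_derivative
     (\<lambda>h. h * (bil (\<lambda>i j. frechet_derivative (\<lambda>y. g c y $ i $ j) (at (\<xi> t)) v) (X t) (Y t)
       + scalar_prod (g c (\<xi> t)) X' (Y t) + scalar_prod (g c (\<xi> t)) (X t) Y'))) (at t)"
    unfolding scalar_prod_bil by (rule has_derivative_eq_rhs)
       (simp add: bil_def algebra_simps sum_distrib_left fun_eq_iff)
  then show ?thesis
    unfolding metric_compatible[OF c] has_field_derivative_def
    by (rule has_derivative_eq_rhs)
       (simp add: scalar_prod.add_left scalar_prod.add_right algebra_simps fun_eq_iff)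
qed

lemma Gam_leibniz:
  assumes c: "c \<in> atlas" "\<xi> t \<in> coord c ` cdom c"
    and x: "(\<xi> has_vector_derivative v) (at t)"
    and X: "(X has_vector_derivative X') (at t)" and Y: "(Y has_vector_derivative Y') (at t)"
  shows "((\<lambda>s. Gam c (\<xi> s) (X s) (Y s)) has_vector_derivative
     DGam c (\<xi> t) v (X t) (Y t) + Gam c (\<xi> t) X' (Y t) + Gam c (\<xi> t) (X t) Y') (at t)"
proof -
  have "((\<lambda>s. Christoffel c (\<xi> s) k i j) has_derivative
      (\<lambda>h. h * frechet_derivative (\<lambda>y. Christoffel c y k i j) (at (\<xi> t)) v)) (at t)" for i j k
    using has_derivative_vector_compose[OF x smooth_on_has_derivative[OF Christoffel_smooth[OF c(1)] c(2)]]
    by (simp add: has_vector_derivative_def)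
  from bil_has_derivative[OF this X[unfolded has_vector_derivative_def] Y[unfolded has_vector_derivative_def]]
  have "((\<lambda>s. Gam c (\<xi> s) (X s) (Y s) $ k) has_vector_derivative
     (DGam c (\<xi> t) v (X t) (Y t) + Gam c (\<xi> t) X' (Y t) + Gam c (\<xi> t) (X t) Y') $ k) (at t)" for k
    unfolding Gam_def DGam_def has_vector_derivative_def vec_lambda_beta vector_add_component
    by (rule has_derivative_eq_rhs)
       (simp add: bil_def algebra_simps sum_distrib_left fun_eq_iff)
  then show ?thesis
    unfolding has_vector_derivative_def
    by (subst has_derivative_componentwise_within) (auto simp: Basis_vec_def inner_axis)
qed

text \<open>Passage from indices to operators, the form in which the curvature will be recognised
  inside second covariant derivatives.\<close>

lemma curvature_op:
  assumes "c \<in> atlas" "x \<in> coord c ` cdom c"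
  shows "(\<Sum>m\<in>UNIV. \<Sum>i\<in>UNIV. \<Sum>j\<in>UNIV. curvature c x k m i j * X $ i * Y $ j * Z $ m)
    = (DGam c x X Y Z - DGam c x Y X Z + Gam c x X (Gam c x Y Z) - Gam c x Y (Gam c x X Z)) $ k"
proof -
  have D: "frechet_derivative (\<lambda>y. Christoffel c y k i j) (at x) w
      = (\<Sum>l\<in>UNIV. w $ l * pd l (\<lambda>y. Christoffel c y k i j) x)" for i j w
    unfolding pd_def real_scaleR_def[symmetric]
    by (rule linear_apply_axis_sum[OF has_derivative_linear[OF smooth_on_has_derivative[OF Christoffel_smooth[OF assms(1)] assms(2)]]])
  let ?S = "\<lambda>f. \<Sum>m\<in>UNIV. \<Sum>i\<in>UNIV. \<Sum>j\<in>UNIV. f m i j :: real"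
  have 1: "DGam c x X Y Z $ k = ?S (\<lambda>m i j. pd i (\<lambda>y. Christoffel c y k j m) x * X $ i * Y $ j * Z $ m)" for X Y
  proof -
    have "DGam c x X Y Z $ k = (\<Sum>j\<in>UNIV. \<Sum>m\<in>UNIV. \<Sum>i\<in>UNIV. pd i (\<lambda>y. Christoffel c y k j m) x * X $ i * Y $ j * Z $ m)"
      unfolding DGam_def bil_def vec_lambda_beta D sum_distrib_right
      by (intro sum.cong refl) (simp only: mult_ac)
    also have "\<dots> = (\<Sum>m\<in>UNIV. \<Sum>j\<in>UNIV. \<Sum>i\<in>UNIV. pd i (\<lambda>y. Christoffel c y k j m) x * X $ i * Y $ j * Z $ m)"
      by (rule sum.swap)
    also have "\<dots> = ?S (\<lambda>m i j. pd i (\<lambda>y. Christoffel c y k j m) x * X $ i * Y $ j * Z $ m)"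
      by (rule sum.cong[OF refl], rule sum.swap)
    finally show ?thesis .
  qed
  have 2: "Gam c x X (Gam c x Y Z) $ k =
      ?S (\<lambda>m i j. (\<Sum>a\<in>UNIV. Christoffel c x k i a * Christoffel c x a j m) * X $ i * Y $ j * Z $ m)" for X Y
  proof -
    have "Gam c x X (Gam c x Y Z) $ k = (\<Sum>i\<in>UNIV. \<Sum>a\<in>UNIV. \<Sum>j\<in>UNIV. \<Sum>m\<in>UNIV.
        Christoffel c x k i a * Christoffel c x a j m * X $ i * Y $ j * Z $ m)"
      unfolding Gam_def bil_def vec_lambda_beta sum_distrib_left
      by (intro sum.cong refl) (simp only: mult_ac)
    also have "\<dots> = (\<Sum>i\<in>UNIV. \<Sum>j\<in>UNIV. \<Sum>a\<in>UNIV. \<Sum>m\<in>UNIV.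
        Christoffel c x k i a * Christoffel c x a j m * X $ i * Y $ j * Z $ m)"
      by (rule sum.cong[OF refl], rule sum.swap)
    also have "\<dots> = (\<Sum>i\<in>UNIV. \<Sum>j\<in>UNIV. \<Sum>m\<in>UNIV. \<Sum>a\<in>UNIV.
        Christoffel c x k i a * Christoffel c x a j m * X $ i * Y $ j * Z $ m)"
      by (rule sum.cong[OF refl], rule sum.cong[OF refl], rule sum.swap)
    also have "\<dots> = (\<Sum>i\<in>UNIV. \<Sum>m\<in>UNIV. \<Sum>j\<in>UNIV. \<Sum>a\<in>UNIV.
        Christoffel c x k i a * Christoffel c x a j m * X $ i * Y $ j * Z $ m)"
      by (rule sum.cong[OF refl], rule sum.swap)
    also have "\<dots> = (\<Sum>m\<in>UNIV. \<Sum>i\<in>UNIV. \<Sum>j\<in>UNIV. \<Sum>a\<in>UNIV.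
        Christoffel c x k i a * Christoffel c x a j m * X $ i * Y $ j * Z $ m)"
      by (rule sum.swap)
    finally show ?thesis by (simp add: sum_distrib_right)
  qed
  \<comment> \<open>The two subtracted terms carry i and j in the opposite order.\<close>
  have sw: "?S f = ?S (\<lambda>m j i. f m i j)" for f :: "'n \<Rightarrow> 'n \<Rightarrow> 'n \<Rightarrow> real"
    by (rule sum.cong[OF refl], rule sum.swap)
  show ?thesis
    unfolding vector_minus_component vector_add_component 1 2 curvature_def
      sw[of "\<lambda>m i j. pd i (\<lambda>y. Christoffel c y k j m) x * Y $ i * X $ j * Z $ m"]
      sw[of "\<lambda>m i j. (\<Sum>a\<in>UNIV. Christoffel c x k i a * Christoffel c x a j m) * Y $ i * X $ j * Z $ m"]
    by (simp add: sum.distrib sum_subtractf algebra_simps sum_distrib_left)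
qed

end


section \<open>Trajectories in charts\<close>

text \<open>Continuous induction away from \<open>t1\<close> in both directions at once, closed
  segments serving as the past. The good set is closed by \<open>lim\<close> and relatively open by
  \<open>ext\<close>, and the interval is connected. It will keep curves inside a chart.\<close>

lemma segment_continuation:
  fixes t1 :: real
  assumes t1: "t1 \<in> {a..b}" "P t1"
    and lim: "\<And>t. t \<in> {a..b} \<Longrightarrow> t \<noteq> t1 \<Longrightarrow> (\<forall>t'\<in>closed_segment t1 t - {t}. P t') \<Longrightarrow> P t"
    and ext: "\<And>t. t \<in> {a..b} \<Longrightarrow> (\<forall>t'\<in>closed_segment t1 t. P t') \<Longrightarrow> \<forall>\<^sub>F s in at t within {a..b}. P s"
    and t: "t \<in> {a..b}"
  shows "P t"
proof -
  define J where "J = {t\<in>{a..b}. \<forall>t'\<in>closed_segment t1 t. P t'}"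
  have "openin (top_of_set {a..b}) J"
    unfolding openin_contains_ball
  proof (intro conjI ballI)
    show "J \<subseteq> {a..b}" by (auto simp: J_def)
    fix t assume t: "t \<in> J"
    then obtain \<eta> where \<eta>: "\<eta> > 0" "\<And>s. s \<in> {a..b} \<Longrightarrow> s \<noteq> t \<Longrightarrow> dist s t < \<eta> \<Longrightarrow> P s"
      using ext[of t] by (auto simp: J_def eventually_at)
    have Pt: "P t" using t by (auto simp: J_def)
    have "s \<in> J" if s: "s \<in> ball t \<eta> \<inter> {a..b}" for s
    proof -
      have "P t'" if t': "t' \<in> closed_segment t1 s" for t'
      proof (cases "t' \<in> closed_segment t1 t")
        case True
        then show ?thesis using t by (auto simp: J_def)
      next
        case False
        then have "t' \<in> {a..b}" "dist t' t < \<eta>"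
          using t' s t t1(1) by (auto simp: closed_segment_eq_real_ivl dist_real_def J_def split: if_splits)
        then show ?thesis using \<eta>(2) Pt by (cases "t' = t") auto
      qed
      then show ?thesis using s by (auto simp: J_def)
    qed
    then show "\<exists>e>0. ball t e \<inter> {a..b} \<subseteq> J" using \<eta>(1) by blast
  qed
  moreover have "closed J"
    unfolding closed_sequential_limits
  proof (intro conjI allI impI)
    fix x l assume xJ: "(\<forall>n. x n \<in> J) \<and> x \<longlonglongrightarrow> l"
    have "x n \<in> {a..b}" for n using xJ unfolding J_def by blast
    then have "l \<in> {a..b}" using xJ closed_sequentially[OF closed_real_atLeastAtMost] by blast
    with xJ have x: "(\<forall>n. x n \<in> J) \<and> l \<in> {a..b} \<and> x \<longlonglongrightarrow> l" by blast
    have *: "P t'" if t': "t' \<in> closed_segment t1 l - {l}" for t'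
    proof -
      have "\<forall>\<^sub>F n in sequentially. t' \<in> closed_segment t1 (x n)"
      proof (cases "t1 \<le> l")
        case True
        then have "t1 \<le> t'" "t' < l" using t' by (auto simp: closed_segment_eq_real_ivl)
        moreover have "\<forall>\<^sub>F n in sequentially. t' < x n" using x \<open>t' < l\<close> order_tendstoD(1) by blast
        ultimately show ?thesis by (auto simp: closed_segment_eq_real_ivl elim!: eventually_mono)
      next
        case False
        then have "t' \<le> t1" "l < t'" using t' by (auto simp: closed_segment_eq_real_ivl)
        moreover have "\<forall>\<^sub>F n in sequentially. x n < t'" using x \<open>l < t'\<close> order_tendstoD(2) by blast
        ultimately show ?thesis by (auto simp: closed_segment_eq_real_ivl elim!: eventually_mono)
      qed
      then obtain n where "t' \<in> closed_segment t1 (x n)" using eventually_happens' sequentially_bot by blast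
      then show ?thesis using x by (auto simp: J_def)
    qed
    then have "P l" using lim[of l] x t1 by (cases "l = t1") auto
    then show "l \<in> J" using * x by (cases "l = t1") (auto simp: J_def)
  qed
  moreover have "J \<subseteq> {a..b}" by (auto simp: J_def)
  moreover have "t1 \<in> J" using t1 by (auto simp: J_def)
  ultimately have "J = {a..b}"
    using connected_clopen[of "{a..b}"] connected_Icc closed_subset by blast
  then show ?thesis using t by (auto simp: J_def)
qed

lemma has_vector_derivative_Pair_fst_snd:
  "(f has_vector_derivative D) (at x within S) \<longleftrightarrow>
    ((\<lambda>t. fst (f t)) has_vector_derivative fst D) (at x within S) \<and>
    ((\<lambda>t. snd (f t)) has_vector_derivative snd D) (at x within S)"
proof
  assume "(f has_vector_derivative D) (at x within S)"
  then show "((\<lambda>t. fst (f t)) has_vector_derivative fst D) (at x within S) \<and> ((\<lambda>t. snd (f t)) has_vector_derivative snd D) (at x within S)"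
    using bounded_linear.has_vector_derivative[OF bounded_linear_fst]
      bounded_linear.has_vector_derivative[OF bounded_linear_snd] by blast
next
  assume "((\<lambda>t. fst (f t)) has_vector_derivative fst D) (at x within S) \<and> ((\<lambda>t. snd (f t)) has_vector_derivative snd D) (at x within S)"
  then have "((\<lambda>t. (fst (f t), snd (f t))) has_vector_derivative (fst D, snd D)) (at x within S)"
    by (intro has_vector_derivative_Pair) auto
  then show "(f has_vector_derivative D) (at x within S)" by simp
qed

lemma smooth_on_Pair:
  assumes "open S" "smooth_on S f" "smooth_on S h"
  shows "smooth_on S (\<lambda>x. (f x, h x))"
proof -
  have "smooth_on S (\<lambda>x. (f x, 0) + (0, h x))"
    by (intro smooth_on_add assms smooth_on_bounded_linear[OF _ assms(1), where h = "\<lambda>x. (x, 0)"]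
        smooth_on_bounded_linear[OF _ assms(1), where h = "\<lambda>x. (0, x)"]
        bounded_linear_Pair bounded_linear_ident bounded_linear_zero)
  then show ?thesis by simp
qed

section \<open>The trajectory equation as a first-order system in the phase coordinates\<close>

context newtonian_system
begin

definition DF :: "('a, 'n) chart \<Rightarrow> real^'n \<Rightarrow> real^'n \<Rightarrow> real^'n \<Rightarrow> real^'n \<Rightarrow> real^'n" where
  "DF c x v h k = frechet_derivative (\<lambda>(x, v). F c x v) (at (x, v)) (h, k)"

definition acc :: "('a, 'n) chart \<Rightarrow> real^'n \<Rightarrow> real^'n \<Rightarrow> real^'n" where
  "acc c x v = F c x v - Gam c x v v"

text \<open>The vector field on the coordinates of the tangent bundle whose integral curves are the
  trajectories.\<close>

definition flow_field :: "('a, 'n) chart \<Rightarrow> (real^'n) \<times> (real^'n) \<Rightarrow> (real^'n) \<times> (real^'n)" where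
  "flow_field c z = (snd z, acc c (fst z) (snd z))"

text \<open>The derivative of \<open>flow_field\<close> at \<open>z\<close>. Its last two terms
  agree by symmetry of \<Gamma> but are kept as the product rule delivers them.\<close>

definition flow_linearization ::
  "('a, 'n) chart \<Rightarrow> (real^'n) \<times> (real^'n) \<Rightarrow> (real^'n) \<times> (real^'n) \<Rightarrow> (real^'n) \<times> (real^'n)" where
  "flow_linearization c z w = (snd w, DF c (fst z) (snd z) (fst w) (snd w)
     - (DGam c (fst z) (fst w) (snd z) (snd z) + Gam c (fst z) (snd w) (snd z) + Gam c (fst z) (snd z) (snd w)))"

definition phase :: "('a, 'n) chart \<Rightarrow> (real \<Rightarrow> 'a) \<Rightarrow> real \<Rightarrow> (real^'n) \<times> (real^'n)" where
  "phase c \<gamma> t = (coord c (\<gamma> t), vel c \<gamma> t)"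

lemma open_phase: "c \<in> atlas \<Longrightarrow> open ((coord c ` cdom c) \<times> (UNIV :: (real^'n) set))"
  by (intro open_Times open_coord_cdom open_UNIV)

lemma F_has_derivative:
  assumes "c \<in> atlas" "x \<in> coord c ` cdom c"
  shows "((\<lambda>(x, v). F c x v) has_derivative (\<lambda>(h, k). DF c x v h k)) (at (x, v))"
  using smooth_on_has_derivative[OF force_smooth[OF assms(1)], of "(x, v)"] assms(2)
  by (simp add: DF_def case_prod_unfold)

lemma linear_DF:
  assumes "c \<in> atlas" "x \<in> coord c ` cdom c"
  shows "linear (\<lambda>(h, k). DF c x v h k)"
  using F_has_derivative[OF assms] has_derivative_linear by blast

lemma linear_DF2:
  assumes "c \<in> atlas" "x \<in> coord c ` cdom c"
  shows "linear (DF c x v 0)"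
  using linear_compose[OF _ linear_DF[OF assms, of v], of "\<lambda>k. (0, k)"]
  by (simp add: o_def linear_iff)

lemma linear_DF1:
  assumes "c \<in> atlas" "x \<in> coord c ` cdom c"
  shows "linear (\<lambda>h. DF c x v h 0)"
  using linear_compose[OF _ linear_DF[OF assms, of v], of "\<lambda>h. (h, 0)"]
  by (simp add: o_def linear_iff)

lemma DF_split:
  assumes "c \<in> atlas" "x \<in> coord c ` cdom c"
  shows "DF c x v h k = DF c x v h 0 + DF c x v 0 k"
  using linear_add[OF linear_DF[OF assms, of v], of "(h, 0)" "(0, k)"] by simp

lemma flow_field_has_derivative:
  assumes c: "c \<in> atlas" and z: "z \<in> (coord c ` cdom c) \<times> UNIV"
  shows "(flow_field c has_derivative flow_linearization c z) (at z)"
proof -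
  have x: "fst z \<in> coord c ` cdom c" using z by auto
  have "((\<lambda>z. Christoffel c (fst z) k i j) has_derivative
      (\<lambda>w. frechet_derivative (\<lambda>y. Christoffel c y k i j) (at (fst z)) (fst w))) (at z)" for k i j
    using has_derivative_compose[OF has_derivative_fst[OF has_derivative_ident]
        smooth_on_has_derivative[OF Christoffel_smooth[OF c] x]] .
  from bil_has_derivative[OF this has_derivative_snd[OF has_derivative_ident] has_derivative_snd[OF has_derivative_ident]]
  have "((\<lambda>z. Gam c (fst z) (snd z) (snd z) $ k) has_derivative (\<lambda>w. (DGam c (fst z) (fst w) (snd z) (snd z)
      + Gam c (fst z) (snd w) (snd z) + Gam c (fst z) (snd z) (snd w)) $ k)) (at z)" for k
    by (simp add: Gam_def DGam_def)
  then have G: "((\<lambda>z. Gam c (fst z) (snd z) (snd z)) has_derivative (\<lambda>w. DGam c (fst z) (fst w) (snd z) (snd z)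
      + Gam c (fst z) (snd w) (snd z) + Gam c (fst z) (snd z) (snd w))) (at z)"
    by (subst has_derivative_componentwise_within) (auto simp: Basis_vec_def inner_axis)
  have "((\<lambda>z. F c (fst z) (snd z)) has_derivative (\<lambda>w. DF c (fst z) (snd z) (fst w) (snd w))) (at z)"
    using F_has_derivative[OF c x, of "snd z"] by (simp add: case_prod_unfold)
  from has_derivative_Pair[OF has_derivative_snd[OF has_derivative_ident] has_derivative_diff[OF this G]]
  show ?thesis by (simp add: flow_field_def[abs_def] acc_def flow_linearization_def[abs_def])
qed

lemma flow_field_smooth:
  assumes c: "c \<in> atlas"
  shows "smooth_on ((coord c ` cdom c) \<times> UNIV) (flow_field c)"
proof -
  let ?S = "(coord c ` cdom c) \<times> (UNIV :: (real^'n) set)"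
  note o = open_phase[OF c]
  have C: "smooth_on ?S (\<lambda>z. Christoffel c (fst z) k i j)" for k i j
    by (rule smooth_on_compose[OF o open_coord_cdom[OF c] _ Christoffel_smooth[OF c]
          smooth_on_linear[OF bounded_linear_fst o]]) auto
  have v: "smooth_on ?S snd" by (rule smooth_on_linear[OF bounded_linear_snd o])
  have "smooth_on ?S (\<lambda>z. Gam c (fst z) (snd z) (snd z) $ k)" for k
    unfolding Gam_def bil_def vec_lambda_beta
    by (intro smooth_on_sum smooth_on_mult C smooth_on_nth[OF o v] o)
  then have G: "smooth_on ?S (\<lambda>z. Gam c (fst z) (snd z) (snd z))" by (rule smooth_on_vec[OF o])
  have "smooth_on ?S (\<lambda>z. F c (fst z) (snd z))"
    using force_smooth[OF c] by (simp add: case_prod_unfold)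
  then show ?thesis
    unfolding flow_field_def[abs_def] acc_def by (intro smooth_on_Pair o v smooth_on_diff G)
qed

lemma flow_linearization_continuous:
  assumes c: "c \<in> atlas"
  shows "continuous_on ((coord c ` cdom c) \<times> UNIV) (\<lambda>z. flow_linearization c z w)"
proof -
  have "continuous_on ((coord c ` cdom c) \<times> UNIV) (\<lambda>z. frechet_derivative (flow_field c) (at z) w)"
    by (intro smooth_on_continuous smooth_on_frechet_derivative flow_field_smooth c)
  moreover have "frechet_derivative (flow_field c) (at z) w = flow_linearization c z w"
    if "z \<in> (coord c ` cdom c) \<times> UNIV" for z
    using frechet_derivative_at[OF flow_field_has_derivative[OF c that]] by simp
  ultimately show ?thesis by (simp cong: continuous_on_cong)
qed

lemma trajectory_phase:
  assumes \<gamma>: "trajectory I \<gamma>" "t \<in> I" and c: "c \<in> atlas" "\<gamma> t \<in> cdom c"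
  shows "(phase c \<gamma> has_vector_derivative flow_field c (phase c \<gamma> t)) (at t)"
    and "((\<lambda>s. coord c (\<gamma> s)) has_vector_derivative vel c \<gamma> t) (at t)"
    and "(vel c \<gamma> has_vector_derivative acc c (coord c (\<gamma> t)) (vel c \<gamma> t)) (at t)"
    and "nabla_t c \<gamma> (vel c \<gamma>) t = F c (coord c (\<gamma> t)) (vel c \<gamma> t)"
proof -
  have d: "(\<lambda>s. coord c (\<gamma> s)) differentiable (at t)" "vel c \<gamma> differentiable (at t)"
    and n: "nabla_t c \<gamma> (vel c \<gamma>) t = F c (coord c (\<gamma> t)) (vel c \<gamma> t)"
    using \<gamma> c unfolding trajectory_def by blast+
  show "nabla_t c \<gamma> (vel c \<gamma>) t = F c (coord c (\<gamma> t)) (vel c \<gamma> t)" by (rule n)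
  show 1: "((\<lambda>s. coord c (\<gamma> s)) has_vector_derivative vel c \<gamma> t) (at t)"
    unfolding vel_def using d(1) vector_derivative_works by blast
  have "vector_derivative (vel c \<gamma>) (at t) = acc c (coord c (\<gamma> t)) (vel c \<gamma> t)"
    using n unfolding nabla_t_Gam acc_def by (simp add: algebra_simps)
  then show 2: "(vel c \<gamma> has_vector_derivative acc c (coord c (\<gamma> t)) (vel c \<gamma> t)) (at t)"
    using d(2) vector_derivative_works by metis
  show "(phase c \<gamma> has_vector_derivative flow_field c (phase c \<gamma> t)) (at t)"
    using has_vector_derivative_Pair[OF 1 2] by (simp add: phase_def[abs_def] flow_field_def)
qed

lemma trajectory_isCont:
  assumes "trajectory I \<gamma>" "t \<in> I"
  shows "isCont \<gamma> t"
  using assms continuous_on_eq_continuous_at by (auto simp: trajectory_def)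

lemma trajectory_eventually_chart:
  assumes "trajectory I \<gamma>" "t \<in> I" "c \<in> atlas" "\<gamma> t \<in> cdom c"
  shows "\<forall>\<^sub>F s in nhds t. s \<in> I \<and> \<gamma> s \<in> cdom c"
proof (intro eventually_conj)
  show "\<forall>\<^sub>F s in nhds t. s \<in> I"
    using assms by (intro eventually_nhds_in_open) (auto simp: trajectory_def)
  have "(\<gamma> \<longlongrightarrow> \<gamma> t) (nhds t)"
    using trajectory_isCont[OF assms(1,2)] tendsto_at_iff_tendsto_nhds[of \<gamma> t] by (simp add: isCont_def)
  then show "\<forall>\<^sub>F s in nhds t. \<gamma> s \<in> cdom c"
    using tendsto_compose_eventually_mem open_cdom assms by blast
qed

lemma vel_change:
  assumes "trajectory I \<gamma>" "t \<in> I" "c \<in> atlas" "d \<in> atlas" "\<gamma> t \<in> cdom c" "\<gamma> t \<in> cdom d"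
  shows "vel d \<gamma> t = jac c d (coord c (\<gamma> t)) (vel c \<gamma> t)"
proof -
  have "((\<lambda>s. coord d (\<gamma> s)) has_vector_derivative jac c d (coord c (\<gamma> t)) (vel c \<gamma> t)) (at t)"
    using trajectory_eventually_chart[OF assms(1,2,3,5)] trajectory_phase(2)[OF assms(1,2,3,5)] assms
    by (intro coord_curve_change) (auto elim: eventually_mono)
  then show ?thesis
    using trajectory_phase(2)[OF assms(1,2,4,6)] vector_derivative_unique_at by blast
qed

text \<open>A nearby trajectory is given on the time interval but might leave the chart, and
  Gronwall applies only while it stays. While within distance r it lies in a compact part of the
  chart domain, so limit points remain inside; Gronwall then improves r to a smaller bound, and
  \<open>segment_continuation\<close> covers the whole interval. Since r and K do not depend on the
  neighbour, this is also a uniqueness theorem.\<close>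

lemma trajectory_tube:
  assumes \<gamma>0: "trajectory I \<gamma>0" "{a..b} \<subseteq> I" and c: "c \<in> atlas"
    and dom: "\<And>t. t \<in> {a..b} \<Longrightarrow> \<gamma>0 t \<in> cdom c"
  obtains r K where "0 < r"
    "\<And>\<gamma> J t1 t. trajectory J \<gamma> \<Longrightarrow> {a..b} \<subseteq> J \<Longrightarrow> t1 \<in> {a..b} \<Longrightarrow> \<gamma> t1 \<in> cdom c \<Longrightarrow>
      norm (phase c \<gamma> t1 - phase c \<gamma>0 t1) < r \<Longrightarrow> t \<in> {a..b} \<Longrightarrow>
      \<gamma> t \<in> cdom c \<and> norm (phase c \<gamma> t - phase c \<gamma>0 t) \<le> K * norm (phase c \<gamma> t1 - phase c \<gamma>0 t1)"
proof -
  let ?U = "(coord c ` cdom c) \<times> (UNIV :: (real^'n) set)"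
  define C where "C = phase c \<gamma>0 ` {a..b}"
  have der0: "(phase c \<gamma>0 has_vector_derivative flow_field c (phase c \<gamma>0 t)) (at t)" if "t \<in> {a..b}" for t
    using trajectory_phase(1)[OF \<gamma>0(1) _ c dom[OF that]] that \<gamma>0(2) by blast
  then have "continuous_on {a..b} (phase c \<gamma>0)"
    by (intro continuous_at_imp_continuous_on ballI has_vector_derivative_continuous)
  then have C: "compact C" by (auto simp: C_def intro: compact_continuous_image)
  have CU: "C \<subseteq> ?U" using dom by (auto simp: C_def phase_def)
  obtain r L where r: "0 < r" "0 \<le> L" "\<And>x z. x \<in> C \<Longrightarrow> norm (z - x) \<le> r \<Longrightarrow> z \<in> ?U"
    "\<And>x z. x \<in> C \<Longrightarrow> norm (z - x) \<le> r \<Longrightarrow> norm (flow_field c z - flow_field c x) \<le> L * norm (z - x)"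
    using C1_Lipschitz_near_compact[OF open_phase[OF c] C CU flow_field_has_derivative[OF c]
        flow_linearization_continuous[OF c]] by metis
  \<comment> \<open>A square root because \<open>gronwall\<close> bounds squared norms.\<close>
  define K where "K = sqrt (exp ((2 * L + 1) * (b - a)))"
  have K: "0 < K" by (simp add: K_def)
  define N where "N = (\<Union>z\<in>C. \<Union>h\<in>cball 0 r. {z + h})"
  have N: "compact N" unfolding N_def by (rule compact_sums') (use C in auto)
  have NU: "N \<subseteq> ?U"
  proof
    fix z assume "z \<in> N"
    then obtain x h where "x \<in> C" "norm h \<le> r" "z = x + h" by (auto simp: N_def)
    then show "z \<in> ?U" using r(3)[of x z] by simp
  qed
  \<comment> \<open>Compact part of the chart domain. It is closed because the manifold is
    Hausdorff, and therefore keeps the limits of the neighbour.\<close>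
  define M where "M = cinv c ` fst ` N"
  have M: "compact M"
    unfolding M_def using NU
    by (intro compact_continuous_image N continuous_on_subset[OF continuous_on_cinv[OF c]]
        continuous_on_fst continuous_on_id) auto
  have Mc: "M \<subseteq> cdom c" unfolding M_def using NU coord_cinv[OF c] by auto
  show ?thesis
  proof (rule that[of "min r (r / K)" K])
    show "0 < min r (r / K)" using r(1) K by simp
    fix \<gamma> J t1 t assume \<gamma>: "trajectory J \<gamma>" "{a..b} \<subseteq> J" and t1: "t1 \<in> {a..b}" "\<gamma> t1 \<in> cdom c"
      "norm (phase c \<gamma> t1 - phase c \<gamma>0 t1) < min r (r / K)" and t: "t \<in> {a..b}"
    define \<delta> where "\<delta> = norm (phase c \<gamma> t1 - phase c \<gamma>0 t1)"
    \<comment> \<open>The bound r / K on the initial distance makes the Gronwall bound K \<delta>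
      strictly less than r.\<close>
    have \<delta>: "0 \<le> \<delta>" "\<delta> < r" "K * \<delta> < r" using t1(3) K by (auto simp: \<delta>_def field_simps)
    let ?P = "\<lambda>t. \<gamma> t \<in> cdom c \<and> norm (phase c \<gamma> t - phase c \<gamma>0 t) \<le> r"
    have der: "((\<lambda>s. phase c \<gamma> s - phase c \<gamma>0 s) has_vector_derivative
        flow_field c (phase c \<gamma> s) - flow_field c (phase c \<gamma>0 s)) (at s)" if "s \<in> {a..b}" "\<gamma> s \<in> cdom c" for s
      using trajectory_phase(1)[OF \<gamma>(1) _ c that(2)] der0[OF that(1)] that(1) \<gamma>(2)
      by (intro has_vector_derivative_diff) auto
    have est: "norm (phase c \<gamma> t - phase c \<gamma>0 t) \<le> K * \<delta>"
      if t: "t \<in> {a..b}" and P: "\<forall>s\<in>closed_segment t1 t. ?P s" for t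
    proof -
      define a' b' where "a' = min t1 t" and "b' = max t1 t"
      have seg: "closed_segment t1 t = {a'..b'}" by (auto simp: closed_segment_eq_real_ivl a'_def b'_def)
      have sub: "{a'..b'} \<subseteq> {a..b}" "b' - a' \<le> b - a" using t t1 by (auto simp: a'_def b'_def)
      have "(norm (phase c \<gamma> t - phase c \<gamma>0 t))\<^sup>2 \<le>
          ((norm (phase c \<gamma> t1 - phase c \<gamma>0 t1))\<^sup>2 + 0\<^sup>2 * (b' - a')) * exp ((2 * L + 1) * (b' - a'))"
      proof (rule gronwall[OF r(2)])
        show "t1 \<in> {a'..b'}" "t \<in> {a'..b'}" by (auto simp: a'_def b'_def)
        fix s assume s: "s \<in> {a'..b'}"
        then have Ps: "?P s" using P seg by blast
        have sab: "s \<in> {a..b}" using s sub by blast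
        show "((\<lambda>s. phase c \<gamma> s - phase c \<gamma>0 s) has_vector_derivative
          flow_field c (phase c \<gamma> s) - flow_field c (phase c \<gamma>0 s)) (at s within {a'..b'})"
          using der sab Ps has_vector_derivative_at_within by blast
        show "norm (flow_field c (phase c \<gamma> s) - flow_field c (phase c \<gamma>0 s))
          \<le> L * norm (phase c \<gamma> s - phase c \<gamma>0 s) + 0"
          using r(4)[of "phase c \<gamma>0 s" "phase c \<gamma> s"] Ps sab by (auto simp: C_def)
      qed
      also have "\<dots> = \<delta>\<^sup>2 * exp ((2 * L + 1) * (b' - a'))" by (simp add: \<delta>_def)
      also have "\<dots> \<le> \<delta>\<^sup>2 * exp ((2 * L + 1) * (b - a))"
        using sub(2) r(2) by (intro mult_left_mono) auto
      also have "\<dots> = (K * \<delta>)\<^sup>2" by (simp add: K_def power_mult_distrib mult.commute)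
      finally show ?thesis by (rule power2_le_imp_le) (use K \<delta> in simp)
    qed
    have P: "?P t" if "t \<in> {a..b}" for t
    proof (rule segment_continuation[of t1 a b ?P t])
      show "t1 \<in> {a..b}" by (rule t1)
      show "?P t1" using t1 \<delta> by (auto simp: \<delta>_def)
      show "t \<in> {a..b}" by fact
    next
      fix t assume t: "t \<in> {a..b}" "t \<noteq> t1" and P: "\<forall>s\<in>closed_segment t1 t - {t}. ?P s"
      define T where "T = closed_segment t1 t - {t}"
      \<comment> \<open>A nondegenerate segment accumulates at its end t, so limits along
        \<open>T\<close> carry information.\<close>
      have nt: "at t within T \<noteq> bot"
      proof -
        have "closed_segment t1 t \<noteq> {s}" for s
          using t(2) ends_in_segment(1)[of t1 t] ends_in_segment(2)[of t t1] by (metis singletonD)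
        then have "t islimpt closed_segment t1 t"
          by (intro connected_imp_perfect connected_segment) auto
        then have "t islimpt insert t T" by (simp add: T_def insert_absorb)
        then show ?thesis unfolding trivial_limit_within islimpt_insert by simp
      qed
      have TJ: "t \<in> J" using t \<gamma>(2) by blast
      have Tab: "T \<subseteq> {a..b}" using t t1(1) by (auto simp: T_def closed_segment_eq_real_ivl split: if_splits)
      have inM: "\<gamma> s \<in> M" if s: "s \<in> T" for s
      proof -
        have Ps: "?P s" using P s by (simp add: T_def)
        have "phase c \<gamma>0 s \<in> C" using s Tab by (auto simp: C_def)
        moreover have "phase c \<gamma> s = phase c \<gamma>0 s + (phase c \<gamma> s - phase c \<gamma>0 s)" by simp
        moreover have "phase c \<gamma> s - phase c \<gamma>0 s \<in> cball 0 r" using Ps by simp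
        ultimately have "phase c \<gamma> s \<in> N" unfolding N_def by blast
        then have "cinv c (fst (phase c \<gamma> s)) \<in> M" unfolding M_def by blast
        then show ?thesis using Ps c by (simp add: phase_def)
      qed
      have "(\<gamma> \<longlongrightarrow> \<gamma> t) (at t within T)"
        using trajectory_isCont[OF \<gamma>(1) TJ] by (auto simp: isCont_def intro: tendsto_within_subset)
      then have "\<gamma> t \<in> M"
        using inM by (intro Lim_in_closed_set[OF compact_imp_closed[OF M] _ nt, of \<gamma>])
          (auto simp: eventually_at_filter)
      then have td: "\<gamma> t \<in> cdom c" using Mc by blast
      have "isCont (\<lambda>s. phase c \<gamma> s - phase c \<gamma>0 s) t"
        using der[OF t(1) td] has_vector_derivative_continuous by blast
      then have "((\<lambda>s. norm (phase c \<gamma> s - phase c \<gamma>0 s)) \<longlongrightarrow> norm (phase c \<gamma> t - phase c \<gamma>0 t)) (at t within T)"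
        by (auto simp: isCont_def intro: tendsto_norm tendsto_within_subset)
      then have "norm (phase c \<gamma> t - phase c \<gamma>0 t) \<le> r"
        by (rule tendsto_upperbound[OF _ _ nt]) (use P in \<open>auto simp: eventually_at_filter T_def\<close>)
      then show "?P t" using td by simp
    next
      fix t assume t: "t \<in> {a..b}" and P: "\<forall>s\<in>closed_segment t1 t. ?P s"
      have td: "\<gamma> t \<in> cdom c" using P by simp
      have tJ: "t \<in> J" using t \<gamma>(2) by blast
      have "isCont (\<lambda>s. phase c \<gamma> s - phase c \<gamma>0 s) t"
        using der[OF t td] has_vector_derivative_continuous by blast
      then have "((\<lambda>s. norm (phase c \<gamma> s - phase c \<gamma>0 s)) \<longlongrightarrow> norm (phase c \<gamma> t - phase c \<gamma>0 t)) (at t within {a..b})"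
        by (auto simp: isCont_def intro: tendsto_norm tendsto_within_subset)
      \<comment> \<open>The strict inequality leaves room to continue past t.\<close>
      moreover have "norm (phase c \<gamma> t - phase c \<gamma>0 t) < r" using est[OF t P] \<delta>(3) by simp
      ultimately have "\<forall>\<^sub>F s in at t within {a..b}. norm (phase c \<gamma> s - phase c \<gamma>0 s) < r"
        by (rule order_tendstoD(2))
      moreover have "\<forall>\<^sub>F s in at t within {a..b}. \<gamma> s \<in> cdom c"
        using trajectory_eventually_chart[OF \<gamma>(1) tJ c td]
        by (auto simp: eventually_at_filter elim: eventually_mono)
      ultimately show "\<forall>\<^sub>F s in at t within {a..b}. ?P s" by eventually_elim auto
    qed
    have "closed_segment t1 t \<subseteq> {a..b}"
      using t t1(1) by (auto simp: closed_segment_eq_real_ivl split: if_splits)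
    then have "\<forall>s\<in>closed_segment t1 t. ?P s" using P by blast
    from est[OF t this] P[OF t]
    show "\<gamma> t \<in> cdom c \<and> norm (phase c \<gamma> t - phase c \<gamma>0 t) \<le> K * norm (phase c \<gamma> t1 - phase c \<gamma>0 t1)"
      by (simp add: \<delta>_def)
  qed
qed


section \<open>Vectors of variation\<close>

lemma DGam_sym:
  assumes "c \<in> atlas" "x \<in> coord c ` cdom c"
  shows "DGam c x h X Y = DGam c x h Y X"
proof -
  have eq: "frechet_derivative (\<lambda>y. Christoffel c y k i j) (at x) = frechet_derivative (\<lambda>y. Christoffel c y k j i) (at x)" for k i j
  proof (rule frechet_derivative_transform_within_open[OF _ open_coord_cdom[OF assms(1)] assms(2)])
    show "(\<lambda>y. Christoffel c y k i j) differentiable (at x)"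
      using smooth_on_has_derivative[OF Christoffel_smooth[OF assms(1)] assms(2)] unfolding differentiable_def by blast
  qed (rule Christoffel_sym[OF assms(1)])
  have "bil (\<lambda>i j. frechet_derivative (\<lambda>y. Christoffel c y k i j) (at x) h) X Y
      = bil (\<lambda>i j. frechet_derivative (\<lambda>y. Christoffel c y k i j) (at x) h) Y X" for k
    unfolding bil_def
  proof (subst sum.swap, intro sum.cong refl)
    fix i j
    show "frechet_derivative (\<lambda>y. Christoffel c y k j i) (at x) h * X $ j * Y $ i
        = frechet_derivative (\<lambda>y. Christoffel c y k i j) (at x) h * Y $ i * X $ j"
      unfolding eq[of k j i] by simp
  qed
  then show ?thesis by (simp add: DGam_def)
qed

lemma velocity_grad_DF:
  assumes "c \<in> atlas" "x \<in> coord c ` cdom c"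
  shows "velocity_grad c x v m k = DF c x v 0 (axis m 1) $ k"
proof -
  have "((\<lambda>w. (x, w)) has_derivative (\<lambda>h. (0, h))) (at v)"
    by (intro has_derivative_Pair has_derivative_const has_derivative_ident)
  from has_derivative_compose[OF this F_has_derivative[OF assms]]
  have "((\<lambda>w. F c x w $ k) has_derivative (\<lambda>h. DF c x v 0 h $ k)) (at v)"
    by (intro bounded_linear.has_derivative[OF bounded_linear_vec_nth]) simp
  from frechet_derivative_at[OF this] show ?thesis unfolding velocity_grad_def pd_def by metis
qed

lemma pd_F_DF:
  assumes "c \<in> atlas" "x \<in> coord c ` cdom c"
  shows "pd m (\<lambda>y. F c y v $ k) x = DF c x v (axis m 1) 0 $ k"
proof -
  have "((\<lambda>y. (y, v)) has_derivative (\<lambda>h. (h, 0))) (at x)"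
    by (intro has_derivative_Pair has_derivative_const has_derivative_ident)
  from has_derivative_compose[OF this F_has_derivative[OF assms]]
  have "((\<lambda>y. F c y v $ k) has_derivative (\<lambda>h. DF c x v h 0 $ k)) (at x)"
    by (intro bounded_linear.has_derivative[OF bounded_linear_vec_nth]) simp
  from frechet_derivative_at[OF this] show ?thesis unfolding pd_def by metis
qed

lemma linear_nth: "linear f \<Longrightarrow> linear (\<lambda>x. f x $ (k :: 'n) :: real)"
  by (simp add: linear_iff)

lemma velocity_grad_sum:
  assumes "c \<in> atlas" "x \<in> coord c ` cdom c"
  shows "(\<Sum>m\<in>UNIV. K $ m * velocity_grad c x v m k) = DF c x v 0 K $ k"
  using linear_apply_axis_sum[OF linear_nth[OF linear_DF2[OF assms, of v], of k], of K]
  by (simp add: velocity_grad_DF[OF assms])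

text \<open>Parallel transport of v in the direction T changes its components by -\<Gamma>(T, v);
  this explains the velocity derivative of F in the middle term.\<close>

lemma spatial_grad_sum:
  assumes "c \<in> atlas" "x \<in> coord c ` cdom c"
  shows "(\<Sum>m\<in>UNIV. T $ m * spatial_grad c x v m k) =
    (DF c x v T 0 - DF c x v 0 (Gam c x T v) + Gam c x T (F c x v)) $ k"
proof -
  have 1: "DF c x v T 0 $ k = (\<Sum>m\<in>UNIV. T $ m * pd m (\<lambda>y. F c y v $ k) x)"
    using linear_apply_axis_sum[OF linear_nth[OF linear_DF1[OF assms, of v], of k], of T]
    by (simp add: pd_F_DF[OF assms])
  have "DF c x v 0 (Gam c x T v) $ k = (\<Sum>b\<in>UNIV. \<Sum>m\<in>UNIV. \<Sum>a\<in>UNIV. T $ m * (v $ a * Christoffel c x b m a * velocity_grad c x v b k))"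
    unfolding velocity_grad_sum[OF assms, symmetric] Gam_def bil_def vec_lambda_beta sum_distrib_right
    by (intro sum.cong refl) (simp only: mult_ac)
  also have "\<dots> = (\<Sum>m\<in>UNIV. \<Sum>b\<in>UNIV. \<Sum>a\<in>UNIV. T $ m * (v $ a * Christoffel c x b m a * velocity_grad c x v b k))"
    by (rule sum.swap)
  also have "\<dots> = (\<Sum>m\<in>UNIV. \<Sum>a\<in>UNIV. \<Sum>b\<in>UNIV. T $ m * (v $ a * Christoffel c x b m a * velocity_grad c x v b k))"
    by (rule sum.cong[OF refl], rule sum.swap)
  also have "\<dots> = (\<Sum>m\<in>UNIV. T $ m * (\<Sum>a\<in>UNIV. \<Sum>b\<in>UNIV. v $ a * Christoffel c x b m a * velocity_grad c x v b k))"
    unfolding sum_distrib_left ..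
  finally have 2: "DF c x v 0 (Gam c x T v) $ k = \<dots>" .
  have 3: "Gam c x T (F c x v) $ k = (\<Sum>m\<in>UNIV. T $ m * (\<Sum>a\<in>UNIV. Christoffel c x k m a * F c x v $ a))"
    unfolding Gam_def bil_def vec_lambda_beta sum_distrib_left
    by (intro sum.cong refl) (simp only: mult_ac)
  show ?thesis
    unfolding vector_minus_component vector_add_component 1 2 3 spatial_grad_def velocity_grad_def
    by (simp add: sum.distrib sum_subtractf distrib_left right_diff_distrib)
qed

lemma nabla_t_differentiable:
  assumes \<gamma>: "trajectory I \<gamma>" "t \<in> I" and c: "c \<in> atlas" "\<gamma> t \<in> cdom c"
    and T: "\<And>s. s \<in> I \<Longrightarrow> \<gamma> s \<in> cdom c \<Longrightarrow> (T has_vector_derivative S s) (at s)"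
    and S: "(S has_vector_derivative W) (at t)"
  shows "(nabla_t c \<gamma> T has_vector_derivative W +
    (let x = coord c (\<gamma> t); v = vel c \<gamma> t in DGam c x v v (T t) + Gam c x (acc c x v) (T t) + Gam c x v (S t))) (at t)"
proof (rule has_vector_derivative_cong_eventually)
  have x: "coord c (\<gamma> t) \<in> coord c ` cdom c" using c by blast
  show "((\<lambda>s. S s + Gam c (coord c (\<gamma> s)) (vel c \<gamma> s) (T s)) has_vector_derivative W +
    (let x = coord c (\<gamma> t); v = vel c \<gamma> t in DGam c x v v (T t) + Gam c x (acc c x v) (T t) + Gam c x v (S t))) (at t)"
    unfolding Let_def
    by (intro has_vector_derivative_add S T \<gamma> c trajectory_phase[OF \<gamma> c]
        Gam_leibniz[where \<xi> = "\<lambda>s. coord c (\<gamma> s)" and t = t, OF c(1) x])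
  show "\<forall>\<^sub>F s in nhds t. S s + Gam c (coord c (\<gamma> s)) (vel c \<gamma> s) (T s) = nabla_t c \<gamma> T s"
    using trajectory_eventually_chart[OF \<gamma> c]
    by eventually_elim (simp add: nabla_t_Gam vector_derivative_at[OF T])
qed

text \<open>The equation of variation is the linearised trajectory equation in disguise. When both
  covariant derivatives are expanded, the derivatives of \<Gamma> and the products of \<Gamma> with
  itself collect into the curvature, and the terms with the force into its gradients. It is
  therefore enough to have the linearised equation in every chart.\<close>

lemma vector_of_variationI:
  assumes \<gamma>: "trajectory I \<gamma>" and along: "vector_along I \<gamma> \<tau>"
    and \<tau>: "\<And>c t. c \<in> atlas \<Longrightarrow> t \<in> I \<Longrightarrow> \<gamma> t \<in> cdom c \<Longrightarrow> (\<tau> c has_vector_derivative \<sigma> c t) (at t)"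
    and \<sigma>: "\<And>c t. c \<in> atlas \<Longrightarrow> t \<in> I \<Longrightarrow> \<gamma> t \<in> cdom c \<Longrightarrow> (\<sigma> c has_vector_derivative
      snd (flow_linearization c (phase c \<gamma> t) (\<tau> c t, \<sigma> c t))) (at t)"
  shows "vector_of_variation I \<gamma> \<tau>"
  unfolding vector_of_variation_def
proof (intro conjI ballI impI along)
  fix c t assume c: "c \<in> atlas" and t: "t \<in> I" and tc: "\<gamma> t \<in> cdom c"
  let ?x = "coord c (\<gamma> t)" and ?v = "vel c \<gamma> t" and ?T = "\<tau> c t" and ?S = "\<sigma> c t"
  have x: "?x \<in> coord c ` cdom c" using tc by blast
  interpret G: bounded_bilinear "Gam c ?x" by (rule Gam_bilinear)
  have D: "(nabla_t c \<gamma> (\<tau> c) has_vector_derivative snd (flow_linearization c (phase c \<gamma> t) (?T, ?S)) +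
    (DGam c ?x ?v ?v ?T + Gam c ?x (acc c ?x ?v) ?T + Gam c ?x ?v ?S)) (at t)"
    using nabla_t_differentiable[where T = "\<tau> c" and S = "\<sigma> c", OF \<gamma> t c tc \<tau>[OF c] \<sigma>[OF c t tc]]
    by (simp add: Let_def)
  show "\<tau> c differentiable (at t)" using \<tau>[OF c t tc] by (rule differentiableI_vector)
  show "nabla_t c \<gamma> (\<tau> c) differentiable (at t)" using D by (rule differentiableI_vector)
  have K: "nabla_t c \<gamma> (\<tau> c) t = ?S + Gam c ?x ?v ?T"
    using vector_derivative_at[OF \<tau>[OF c t tc]] by (simp add: nabla_t_Gam)
  \<comment> \<open>Symmetry of \<Gamma> and of its derivative in the two lower indices makes the
    two expansions agree.\<close>
  have N: "nabla_t c \<gamma> (nabla_t c \<gamma> (\<tau> c)) t =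
     - (DGam c ?x ?T ?v ?v - DGam c ?x ?v ?T ?v + Gam c ?x ?T (Gam c ?x ?v ?v) - Gam c ?x ?v (Gam c ?x ?T ?v))
     + DF c ?x ?v 0 (?S + Gam c ?x ?v ?T)
     + (DF c ?x ?v ?T 0 - DF c ?x ?v 0 (Gam c ?x ?T ?v) + Gam c ?x ?T (F c ?x ?v))"
    unfolding nabla_t_Gam[of c \<gamma> "nabla_t c \<gamma> (\<tau> c)"] vector_derivative_at[OF D] K
    using Gam_sym[OF c x, of ?T] Gam_sym[OF c x, of ?S ?v] DGam_sym[OF c x, of ?v ?T ?v]
      DF_split[OF c x, of ?v ?T ?S] linear_add[OF linear_DF2[OF c x], of ?v ?S "Gam c ?x ?v ?T"]
    by (simp add: flow_linearization_def phase_def Let_def acc_def G.add_right G.diff_left G.diff_right algebra_simps)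
  show "let x = coord c (\<gamma> t); v = vel c \<gamma> t
      in \<forall>k. nabla_t c \<gamma> (nabla_t c \<gamma> (\<tau> c)) t $ k =
          - (\<Sum>m\<in>UNIV. \<Sum>i\<in>UNIV. \<Sum>j\<in>UNIV. curvature c x k m i j * \<tau> c t $ i * v $ j * v $ m)
          + (\<Sum>m\<in>UNIV. nabla_t c \<gamma> (\<tau> c) t $ m * velocity_grad c x v m k)
          + (\<Sum>m\<in>UNIV. \<tau> c t $ m * spatial_grad c x v m k)"
    unfolding Let_def velocity_grad_sum[OF c x] spatial_grad_sum[OF c x] curvature_op[OF c x] N K
    by simp
qed

lemma vector_of_variation_equation:
  assumes V: "vector_of_variation I \<gamma> \<tau>" and c: "c \<in> atlas" "t \<in> I" "\<gamma> t \<in> cdom c"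
  shows "nabla_t c \<gamma> (nabla_t c \<gamma> (\<tau> c)) t = (let x = coord c (\<gamma> t); v = vel c \<gamma> t; T = \<tau> c t in
     - (DGam c x T v v - DGam c x v T v + Gam c x T (Gam c x v v) - Gam c x v (Gam c x T v))
     + DF c x v 0 (nabla_t c \<gamma> (\<tau> c) t)
     + (DF c x v T 0 - DF c x v 0 (Gam c x T v) + Gam c x T (F c x v)))"
proof -
  have x: "coord c (\<gamma> t) \<in> coord c ` cdom c" using c by blast
  from V c have "\<forall>k. nabla_t c \<gamma> (nabla_t c \<gamma> (\<tau> c)) t $ k =
      - (\<Sum>m\<in>UNIV. \<Sum>i\<in>UNIV. \<Sum>j\<in>UNIV. curvature c (coord c (\<gamma> t)) k m i j * \<tau> c t $ i * vel c \<gamma> t $ j * vel c \<gamma> t $ m)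
      + (\<Sum>m\<in>UNIV. nabla_t c \<gamma> (\<tau> c) t $ m * velocity_grad c (coord c (\<gamma> t)) (vel c \<gamma> t) m k)
      + (\<Sum>m\<in>UNIV. \<tau> c t $ m * spatial_grad c (coord c (\<gamma> t)) (vel c \<gamma> t) m k)"
    unfolding vector_of_variation_def Let_def by blast
  then show ?thesis
    unfolding velocity_grad_sum[OF c(1) x] spatial_grad_sum[OF c(1) x] curvature_op[OF c(1) x]
    by (simp add: vec_eq_iff Let_def)
qed

text \<open>Inside one chart, \<open>trajectory_tube\<close> keeps the neighbours in the chart with
  a Lipschitz bound, just what \<open>flow_derivative\<close> requires. Differentiability in s at
  the single time \<open>t1\<close> thus spreads over the interval.\<close>

lemma variation_local:
  assumes \<Gamma>: "\<forall>\<^sub>F s in nhds 0. trajectory I (\<Gamma> s)" and ab: "{a..b} \<subseteq> I"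
    and c: "c \<in> atlas" and dom: "\<And>t. t \<in> {a..b} \<Longrightarrow> \<Gamma> 0 t \<in> cdom c"
    and t1: "t1 \<in> {a..b}" "\<forall>\<^sub>F s in nhds 0. \<Gamma> s t1 \<in> cdom c"
      "((\<lambda>s. phase c (\<Gamma> s) t1) has_vector_derivative z1) (at 0)"
  obtains z where "\<And>t. t \<in> {a..b} \<Longrightarrow>
      (z has_vector_derivative flow_linearization c (phase c (\<Gamma> 0) t) (z t)) (at t within {a..b})"
    "\<And>t. t \<in> {a..b} \<Longrightarrow> ((\<lambda>s. phase c (\<Gamma> s) t) has_vector_derivative z t) (at 0)"
    "\<And>t. t \<in> {a..b} \<Longrightarrow> \<forall>\<^sub>F s in nhds 0. \<Gamma> s t \<in> cdom c"
proof -
  have \<Gamma>0: "trajectory I (\<Gamma> 0)" using \<Gamma> by (rule eventually_nhds_x_imp_x)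
  obtain r K where r: "0 < r"
    "\<And>\<gamma> J t1 t. trajectory J \<gamma> \<Longrightarrow> {a..b} \<subseteq> J \<Longrightarrow> t1 \<in> {a..b} \<Longrightarrow> \<gamma> t1 \<in> cdom c \<Longrightarrow>
      norm (phase c \<gamma> t1 - phase c (\<Gamma> 0) t1) < r \<Longrightarrow> t \<in> {a..b} \<Longrightarrow>
      \<gamma> t \<in> cdom c \<and> norm (phase c \<gamma> t - phase c (\<Gamma> 0) t) \<le> K * norm (phase c \<gamma> t1 - phase c (\<Gamma> 0) t1)"
    using trajectory_tube[OF \<Gamma>0 ab c dom] by metis
  have "((\<lambda>s. norm (phase c (\<Gamma> s) t1 - phase c (\<Gamma> 0) t1)) \<longlongrightarrow> norm (phase c (\<Gamma> 0) t1 - phase c (\<Gamma> 0) t1)) (nhds 0)"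
    by (intro tendsto_norm tendsto_diff has_vector_derivative_tendsto[OF t1(3)] tendsto_const)
  then have "\<forall>\<^sub>F s in nhds 0. norm (phase c (\<Gamma> s) t1 - phase c (\<Gamma> 0) t1) < r"
    using r(1) by (intro order_tendstoD(2)) auto
  then have ev: "\<forall>\<^sub>F s in nhds 0. trajectory I (\<Gamma> s) \<and> (\<forall>t\<in>{a..b}. \<Gamma> s t \<in> cdom c \<and>
      norm (phase c (\<Gamma> s) t - phase c (\<Gamma> 0) t) \<le> K * norm (phase c (\<Gamma> s) t1 - phase c (\<Gamma> 0) t1))"
    using \<Gamma> t1(2) by eventually_elim (use r(2) ab t1(1) in blast)
  then have ev': "\<forall>\<^sub>F s in at 0. trajectory I (\<Gamma> s) \<and> (\<forall>t\<in>{a..b}. \<Gamma> s t \<in> cdom c \<and>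
      norm (phase c (\<Gamma> s) t - phase c (\<Gamma> 0) t) \<le> K * norm (phase c (\<Gamma> s) t1 - phase c (\<Gamma> 0) t1))"
    by (auto simp: eventually_at_filter elim: eventually_mono)
  have "\<exists>z. (\<forall>t\<in>{a..b}. (z has_vector_derivative flow_linearization c (phase c (\<Gamma> 0) t) (z t)) (at t within {a..b}))
    \<and> (\<forall>t\<in>{a..b}. ((\<lambda>s. (phase c (\<Gamma> s) t - phase c (\<Gamma> 0) t) /\<^sub>R s) \<longlongrightarrow> z t) (at 0))"
  proof (rule flow_derivative[OF open_phase[OF c] flow_field_has_derivative[OF c] flow_linearization_continuous[OF c] t1(1),
        of "phase c (\<Gamma> 0)" "\<lambda>s. phase c (\<Gamma> s)" K z1])
    show "phase c (\<Gamma> 0) t \<in> coord c ` cdom c \<times> UNIV" if "t \<in> {a..b}" for t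
      using dom[OF that] by (simp add: phase_def)
    show "(phase c (\<Gamma> 0) has_vector_derivative flow_field c (phase c (\<Gamma> 0) t)) (at t)" if "t \<in> {a..b}" for t
      using trajectory_phase(1)[OF \<Gamma>0 _ c dom[OF that]] ab that by blast
    show "\<forall>\<^sub>F s in at 0. \<forall>t\<in>{a..b}. (phase c (\<Gamma> s) has_vector_derivative flow_field c (phase c (\<Gamma> s) t)) (at t)"
      using ev' by eventually_elim (use trajectory_phase(1)[OF _ _ c] ab in blast)
    show "\<forall>\<^sub>F s in at 0. \<forall>t\<in>{a..b}. norm (phase c (\<Gamma> s) t - phase c (\<Gamma> 0) t) \<le> K * norm (phase c (\<Gamma> s) t1 - phase c (\<Gamma> 0) t1)"
      using ev' by eventually_elim blast
    show "((\<lambda>s. (phase c (\<Gamma> s) t1 - phase c (\<Gamma> 0) t1) /\<^sub>R s) \<longlongrightarrow> z1) (at 0)"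
      using t1(3) by (simp add: has_vector_derivative_at_0_iff)
  qed (assumption, rule_tac x = z in exI, intro conjI ballI, blast+)
  then obtain z where z: "\<forall>t\<in>{a..b}. (z has_vector_derivative flow_linearization c (phase c (\<Gamma> 0) t) (z t)) (at t within {a..b})"
    "\<forall>t\<in>{a..b}. ((\<lambda>s. (phase c (\<Gamma> s) t - phase c (\<Gamma> 0) t) /\<^sub>R s) \<longlongrightarrow> z t) (at 0)" by blast
  have "\<forall>\<^sub>F s in nhds 0. \<Gamma> s t \<in> cdom c" if "t \<in> {a..b}" for t
    using ev by eventually_elim (use that in blast)
  with z show ?thesis by (intro that[of z]) (simp_all add: has_vector_derivative_at_0_iff)
qed

lemma trajectory_interval:
  assumes "trajectory I \<gamma>" "t \<in> I" "c \<in> atlas" "\<gamma> t \<in> cdom c"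
  obtains \<eta> where "0 < \<eta>" "{t - \<eta>..t + \<eta>} \<subseteq> I" "\<And>s. s \<in> {t - \<eta>..t + \<eta>} \<Longrightarrow> \<gamma> s \<in> cdom c"
proof -
  obtain e where e: "0 < e" "\<And>s. dist s t < e \<Longrightarrow> s \<in> I \<and> \<gamma> s \<in> cdom c"
    using trajectory_eventually_chart[OF assms] by (auto simp: eventually_nhds_metric)
  then show ?thesis by (intro that[of "e / 2"]) (auto simp: dist_real_def subset_iff)
qed

text \<open>Position and velocity are taken together because only the full phase propagates in time.
  The first clause keeps the coordinates meaningful, as their values outside the chart are
  arbitrary.\<close>

definition differentiable_phase :: "(real \<Rightarrow> real \<Rightarrow> 'a) \<Rightarrow> ('a, 'n) chart \<Rightarrow> real \<Rightarrow> bool" where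
  "differentiable_phase \<Gamma> c t \<longleftrightarrow> (\<forall>\<^sub>F s in nhds 0. \<Gamma> s t \<in> cdom c) \<and>
    (\<exists>D. ((\<lambda>s. phase c (\<Gamma> s) t) has_vector_derivative D) (at 0))"

lemma differentiable_phase_change:
  assumes \<Gamma>: "\<forall>\<^sub>F s in nhds 0. trajectory I (\<Gamma> s)" and "t \<in> I" and c: "c \<in> atlas" "d \<in> atlas"
    and g: "differentiable_phase \<Gamma> c t" and d: "\<Gamma> 0 t \<in> cdom d"
  shows "differentiable_phase \<Gamma> d t"
proof -
  obtain D where ev: "\<forall>\<^sub>F s in nhds 0. \<Gamma> s t \<in> cdom c"
    and D: "((\<lambda>s. phase c (\<Gamma> s) t) has_vector_derivative D) (at 0)"
    using g by (auto simp: differentiable_phase_def)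
  have x: "((\<lambda>s. coord c (\<Gamma> s t)) has_vector_derivative fst D) (at 0)"
    and v: "((\<lambda>s. vel c (\<Gamma> s) t) has_vector_derivative snd D) (at 0)"
    using D by (auto simp: has_vector_derivative_Pair_fst_snd[of _ D] phase_def)
  have ev': "\<forall>\<^sub>F s in nhds 0. \<Gamma> s t \<in> cdom d"
    by (rule curve_eventually_in_chart[OF c d ev x])
  obtain W where W: "((\<lambda>s. jac c d (coord c (\<Gamma> s t)) (vel c (\<Gamma> s) t)) has_vector_derivative W) (at 0)"
    using vector_jac_has_derivative[OF c d ev x v] by blast
  have "((\<lambda>s. vel d (\<Gamma> s) t) has_vector_derivative W) (at 0)"
    by (rule has_vector_derivative_cong_eventually[OF W])
       (use ev ev' \<Gamma> in eventually_elim, use vel_change \<open>t \<in> I\<close> c in metis)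
  with coord_curve_change[OF c d ev x]
  have "((\<lambda>s. phase d (\<Gamma> s) t) has_vector_derivative (jac c d (coord c (\<Gamma> 0 t)) (fst D), W)) (at 0)"
    unfolding phase_def by (rule has_vector_derivative_Pair)
  then show ?thesis unfolding differentiable_phase_def using ev' by blast
qed

text \<open>A trajectory may cross many charts. On short time intervals differentiability at one
  instant gives it at all others, so it spreads over the connected set \<open>I\<close>.\<close>

lemma differentiable_phase_everywhere:
  assumes \<Gamma>: "\<forall>\<^sub>F s in nhds 0. trajectory I (\<Gamma> s)"
    and t0: "t0 \<in> I" "c0 \<in> atlas" "differentiable_phase \<Gamma> c0 t0"
    and t: "t \<in> I" "c \<in> atlas" "\<Gamma> 0 t \<in> cdom c"
  shows "differentiable_phase \<Gamma> c t"
proof -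
  have \<Gamma>0: "trajectory I (\<Gamma> 0)" using \<Gamma> by (rule eventually_nhds_x_imp_x)
  let ?P = "\<lambda>t. \<exists>c\<in>atlas. differentiable_phase \<Gamma> c t"
  have "?P t"
  proof (rule connected_induction_simple[where P = ?P])
    show "connected I" using \<Gamma>0 by (simp add: trajectory_def)
    fix a assume a: "a \<in> I"
    obtain d where d: "d \<in> atlas" "\<Gamma> 0 a \<in> cdom d" using covering by blast
    obtain \<eta> where \<eta>: "0 < \<eta>" "{a - \<eta>..a + \<eta>} \<subseteq> I" "\<And>s. s \<in> {a - \<eta>..a + \<eta>} \<Longrightarrow> \<Gamma> 0 s \<in> cdom d"
      using trajectory_interval[OF \<Gamma>0 a d] by metis
    have "?P y" if x: "x \<in> {a - \<eta><..<a + \<eta>}" and y: "y \<in> {a - \<eta><..<a + \<eta>}" and P: "?P x" for x y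
    proof -
      have x': "x \<in> {a - \<eta>..a + \<eta>}" "y \<in> {a - \<eta>..a + \<eta>}" using x y by auto
      have "differentiable_phase \<Gamma> d x"
        using P differentiable_phase_change[OF \<Gamma>, of x _ d] \<eta> x' d by blast
      then obtain D where D: "\<forall>\<^sub>F s in nhds 0. \<Gamma> s x \<in> cdom d" "((\<lambda>s. phase d (\<Gamma> s) x) has_vector_derivative D) (at 0)"
        by (auto simp: differentiable_phase_def)
      have "differentiable_phase \<Gamma> d y"
        using variation_local[OF \<Gamma> \<eta>(2) d(1) \<eta>(3) x'(1) D] x'(2) unfolding differentiable_phase_def by metis
      then show ?thesis using d by blast
    qed
    then have "\<forall>x\<in>{a - \<eta><..<a + \<eta>}. \<forall>y\<in>{a - \<eta><..<a + \<eta>}. ?P x \<longrightarrow> ?P y" by blast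
    moreover have "{a - \<eta><..<a + \<eta>} \<subseteq> I"
      using \<eta>(2) by (meson greaterThanLessThan_subseteq_atLeastAtMost_iff order_refl subset_trans)
    then have "openin (top_of_set I) {a - \<eta><..<a + \<eta>}" by (intro open_subset) simp_all
    moreover have "a \<in> {a - \<eta><..<a + \<eta>}" using \<eta>(1) by simp
    ultimately show "\<exists>T. openin (top_of_set I) T \<and> a \<in> T \<and> (\<forall>x\<in>T. \<forall>y\<in>T. ?P x \<longrightarrow> ?P y)"
      by blast
  qed (use t0 t in blast)+
  then show ?thesis using differentiable_phase_change[OF \<Gamma> t(1) _ t(2) _ t(3)] by blast
qed

text \<open>The solution supplied by \<open>variation_local\<close> depends on a chosen time
  interval around t; uniqueness of derivatives identifies it there with \<open>Z\<close>, which is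
  defined without that choice.\<close>

lemma variation_equation:
  assumes \<Gamma>: "\<forall>\<^sub>F s in nhds 0. trajectory I (\<Gamma> s)"
    and t0: "t0 \<in> I" "c0 \<in> atlas" "differentiable_phase \<Gamma> c0 t0"
    and t: "t \<in> I" "c \<in> atlas" "\<Gamma> 0 t \<in> cdom c"
  defines "Z \<equiv> \<lambda>t. vector_derivative (\<lambda>s. phase c (\<Gamma> s) t) (at 0)"
  shows "((\<lambda>s. phase c (\<Gamma> s) t) has_vector_derivative Z t) (at 0)"
    and "(Z has_vector_derivative flow_linearization c (phase c (\<Gamma> 0) t) (Z t)) (at t)"
proof -
  have \<Gamma>0: "trajectory I (\<Gamma> 0)" using \<Gamma> by (rule eventually_nhds_x_imp_x)
  obtain D where D: "\<forall>\<^sub>F s in nhds 0. \<Gamma> s t \<in> cdom c" "((\<lambda>s. phase c (\<Gamma> s) t) has_vector_derivative D) (at 0)"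
    using differentiable_phase_everywhere[OF assms(1-7)] by (auto simp: differentiable_phase_def)
  then show "((\<lambda>s. phase c (\<Gamma> s) t) has_vector_derivative Z t) (at 0)"
    using vector_derivative_at[OF D(2)] by (simp add: Z_def)
  obtain \<eta> where \<eta>: "0 < \<eta>" "{t - \<eta>..t + \<eta>} \<subseteq> I" "\<And>s. s \<in> {t - \<eta>..t + \<eta>} \<Longrightarrow> \<Gamma> 0 s \<in> cdom c"
    using trajectory_interval[OF \<Gamma>0 t] by metis
  have tt: "t \<in> {t - \<eta>..t + \<eta>}" using \<eta>(1) by simp
  obtain z where z: "\<And>s. s \<in> {t - \<eta>..t + \<eta>} \<Longrightarrow>
      (z has_vector_derivative flow_linearization c (phase c (\<Gamma> 0) s) (z s)) (at s within {t - \<eta>..t + \<eta>})"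
    "\<And>r. r \<in> {t - \<eta>..t + \<eta>} \<Longrightarrow> ((\<lambda>s. phase c (\<Gamma> s) r) has_vector_derivative z r) (at 0)"
    using variation_local[OF \<Gamma> \<eta>(2) t(2) \<eta>(3) tt D] by metis
  have zZ: "z s = Z s" if "s \<in> {t - \<eta>..t + \<eta>}" for s
    using vector_derivative_at[OF z(2)[OF that]] by (simp add: Z_def)
  have "(z has_vector_derivative flow_linearization c (phase c (\<Gamma> 0) t) (Z t)) (at t)"
    using z(1)[OF tt] \<eta>(1) zZ[OF tt] by (simp add: at_within_Icc_at)
  moreover have "\<forall>\<^sub>F s in nhds t. z s = Z s"
    using eventually_nhds_in_open[of "{t - \<eta><..<t + \<eta>}" t] \<eta>(1)
    by (auto elim!: eventually_mono intro: zZ)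
  ultimately show "(Z has_vector_derivative flow_linearization c (phase c (\<Gamma> 0) t) (Z t)) (at t)"
    by (rule has_vector_derivative_cong_eventually)
qed

text \<open>The phase derivative is split into its two components. The first component of the
  linearised equation, \<tau>' = \<sigma>, is the exchange of the derivatives in s and t.\<close>

lemma variation_of_trajectories:
  assumes \<Gamma>: "\<forall>\<^sub>F s in nhds 0. trajectory I (\<Gamma> s)"
    and t0: "t0 \<in> I" "c0 \<in> atlas" "differentiable_phase \<Gamma> c0 t0"
  defines "\<tau> \<equiv> \<lambda>c t. vector_derivative (\<lambda>s. coord c (\<Gamma> s t)) (at 0)"
    and "\<sigma> \<equiv> \<lambda>c t. vector_derivative (\<lambda>s. vel c (\<Gamma> s) t) (at 0)"
  shows "vector_of_variation I (\<Gamma> 0) \<tau>"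
    and "\<And>c t. c \<in> atlas \<Longrightarrow> t \<in> I \<Longrightarrow> \<Gamma> 0 t \<in> cdom c \<Longrightarrow> (\<tau> c has_vector_derivative \<sigma> c t) (at t)"
    and "\<And>c t. c \<in> atlas \<Longrightarrow> t \<in> I \<Longrightarrow> \<Gamma> 0 t \<in> cdom c \<Longrightarrow>
      ((\<lambda>s. coord c (\<Gamma> s t)) has_vector_derivative \<tau> c t) (at 0)"
    and "\<And>c t. c \<in> atlas \<Longrightarrow> t \<in> I \<Longrightarrow> \<Gamma> 0 t \<in> cdom c \<Longrightarrow>
      ((\<lambda>s. vel c (\<Gamma> s) t) has_vector_derivative \<sigma> c t) (at 0)"
proof -
  have \<Gamma>0: "trajectory I (\<Gamma> 0)" using \<Gamma> by (rule eventually_nhds_x_imp_x)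
  define Z where "Z = (\<lambda>c t. vector_derivative (\<lambda>s. phase c (\<Gamma> s) t) (at 0))"
  have d: "((\<lambda>s. coord c (\<Gamma> s t)) has_vector_derivative fst (Z c t)) (at 0)"
    "((\<lambda>s. vel c (\<Gamma> s) t) has_vector_derivative snd (Z c t)) (at 0)"
    if "t \<in> I" "c \<in> atlas" "\<Gamma> 0 t \<in> cdom c" for c t
    using variation_equation(1)[OF \<Gamma> t0 that]
    unfolding has_vector_derivative_Pair_fst_snd[of "\<lambda>s. phase c (\<Gamma> s) t"]
    by (simp_all add: Z_def phase_def)
  have ZZ: "Z c t = (\<tau> c t, \<sigma> c t)" if "t \<in> I" "c \<in> atlas" "\<Gamma> 0 t \<in> cdom c" for c t
    using vector_derivative_at[OF d(1)[OF that]] vector_derivative_at[OF d(2)[OF that]]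
    by (simp add: \<tau>_def \<sigma>_def)
  show dx: "((\<lambda>s. coord c (\<Gamma> s t)) has_vector_derivative \<tau> c t) (at 0)"
    and dv: "((\<lambda>s. vel c (\<Gamma> s) t) has_vector_derivative \<sigma> c t) (at 0)"
    if "c \<in> atlas" "t \<in> I" "\<Gamma> 0 t \<in> cdom c" for c t
    using d[OF that(2,1,3)] ZZ[OF that(2,1,3)] by auto
  have Zd: "((\<lambda>t. (\<tau> c t, \<sigma> c t)) has_vector_derivative flow_linearization c (phase c (\<Gamma> 0) t) (\<tau> c t, \<sigma> c t)) (at t)"
    if "c \<in> atlas" "t \<in> I" "\<Gamma> 0 t \<in> cdom c" for c t
  proof (rule has_vector_derivative_cong_eventually)
    show "(Z c has_vector_derivative flow_linearization c (phase c (\<Gamma> 0) t) (\<tau> c t, \<sigma> c t)) (at t)"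
      using variation_equation(2)[OF \<Gamma> t0 that(2,1,3)] ZZ[OF that(2,1,3)] by (simp add: Z_def)
    show "\<forall>\<^sub>F s in nhds t. Z c s = (\<tau> c s, \<sigma> c s)"
      using trajectory_eventually_chart[OF \<Gamma>0 that(2,1,3)]
      by eventually_elim (use ZZ that(1) in blast)
  qed
  have \<tau>': "(\<tau> c has_vector_derivative \<sigma> c t) (at t)"
    and \<sigma>': "(\<sigma> c has_vector_derivative snd (flow_linearization c (phase c (\<Gamma> 0) t) (\<tau> c t, \<sigma> c t))) (at t)"
    if "c \<in> atlas" "t \<in> I" "\<Gamma> 0 t \<in> cdom c" for c t
    using Zd[OF that] unfolding has_vector_derivative_Pair_fst_snd[of "\<lambda>t. (\<tau> c t, \<sigma> c t)"]
    by (auto simp: flow_linearization_def)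
  show "(\<tau> c has_vector_derivative \<sigma> c t) (at t)" if "c \<in> atlas" "t \<in> I" "\<Gamma> 0 t \<in> cdom c" for c t
    by (rule \<tau>'[OF that])
  show "vector_of_variation I (\<Gamma> 0) \<tau>"
  proof (rule vector_of_variationI[OF \<Gamma>0 _ \<tau>' \<sigma>'])
    show "vector_along I (\<Gamma> 0) \<tau>"
      unfolding vector_along_def
    proof
      fix t assume t: "t \<in> I"
      obtain c where c: "c \<in> atlas" "\<Gamma> 0 t \<in> cdom c" using covering by blast
      show "tangent_vector (\<Gamma> 0 t) (\<lambda>c. \<tau> c t)"
      proof (rule tangent_vectorI[OF c])
        fix d assume dd: "d \<in> atlas" "\<Gamma> 0 t \<in> cdom d"
        have "\<forall>\<^sub>F s in nhds 0. \<Gamma> s t \<in> cdom c"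
          using differentiable_phase_everywhere[OF \<Gamma> t0 t c] by (simp add: differentiable_phase_def)
        from coord_curve_change[where \<sigma> = "\<lambda>s. \<Gamma> s t", OF c(1) dd(1) dd(2) this dx[OF c(1) t c(2)]]
        show "\<tau> d t = jac c d (coord c (\<Gamma> 0 t)) (\<tau> c t)"
          using dx[OF dd(1) t dd(2)] vector_derivative_unique_at by blast
      qed
    qed
  qed
qed

end


section \<open>Shifts\<close>

text \<open>Gronwall for the pair (\<phi>, \<phi>') on the compact interval from -|t| to |t|, where
  \<open>A\<close> and \<open>B\<close> are bounded: with zero initial data and zero error the bound
  is 0.\<close>

lemma linear_ode_zero:
  fixes \<phi> \<phi>' A B :: "real \<Rightarrow> real"
  assumes A: "continuous_on {-\<epsilon><..<\<epsilon>} A" and B: "continuous_on {-\<epsilon><..<\<epsilon>} B"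
    and \<phi>: "\<And>t. t \<in> {-\<epsilon><..<\<epsilon>} \<Longrightarrow> (\<phi> has_real_derivative \<phi>' t) (at t)"
    and \<phi>': "\<And>t. t \<in> {-\<epsilon><..<\<epsilon>} \<Longrightarrow> (\<phi>' has_real_derivative A t * \<phi>' t + B t * \<phi> t) (at t)"
    and 0: "\<phi> 0 = 0" "\<phi>' 0 = 0" and t: "t \<in> {-\<epsilon><..<\<epsilon>}"
  shows "\<phi> t = 0"
proof -
  define b where "b = \<bar>t\<bar>"
  have sub: "{-b..b} \<subseteq> {-\<epsilon><..<\<epsilon>}" using t by (auto simp: b_def)
  have "\<exists>M. \<forall>s\<in>{-b..b}. \<bar>h s\<bar> \<le> M" if "continuous_on {-\<epsilon><..<\<epsilon>} h" for h :: "real \<Rightarrow> real"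
    using compact_imp_bounded[OF compact_continuous_image[OF continuous_on_subset[OF that sub]]]
    by (auto simp: bounded_iff)
  then obtain MA MB where M: "\<And>s. s \<in> {-b..b} \<Longrightarrow> \<bar>A s\<bar> \<le> MA" "\<And>s. s \<in> {-b..b} \<Longrightarrow> \<bar>B s\<bar> \<le> MB"
    using A B by metis
  have "0 \<in> {-b..b}" by (simp add: b_def)
  then have M0: "0 \<le> MA" "0 \<le> MB" using M[of 0] by auto
  define y where "y s = (\<phi> s, \<phi>' s)" for s
  have "(norm (y t))\<^sup>2 \<le> ((norm (y 0))\<^sup>2 + 0\<^sup>2 * (b - - b)) * exp ((2 * (1 + MA + MB) + 1) * (b - - b))"
  proof (rule gronwall)
    show "0 \<le> 1 + MA + MB" using M0 by simp
    show "0 \<in> {-b..b}" "t \<in> {-b..b}" by (auto simp: b_def)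
    fix s assume s: "s \<in> {-b..b}"
    have "(y has_vector_derivative (\<phi>' s, A s * \<phi>' s + B s * \<phi> s)) (at s)"
      unfolding y_def using \<phi>[of s] \<phi>'[of s] s sub
      by (intro has_vector_derivative_Pair) (auto simp: has_real_derivative_iff_has_vector_derivative)
    then show "(y has_vector_derivative (\<phi>' s, A s * \<phi>' s + B s * \<phi> s)) (at s within {-b..b})"
      by (rule has_vector_derivative_at_within)
    have n: "\<bar>\<phi> s\<bar> \<le> norm (y s)" "\<bar>\<phi>' s\<bar> \<le> norm (y s)"
      unfolding y_def using norm_fst_le[of "\<phi> s" "\<phi>' s"] norm_snd_le[of "\<phi>' s" "\<phi> s"] by auto
    have "norm (\<phi>' s, A s * \<phi>' s + B s * \<phi> s) \<le> \<bar>\<phi>' s\<bar> + \<bar>A s * \<phi>' s + B s * \<phi> s\<bar>"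
      using norm_Pair_le[of "\<phi>' s" "A s * \<phi>' s + B s * \<phi> s"] by simp
    also have "\<dots> \<le> \<bar>\<phi>' s\<bar> + (\<bar>A s\<bar> * \<bar>\<phi>' s\<bar> + \<bar>B s\<bar> * \<bar>\<phi> s\<bar>)"
      by (intro add_left_mono order_trans[OF abs_triangle_ineq]) (simp add: abs_mult)
    also have "\<dots> \<le> norm (y s) + (MA * norm (y s) + MB * norm (y s))"
      using n M[OF s] M0 by (intro add_mono mult_mono) auto
    finally show "norm (\<phi>' s, A s * \<phi>' s + B s * \<phi> s) \<le> (1 + MA + MB) * norm (y s) + 0"
      by (simp add: algebra_simps)
  qed
  then have "y t = 0" using 0 by (simp add: y_def zero_prod_def)
  then show ?thesis by (simp add: y_def zero_prod_def)
qed

section \<open>Vectors of variation and deviations of a shift\<close>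

context newtonian_system
begin

lemma scalar_prod_change:
  assumes "c \<in> atlas" "d \<in> atlas" "p \<in> cdom c" "p \<in> cdom d"
  shows "scalar_prod (g d (coord d p)) (jac c d (coord c p) X) (jac c d (coord c p) Y)
    = scalar_prod (g c (coord c p)) X Y"
  using metric_tensor[OF assms(1,2), of "coord c p" X Y] assms by auto

text \<open>A vector tangent to the slice is a combination of the axes k \<noteq> i.\<close>

lemma slice_scalar_prod:
  assumes "X $ i = 0" "\<And>k. k \<noteq> i \<Longrightarrow> scalar_prod G (axis k 1) Y = 0"
  shows "scalar_prod G X Y = (0 :: real)"
proof -
  have "scalar_prod G X Y = (\<Sum>k\<in>UNIV. X $ k *\<^sub>R scalar_prod G (axis k 1) Y)"
    by (rule linear_apply_axis_sum) (simp add: bounded_linear.linear scalar_prod.bounded_linear_left)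
  also have "\<dots> = 0"
    by (rule sum.neutral) (metis assms mult_zero_left mult_zero_right real_scaleR_def)
  finally show ?thesis .
qed

text \<open>Smoothness of \<nu> is available only through its extension, in slice charts of the
  larger hypersurface. A coordinate line of \<open>S\<close> is also a curve in \<open>T\<close> and
  is rewritten in such a chart.\<close>

lemma transformation_class_fun_line:
  assumes \<nu>: "transformation_class_fun S \<nu>" and c: "slice_chart S c i" "u \<in> slice_dom c i"
  shows "\<exists>D. ((\<lambda>s. \<nu> (slice_param c i (u + s *\<^sub>R w))) has_vector_derivative D) (at 0)"
proof -
  obtain T \<mu> where T: "hypersurface T" "closure S \<subseteq> T" "smooth_fun_on T \<mu>" "\<And>p. p \<in> S \<Longrightarrow> \<mu> p = \<nu> p"
    using \<nu> unfolding transformation_class_fun_def compactly_contained_def by blast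
  define \<sigma> where "\<sigma> s = slice_param c i (u + s *\<^sub>R w)" for s
  note ca = slice_chart_atlas[OF c(1)]
  have evS: "\<forall>\<^sub>F s in nhds 0. \<sigma> s \<in> S" and evc: "\<forall>\<^sub>F s in nhds 0. \<sigma> s \<in> cdom c"
    using slice_line_eventually[OF ca c(2), of w]
    by (auto elim!: eventually_mono simp: \<sigma>_def intro: slice_param_props[OF c(1)])
  have ST: "S \<subseteq> T" using T(2) closure_subset by blast
  have "\<sigma> 0 \<in> T" using evS ST eventually_nhds_x_imp_x by fast
  then obtain e j where e: "slice_chart T e j" "\<sigma> 0 \<in> cdom e"
    using T(1) unfolding hypersurface_def by blast
  note ea = slice_chart_atlas[OF e(1)]
  have dc: "((\<lambda>s. coord c (\<sigma> s)) has_vector_derivative flat i w) (at 0)"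
    unfolding \<sigma>_def by (rule slice_line_has_derivative[OF c])
  have eve: "\<forall>\<^sub>F s in nhds 0. \<sigma> s \<in> cdom e" by (rule curve_eventually_in_chart[OF ca ea e(2) evc dc])
  have "smooth_on (slice_dom e j) (\<lambda>u. \<mu> (slice_param e j u))"
    using T(3) e(1) unfolding smooth_fun_on_def by blast
  from smooth_on_has_derivative[OF this slice_param_coord(1)[OF e(1) \<open>\<sigma> 0 \<in> T\<close> e(2)]]
  have "((\<lambda>s. \<mu> (slice_param e j (coord e (\<sigma> s)))) has_vector_derivative
      frechet_derivative (\<lambda>u. \<mu> (slice_param e j u)) (at (coord e (\<sigma> 0))) (jac c e (coord c (\<sigma> 0)) (flat i w))) (at 0)"
    by (rule has_derivative_vector_compose[OF coord_curve_change[OF ca ea e(2) evc dc]])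
  moreover have "\<forall>\<^sub>F s in nhds 0. \<mu> (slice_param e j (coord e (\<sigma> s))) = \<nu> (\<sigma> s)"
    using evS eve by eventually_elim (use slice_param_coord(2)[OF e(1)] ST T(4) in auto)
  ultimately have "((\<lambda>s. \<nu> (\<sigma> s)) has_vector_derivative
      frechet_derivative (\<lambda>u. \<mu> (slice_param e j u)) (at (coord e (\<sigma> 0))) (jac c e (coord c (\<sigma> 0)) (flat i w))) (at 0)"
    by (rule has_vector_derivative_cong_eventually)
  then show ?thesis unfolding \<sigma>_def by blast
qed

lemma unit_normal_field_line:
  assumes n: "unit_normal_field S n" and c: "slice_chart S c i" "u \<in> slice_dom c i"
  shows "\<exists>D. ((\<lambda>s. n c (slice_param c i (u + s *\<^sub>R w))) has_vector_derivative D) (at 0)"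
proof -
  have "smooth_on (slice_dom c i) (\<lambda>u. n c (slice_param c i u))"
    using n c(1) unfolding unit_normal_field_def smooth_field_on_def by blast
  from smooth_on_has_derivative[OF this c(2)]
  have "((\<lambda>u. n c (slice_param c i u)) has_derivative
      frechet_derivative (\<lambda>u. n c (slice_param c i u)) (at u)) (at (u + 0 *\<^sub>R w))" by simp
  moreover have "((\<lambda>s. u + s *\<^sub>R w) has_vector_derivative w) (at 0)" by (auto intro!: derivative_eq_intros)
  ultimately show ?thesis using has_derivative_vector_compose by blast
qed

text \<open>The seed from which differentiability propagates: at time 0 the phase is (p, \<nu> n),
  which is differentiable along the line of starting points p.\<close>

lemma shift_line:
  fixes w :: "real^'n"
  assumes n: "unit_normal_field S n" and \<nu>: "transformation_class_fun S \<nu>" and f: "is_shift S n \<nu> \<epsilon> f"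
    and c: "slice_chart S c i" "u \<in> slice_dom c i"
  defines "\<Gamma> \<equiv> \<lambda>s. f (slice_param c i (u + s *\<^sub>R w))"
  shows "\<forall>\<^sub>F s in nhds 0. trajectory {-\<epsilon><..<\<epsilon>} (\<Gamma> s)"
    and "differentiable_phase \<Gamma> c 0"
proof -
  define \<sigma> where "\<sigma> s = slice_param c i (u + s *\<^sub>R w)" for s
  note ca = slice_chart_atlas[OF c(1)]
  have fS: "trajectory {-\<epsilon><..<\<epsilon>} (f p)" "f p 0 = p" "p \<in> cdom c \<Longrightarrow> vel c (f p) 0 = \<nu> p *\<^sub>R n c p" if "p \<in> S" for p
    using f that ca unfolding is_shift_def by blast+
  have ev: "\<forall>\<^sub>F s in nhds 0. \<sigma> s \<in> S \<inter> cdom c"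
    using slice_line_eventually[OF ca c(2), of w]
    by eventually_elim (auto simp: \<sigma>_def intro: slice_param_props[OF c(1)])
  show "\<forall>\<^sub>F s in nhds 0. trajectory {-\<epsilon><..<\<epsilon>} (\<Gamma> s)"
    using ev by eventually_elim (simp add: \<Gamma>_def \<sigma>_def fS)
  have ev2: "\<forall>\<^sub>F s in nhds 0. \<sigma> s \<in> S \<inter> cdom c \<and> \<Gamma> s 0 = \<sigma> s \<and> vel c (\<Gamma> s) 0 = \<nu> (\<sigma> s) *\<^sub>R n c (\<sigma> s)"
    using ev by eventually_elim (simp add: \<Gamma>_def \<sigma>_def fS)
  obtain D1 D2 where "((\<lambda>s. \<nu> (\<sigma> s)) has_vector_derivative D1) (at 0)" "((\<lambda>s. n c (\<sigma> s)) has_vector_derivative D2) (at 0)"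
    using transformation_class_fun_line[OF \<nu> c, of w] unit_normal_field_line[OF n c, of w] by (auto simp: \<sigma>_def)
  then have "((\<lambda>s. \<nu> (\<sigma> s) *\<^sub>R n c (\<sigma> s)) has_vector_derivative \<nu> (\<sigma> 0) *\<^sub>R D2 + D1 *\<^sub>R n c (\<sigma> 0)) (at 0)"
    by (rule bounded_bilinear.has_vector_derivative[OF bounded_bilinear_scaleR])
  with slice_line_has_derivative[OF c, of w]
  have "((\<lambda>s. (coord c (\<sigma> s), \<nu> (\<sigma> s) *\<^sub>R n c (\<sigma> s))) has_vector_derivative
      (flat i w, \<nu> (\<sigma> 0) *\<^sub>R D2 + D1 *\<^sub>R n c (\<sigma> 0))) (at 0)"
    unfolding \<sigma>_def by (rule has_vector_derivative_Pair)
  then have "((\<lambda>s. phase c (\<Gamma> s) 0) has_vector_derivative (flat i w, \<nu> (\<sigma> 0) *\<^sub>R D2 + D1 *\<^sub>R n c (\<sigma> 0))) (at 0)"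
    by (rule has_vector_derivative_cong_eventually) (use ev2 in eventually_elim, simp add: phase_def)
  moreover have "\<forall>\<^sub>F s in nhds 0. \<Gamma> s 0 \<in> cdom c" using ev2 by eventually_elim simp
  ultimately show "differentiable_phase \<Gamma> c 0" unfolding differentiable_phase_def by blast
qed

lemma shift_variation_props:
  fixes k :: 'n
  assumes n: "unit_normal_field S n" and \<nu>: "transformation_class_fun S \<nu>" and f: "is_shift S n \<nu> \<epsilon> f"
    and c: "slice_chart S c i" "u \<in> slice_dom c i"
  defines "p \<equiv> slice_param c i u" and "\<Gamma> \<equiv> \<lambda>s. f (slice_param c i (u + s *\<^sub>R axis k 1))"
  shows "vector_of_variation {-\<epsilon><..<\<epsilon>} (f p) (\<lambda>d. shift_variation f c i d k u)"
    and "\<And>d t. d \<in> atlas \<Longrightarrow> t \<in> {-\<epsilon><..<\<epsilon>} \<Longrightarrow> f p t \<in> cdom d \<Longrightarrow>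
      ((\<lambda>s. coord d (\<Gamma> s t)) has_vector_derivative shift_variation f c i d k u t) (at 0)"
    and "\<And>d t. d \<in> atlas \<Longrightarrow> t \<in> {-\<epsilon><..<\<epsilon>} \<Longrightarrow> f p t \<in> cdom d \<Longrightarrow> \<forall>\<^sub>F s in nhds 0. \<Gamma> s t \<in> cdom d"
    and "\<And>d t. d \<in> atlas \<Longrightarrow> t \<in> {-\<epsilon><..<\<epsilon>} \<Longrightarrow> f p t \<in> cdom d \<Longrightarrow>
      (shift_variation f c i d k u has_vector_derivative vector_derivative (\<lambda>s. vel d (\<Gamma> s) t) (at 0)) (at t)"
    and "\<And>d t. d \<in> atlas \<Longrightarrow> t \<in> {-\<epsilon><..<\<epsilon>} \<Longrightarrow> f p t \<in> cdom d \<Longrightarrow>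
      ((\<lambda>s. vel d (\<Gamma> s) t) has_vector_derivative vector_derivative (\<lambda>s. vel d (\<Gamma> s) t) (at 0)) (at 0)"
proof -
  have L: "\<forall>\<^sub>F s in nhds 0. trajectory {-\<epsilon><..<\<epsilon>} (\<Gamma> s)" "differentiable_phase \<Gamma> c 0"
    unfolding \<Gamma>_def by (rule shift_line[OF n \<nu> f c])+
  have I0: "0 \<in> {-\<epsilon><..<\<epsilon>}" using f by (simp add: is_shift_def)
  note V = variation_of_trajectories[OF L(1) I0 slice_chart_atlas[OF c(1)] L(2)]
  have sv: "(\<lambda>d. shift_variation f c i d k u) = (\<lambda>d t. vector_derivative (\<lambda>s. coord d (\<Gamma> s t)) (at 0))"
    by (simp add: shift_variation_def \<Gamma>_def fun_eq_iff)
  have \<Gamma>0: "\<Gamma> 0 = f p" by (simp add: \<Gamma>_def p_def)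
  show "vector_of_variation {-\<epsilon><..<\<epsilon>} (f p) (\<lambda>d. shift_variation f c i d k u)"
    unfolding sv using V(1) \<Gamma>0 by simp
  fix d t assume d: "d \<in> atlas" "t \<in> {-\<epsilon><..<\<epsilon>}" "f p t \<in> cdom d"
  have sv': "shift_variation f c i d k u = (\<lambda>t. vector_derivative (\<lambda>s. coord d (\<Gamma> s t)) (at 0))"
    by (simp add: shift_variation_def \<Gamma>_def fun_eq_iff)
  show "((\<lambda>s. coord d (\<Gamma> s t)) has_vector_derivative shift_variation f c i d k u t) (at 0)"
    "(shift_variation f c i d k u has_vector_derivative vector_derivative (\<lambda>s. vel d (\<Gamma> s) t) (at 0)) (at t)"
    "((\<lambda>s. vel d (\<Gamma> s) t) has_vector_derivative vector_derivative (\<lambda>s. vel d (\<Gamma> s) t) (at 0)) (at 0)"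
    unfolding sv' using V(2-4)[OF d(1,2)] d(3) \<Gamma>0 by auto
  show "\<forall>\<^sub>F s in nhds 0. \<Gamma> s t \<in> cdom d"
    using differentiable_phase_everywhere[OF L(1) I0 slice_chart_atlas[OF c(1)] L(2) d(2,1)] d(3) \<Gamma>0
    by (simp add: differentiable_phase_def)
qed

lemma vector_of_variation_change:
  assumes "vector_of_variation I \<gamma> \<tau>" "t \<in> I" "c \<in> atlas" "d \<in> atlas" "\<gamma> t \<in> cdom c" "\<gamma> t \<in> cdom d"
  shows "\<tau> d t = jac c d (coord c (\<gamma> t)) (\<tau> c t)"
proof -
  have "tangent_vector (\<gamma> t) (\<lambda>c. \<tau> c t)"
    using assms(1,2) unfolding vector_of_variation_def vector_along_def by blast
  from tangent_vectorD[OF this assms(3-6)] show ?thesis .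
qed

lemma deviation_change:
  assumes "trajectory I \<gamma>" "vector_of_variation I \<gamma> \<tau>" "t \<in> I"
    "c \<in> atlas" "d \<in> atlas" "\<gamma> t \<in> cdom c" "\<gamma> t \<in> cdom d"
  shows "scalar_prod (g d (coord d (\<gamma> t))) (vel d \<gamma> t) (\<tau> d t) = scalar_prod (g c (coord c (\<gamma> t))) (vel c \<gamma> t) (\<tau> c t)"
  using scalar_prod_change[OF assms(4-7)] vel_change[OF assms(1,3-7)]
    vector_of_variation_change[OF assms(2-7)] by simp

text \<open>Choosing a chart separately at each time is harmless because the scalar product does not
  depend on it.\<close>

lemma function_of_deviation_exists:
  assumes "trajectory I \<gamma>" "vector_of_variation I \<gamma> \<tau>"
  obtains \<phi> where "function_of_deviation I \<gamma> \<phi>"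
    "\<And>t c. t \<in> I \<Longrightarrow> c \<in> atlas \<Longrightarrow> \<gamma> t \<in> cdom c \<Longrightarrow>
      \<phi> t = scalar_prod (g c (coord c (\<gamma> t))) (vel c \<gamma> t) (\<tau> c t)"
proof -
  have "\<forall>t. \<exists>c. c \<in> atlas \<and> \<gamma> t \<in> cdom c" using covering by blast
  then obtain ch where ch: "\<And>t. ch t \<in> atlas" "\<And>t. \<gamma> t \<in> cdom (ch t)" by metis
  define \<phi> where "\<phi> t = scalar_prod (g (ch t) (coord (ch t) (\<gamma> t))) (vel (ch t) \<gamma> t) (\<tau> (ch t) t)" for t
  have *: "\<phi> t = scalar_prod (g c (coord c (\<gamma> t))) (vel c \<gamma> t) (\<tau> c t)"
    if "t \<in> I" "c \<in> atlas" "\<gamma> t \<in> cdom c" for t c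
    unfolding \<phi>_def by (rule deviation_change[OF assms that(1,2) ch(1) that(3) ch(2)])
  then have "function_of_deviation I \<gamma> \<phi>" unfolding function_of_deviation_def using assms(2) by blast
  then show ?thesis using that * by blast
qed

lemma shift_deviation_eq:
  assumes "c \<in> atlas" "f (slice_param c' i u) t \<in> cdom c"
  shows "shift_deviation f c' i c k u t = scalar_prod (g c (coord c (f (slice_param c' i u) t)))
    (vel c (f (slice_param c' i u)) t) (shift_variation f c' i c k u t)"
  unfolding shift_deviation_def Let_def by (rule scalar_prod_sym) (use assms in auto)

text \<open>The vector of variation is the derivative of a curve in the shifted hypersurface, hence
  tangent to it, and normality makes the velocity orthogonal to a basis of the tangent
  space.\<close>

lemma normal_shift_deviation:
  assumes n: "unit_normal_field S n" and \<nu>: "transformation_class_fun S \<nu>" and f: "is_normal_shift S n \<nu> \<epsilon> f"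
    and c: "slice_chart S c i" "u \<in> slice_dom c i"
    and t: "t \<in> {-\<epsilon><..<\<epsilon>}" "d \<in> atlas" "f (slice_param c i u) t \<in> cdom d"
  shows "shift_deviation f c i d k u t = 0"
proof -
  have f': "is_shift S n \<nu> \<epsilon> f" using f by (simp add: is_normal_shift_def)
  define p where "p = slice_param c i u"
  define \<Gamma> where "\<Gamma> s = f (slice_param c i (u + s *\<^sub>R axis k 1))" for s
  define St where "St = (\<lambda>p. f p t) ` S"
  note V = shift_variation_props[where k = k, OF n \<nu> f' c, folded p_def \<Gamma>_def]
  note td = t(3)[folded p_def]
  have pS: "p \<in> S" unfolding p_def by (rule slice_param_props[OF c])
  have \<gamma>: "trajectory {-\<epsilon><..<\<epsilon>} (f p)" using f' pS unfolding is_shift_def by blast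
  have "hypersurface St" using f' t(1) unfolding is_shift_def St_def by blast
  moreover have "f p t \<in> St" using pS by (simp add: St_def)
  ultimately obtain e j where e: "slice_chart St e j" "f p t \<in> cdom e"
    unfolding hypersurface_def by blast
  note ea = slice_chart_atlas[OF e(1)]
  have "\<forall>\<^sub>F s in nhds 0. \<Gamma> s t \<in> St"
    using slice_line_eventually[OF slice_chart_atlas[OF c(1)] c(2), of "axis k 1"]
    by eventually_elim (auto simp: \<Gamma>_def St_def intro!: slice_param_props[OF c(1)])
  from curve_in_slice[where \<sigma> = "\<lambda>s. \<Gamma> s t", OF e(1) this V(3)[OF ea t(1) e(2)] V(2)[OF ea t(1) e(2)]]
  have "shift_variation f c i e k u t $ j = 0" .
  moreover have "scalar_prod (g e (coord e (f p t))) (axis m 1) (vel e (f p) t) = 0" if "m \<noteq> j" for m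
    using f t(1) pS e that unfolding is_normal_shift_def St_def by blast
  ultimately have "scalar_prod (g e (coord e (f p t))) (shift_variation f c i e k u t) (vel e (f p) t) = 0"
    by (rule slice_scalar_prod)
  then have "scalar_prod (g e (coord e (f p t))) (vel e (f p) t) (shift_variation f c i e k u t) = 0"
    using scalar_prod_sym[OF ea, of "coord e (f p t)"] e(2) by simp
  then show ?thesis
    using deviation_change[OF \<gamma> V(1) t(1) ea t(2) e(2) td] shift_deviation_eq[where f = f and c' = c and i = i and u = u and t = t and k = k, OF t(2,3)] by (simp add: p_def)
qed

text \<open>The vectors of variation span the tangent space of S_t because f_t is a diffeomorphism:
  a coordinate line of S_t is pulled back to S, its tangent vector \<open>w\<close> there is pushed
  forward again, and linearity writes the coordinate vector of S_t as a combination of the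
  \<tau>_m.\<close>

lemma normal_shiftI:
  assumes S: "hypersurface S" and f: "is_shift S n \<nu> \<epsilon> f"
    and 0: "\<And>c i u m d t. slice_chart S c i \<Longrightarrow> u \<in> slice_dom c i \<Longrightarrow> m \<noteq> i \<Longrightarrow> d \<in> atlas \<Longrightarrow>
      t \<in> {-\<epsilon><..<\<epsilon>} \<Longrightarrow> f (slice_param c i u) t \<in> cdom d \<Longrightarrow> shift_deviation f c i d m u t = 0"
  shows "is_normal_shift S n \<nu> \<epsilon> f"
  unfolding is_normal_shift_def
proof (intro conjI ballI allI impI f)
  fix t p e j k
  assume t: "t \<in> {-\<epsilon><..<\<epsilon>}" and pS: "p \<in> S" and e: "slice_chart ((\<lambda>q. f q t) ` S) e j" and pe: "f p t \<in> cdom e"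
    and k: "k \<noteq> j"
  define St where "St = (\<lambda>q. f q t) ` S"
  define h where "h = inv_into S (\<lambda>q. f q t)"
  note e = e[folded St_def]
  note ea = slice_chart_atlas[OF e]
  have dif: "bij_betw (\<lambda>q. f q t) S St" "smooth_map_on S (\<lambda>q. f q t)" "smooth_map_on St h"
    using f t unfolding is_shift_def diffeomorphism_def St_def h_def by blast+
  have hS: "h q \<in> S" "f (h q) t = q" if "q \<in> St" for q
    using that unfolding h_def St_def by (auto intro: inv_into_into f_inv_into_f)
  have hp: "h (f p t) = p" using bij_betw_inv_into_left[OF dif(1) pS] by (simp add: h_def)
  obtain c i where c: "slice_chart S c i" "p \<in> cdom c" using S pS unfolding hypersurface_def by blast
  note ca = slice_chart_atlas[OF c(1)]
  define u0 where "u0 = coord c p"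
  note u0 = slice_param_coord[OF c(1) pS c(2), folded u0_def]
  have pt: "f p t \<in> St" using pS by (simp add: St_def)
  define y0 where "y0 = coord e (f p t)"
  note y0 = slice_param_coord[OF e pt pe, folded y0_def]
  define \<rho> where "\<rho> s = slice_param e j (y0 + s *\<^sub>R axis k 1)" for s
  have \<rho>0: "\<rho> 0 = f p t" using y0 by (simp add: \<rho>_def)
  have flat: "flat j (axis k 1) = axis k 1" using k by (simp add: flat_def vec_eq_iff axis_def)
  have d\<rho>: "((\<lambda>s. coord e (\<rho> s)) has_vector_derivative axis k 1) (at 0)"
    using slice_line_has_derivative[OF e y0(1), of "axis k 1"] by (simp add: \<rho>_def flat)
  have ev\<rho>: "\<forall>\<^sub>F s in nhds 0. y0 + s *\<^sub>R axis k 1 \<in> slice_dom e j \<and> \<rho> s \<in> St \<and> \<rho> s \<in> cdom e"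
    using slice_line_eventually[OF ea y0(1), of "axis k 1"]
    by eventually_elim (auto simp: \<rho>_def intro: slice_param_props[OF e])
  have "continuous_on St h" using dif(3) by (simp add: smooth_map_on_def)
  \<comment> \<open>\<open>h\<close> is continuous only relative to \<open>St\<close>. Landing in
    the chart is therefore expressed by an open set of the manifold, to which
    \<open>curve_eventually_in_open\<close> applies.\<close>
  then obtain W where W: "open W" "W \<inter> St = h -` cdom c \<inter> St"
    using open_cdom[OF ca] continuous_on_open_invariant by metis
  have "\<rho> 0 \<in> W" using W(2) pt hp c(2) \<rho>0 by auto
  then have "\<forall>\<^sub>F s in nhds 0. \<rho> s \<in> W"
    using curve_eventually_in_open[OF ea W(1) _ eventually_mono[OF ev\<rho>] d\<rho>] by blast
  then have evh: "\<forall>\<^sub>F s in nhds 0. h (\<rho> s) \<in> cdom c \<and> h (\<rho> s) \<in> S"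
    using ev\<rho> by eventually_elim (use W(2) hS in blast)
  have sm: "smooth_on {u \<in> slice_dom e j. h (slice_param e j u) \<in> cdom c} (\<lambda>u. coord c (h (slice_param e j u)))"
    using dif(3) e ca unfolding smooth_map_on_def by blast
  have "y0 \<in> {u \<in> slice_dom e j. h (slice_param e j u) \<in> cdom c}" using y0 hp c(2) by simp
  from smooth_on_has_derivative[OF sm this]
  have "((\<lambda>u. coord c (h (slice_param e j u))) has_derivative
      frechet_derivative (\<lambda>u. coord c (h (slice_param e j u))) (at y0)) (at (y0 + 0 *\<^sub>R axis k 1))" by simp
  moreover have "((\<lambda>s. y0 + s *\<^sub>R axis k 1) has_vector_derivative axis k 1) (at 0)"
    by (auto intro!: derivative_eq_intros)
  ultimately obtain w where w: "((\<lambda>s. coord c (h (\<rho> s))) has_vector_derivative w) (at 0)"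
    unfolding \<rho>_def using has_derivative_vector_compose by blast
  have wi: "w $ i = 0"
    using evh by (intro curve_in_slice[where \<sigma> = "\<lambda>s. h (\<rho> s)", OF c(1) _ _ w]) (auto elim: eventually_mono)
  have sm: "smooth_on {u \<in> slice_dom c i. f (slice_param c i u) t \<in> cdom e} (\<lambda>u. coord e (f (slice_param c i u) t))"
    using dif(2) c(1) ea unfolding smooth_map_on_def by blast
  have "u0 \<in> {u \<in> slice_dom c i. f (slice_param c i u) t \<in> cdom e}" using u0 pe by simp
  from smooth_on_has_derivative[OF sm this]
  obtain \<Phi> where \<Phi>: "((\<lambda>u. coord e (f (slice_param c i u) t)) has_derivative \<Phi>) (at u0)" by blast
  have hu: "coord c (h (\<rho> 0)) = u0" using \<rho>0 hp by (simp add: u0_def)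
  have "((\<lambda>s. coord e (f (slice_param c i (coord c (h (\<rho> s)))) t)) has_vector_derivative \<Phi> w) (at 0)"
    by (rule has_derivative_vector_compose[OF w]) (simp add: hu \<Phi>)
  then have "((\<lambda>s. coord e (\<rho> s)) has_vector_derivative \<Phi> w) (at 0)"
    by (rule has_vector_derivative_cong_eventually)
       (use evh ev\<rho> in eventually_elim, use slice_param_coord(2)[OF c(1)] hS in auto)
  \<comment> \<open>Pulling the coordinate line back and pushing it forward again returns the line
    itself.\<close>
  then have ax: "axis k 1 = \<Phi> w" using d\<rho> vector_derivative_unique_at by blast
  have \<Phi>m: "shift_variation f c i e m u0 t = \<Phi> (axis m 1)" for m
  proof -
    have "((\<lambda>s. u0 + s *\<^sub>R axis m 1) has_vector_derivative axis m 1) (at 0)"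
      by (auto intro!: derivative_eq_intros)
    from has_derivative_vector_compose[OF this, of "\<lambda>u. coord e (f (slice_param c i u) t)" \<Phi>] \<Phi>
    have "((\<lambda>s. coord e (f (slice_param c i (u0 + s *\<^sub>R axis m 1)) t)) has_vector_derivative \<Phi> (axis m 1)) (at 0)"
      by simp
    then show ?thesis unfolding shift_variation_def by (rule vector_derivative_at)
  qed
  let ?G = "g e (coord e (f p t))" and ?v = "vel e (f p) t"
  have "linear (\<lambda>w. scalar_prod ?G (\<Phi> w) ?v)"
    using linear_compose[OF has_derivative_linear[OF \<Phi>] bounded_linear.linear[OF scalar_prod.bounded_linear_left]]
    by (simp add: o_def)
  from linear_apply_axis_sum[OF this, of w]
  have "scalar_prod ?G (axis k 1) ?v = (\<Sum>m\<in>UNIV. w $ m * scalar_prod ?G (shift_variation f c i e m u0 t) ?v)"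
    by (simp add: ax \<Phi>m)
  also have "\<dots> = 0"
  proof (rule sum.neutral, rule ballI)
    fix m
    show "w $ m * scalar_prod ?G (shift_variation f c i e m u0 t) ?v = 0"
      using 0[OF c(1) u0(1) _ ea t, of m] wi u0(2) pe
      by (cases "m = i") (auto simp: shift_deviation_def)
  qed
  finally show "scalar_prod (g e (coord e (f p t))) (axis k 1) (vel e (f p) t) = 0" .
qed

text \<open>At time 0 the vector of variation is the coordinate vector itself and the velocity is a
  multiple of the normal.\<close>

lemma shift_deviation_0:
  assumes n: "unit_normal_field S n" and f: "is_shift S n \<nu> \<epsilon> f"
    and c: "slice_chart S c i" "u \<in> slice_dom c i" "k \<noteq> i"
  shows "shift_deviation f c i c k u 0 = 0"
proof -
  note ca = slice_chart_atlas[OF c(1)]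
  note p = slice_param_props[OF c(1,2)]
  define p where "p = slice_param c i u"
  have f0: "f q 0 = q" "q \<in> cdom c \<Longrightarrow> vel c (f q) 0 = \<nu> q *\<^sub>R n c q" if "q \<in> S" for q
    using f that ca unfolding is_shift_def by blast+
  have flat: "flat i (axis k 1) = axis k 1" using c(3) by (simp add: flat_def vec_eq_iff axis_def)
  have "((\<lambda>s. coord c (f (slice_param c i (u + s *\<^sub>R axis k 1)) 0)) has_vector_derivative axis k 1) (at 0)"
    using slice_line_has_derivative[OF c(1,2), of "axis k 1", unfolded flat]
    by (rule has_vector_derivative_cong_eventually)
       (use slice_line_eventually[OF ca c(2), of "axis k 1"] in eventually_elim,
        use f0 slice_param_props[OF c(1)] in auto)
  then have sv: "shift_variation f c i c k u 0 = axis k 1"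
    unfolding shift_variation_def by (rule vector_derivative_at)
  have "unit_normal S p (\<lambda>c. n c p)" using n p unfolding unit_normal_field_def p_def by blast
  then have "scalar_prod (g c (coord c p)) (n c p) (axis k 1) = 0"
    using c p unfolding unit_normal_def p_def by blast
  then show ?thesis
    using shift_deviation_eq[OF ca, of f c i u 0 k] p f0[OF p(1)]
    by (simp add: sv p_def scalar_prod.scaleR_left)
qed

section \<open>Complete normality implies strong, and strong normality implies additional\<close>

lemma complete_imp_strong:
  assumes "complete_normality"
  shows "strong_normality"
  unfolding strong_normality_def
proof (intro allI impI)
  fix S p\<^sub>0 n\<^sub>0 and \<nu>\<^sub>0 :: real
  assume "hypersurface S \<and> p\<^sub>0 \<in> S \<and> unit_normal S p\<^sub>0 n\<^sub>0 \<and> \<nu>\<^sub>0 \<noteq> 0"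
  then obtain S' n \<nu> \<epsilon> f where A: "piece_around p\<^sub>0 S S'" "unit_normal_field S' n"
    "\<forall>c\<in>atlas. p\<^sub>0 \<in> cdom c \<longrightarrow> n c p\<^sub>0 = n\<^sub>0 c" "transformation_class_fun S' \<nu>" "\<nu> p\<^sub>0 = \<nu>\<^sub>0"
    "is_shift S' n \<nu> \<epsilon> f"
    and D: "\<forall>c i k u. \<forall>d\<in>atlas. slice_chart S' c i \<and> k \<noteq> i \<and> u \<in> slice_dom c i \<and> slice_param c i u \<in> cdom d \<longrightarrow>
             ((\<lambda>t. shift_deviation f c i d k u t) has_real_derivative 0) (at 0)"
    using assms unfolding complete_normality_def additional_normality_def by blast
  have "is_normal_shift S' n \<nu> \<epsilon> f"
  proof (rule normal_shiftI[OF _ A(6)])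
    show "hypersurface S'" using A(1) unfolding piece_around_def transformation_class_def by blast
    fix c i u m d t
    assume c: "slice_chart S' c i" "u \<in> slice_dom c i" "m \<noteq> i" and d: "d \<in> atlas" "t \<in> {-\<epsilon><..<\<epsilon>}" "f (slice_param c i u) t \<in> cdom d"
    let ?I = "{-\<epsilon><..<\<epsilon>}"
    note ca = slice_chart_atlas[OF c(1)]
    define p where "p = slice_param c i u"
    have p: "p \<in> S'" "p \<in> cdom c" using slice_param_props[OF c(1,2)] by (auto simp: p_def)
    have \<gamma>: "trajectory ?I (f p)" "f p 0 = p" using A(6) p(1) unfolding is_shift_def by blast+
    have I0: "0 \<in> ?I" using A(6) by (simp add: is_shift_def)
    note V = shift_variation_props[where k = m, OF A(2,4,6) c(1,2), folded p_def]
    \<comment> \<open>In a fixed chart \<open>shift_deviation\<close> is meaningful only while the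
      trajectory stays there; the equation of the weak condition needs the chart-free function on
      the whole interval.\<close>
    obtain \<phi> where \<phi>: "function_of_deviation ?I (f p) \<phi>"
      "\<And>t c'. t \<in> ?I \<Longrightarrow> c' \<in> atlas \<Longrightarrow> f p t \<in> cdom c' \<Longrightarrow>
        \<phi> t = scalar_prod (g c' (coord c' (f p t))) (vel c' (f p) t) (shift_variation f c i c' m u t)"
      using function_of_deviation_exists[OF \<gamma>(1) V(1)] by metis
    have \<phi>s: "\<phi> t = shift_deviation f c i c' m u t" if "t \<in> ?I" "c' \<in> atlas" "f p t \<in> cdom c'" for t c'
      using \<phi>(2)[OF that] shift_deviation_eq[OF that(2)] that(3) by (simp add: p_def)
    obtain A' B' where AB: "continuous_on ?I A'" "continuous_on ?I B'"
      "\<And>\<phi>. function_of_deviation ?I (f p) \<phi> \<Longrightarrow> \<exists>\<phi>'. \<forall>t\<in>?I. (\<phi> has_real_derivative \<phi>' t) (at t) \<and>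
                       (\<phi>' has_real_derivative A' t * \<phi>' t + B' t * \<phi> t) (at t)"
      using assms \<gamma>(1) unfolding complete_normality_def weak_normality_def by blast
    obtain \<phi>' where \<phi>': "\<And>t. t \<in> ?I \<Longrightarrow> (\<phi> has_real_derivative \<phi>' t) (at t)"
      "\<And>t. t \<in> ?I \<Longrightarrow> (\<phi>' has_real_derivative A' t * \<phi>' t + B' t * \<phi> t) (at t)"
      using AB(3)[OF \<phi>(1)] by blast
    have "\<phi> 0 = 0" using \<phi>s[OF I0 ca] \<gamma>(2) p(2) shift_deviation_0[OF A(2,6) c] by simp
    moreover have "\<phi>' 0 = 0"
    proof -
      have "((\<lambda>t. shift_deviation f c i c m u t) has_vector_derivative 0) (at 0)"
        using D ca c p(2) unfolding p_def has_real_derivative_iff_has_vector_derivative by blast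
      then have "(\<phi> has_vector_derivative 0) (at 0)"
        by (rule has_vector_derivative_cong_eventually)
           (use trajectory_eventually_chart[OF \<gamma>(1) I0 ca] \<gamma>(2) p(2) in \<open>auto elim!: eventually_mono simp: \<phi>s[OF _ ca]\<close>)
      then have "(\<phi> has_real_derivative 0) (at 0)"
        by (simp add: has_real_derivative_iff_has_vector_derivative)
      then show ?thesis using \<phi>'(1)[OF I0] DERIV_unique by blast
    qed
    ultimately have "\<phi> t = 0" using linear_ode_zero[OF AB(1,2) \<phi>'] d(2) by blast
    then show "shift_deviation f c i d m u t = 0" using \<phi>s[OF d(2,1)] d(3) by (simp add: p_def)
  qed
  then show "\<exists>S' n \<nu> \<epsilon> f. piece_around p\<^sub>0 S S' \<and>
          unit_normal_field S' n \<and> (\<forall>c\<in>atlas. p\<^sub>0 \<in> cdom c \<longrightarrow> n c p\<^sub>0 = n\<^sub>0 c) \<and>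
          transformation_class_fun S' \<nu> \<and> \<nu> p\<^sub>0 = \<nu>\<^sub>0 \<and> is_normal_shift S' n \<nu> \<epsilon> f"
    using A by blast
qed

text \<open>The deviations of a normal shift vanish for all t near 0, hence so do their derivatives
  at 0.\<close>

lemma strong_imp_additional:
  assumes "strong_normality"
  shows "additional_normality"
  unfolding additional_normality_def
proof (intro allI impI)
  fix S p\<^sub>0 n\<^sub>0 and \<nu>\<^sub>0 :: real
  assume "hypersurface S \<and> p\<^sub>0 \<in> S \<and> unit_normal S p\<^sub>0 n\<^sub>0 \<and> \<nu>\<^sub>0 \<noteq> 0"
  then obtain S' n \<nu> \<epsilon> f where A: "piece_around p\<^sub>0 S S'" "unit_normal_field S' n"
    "\<forall>c\<in>atlas. p\<^sub>0 \<in> cdom c \<longrightarrow> n c p\<^sub>0 = n\<^sub>0 c" "transformation_class_fun S' \<nu>" "\<nu> p\<^sub>0 = \<nu>\<^sub>0"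
    "is_normal_shift S' n \<nu> \<epsilon> f"
    using assms unfolding strong_normality_def by blast
  have f: "is_shift S' n \<nu> \<epsilon> f" using A(6) by (simp add: is_normal_shift_def)
  have "((\<lambda>t. shift_deviation f c i d k u t) has_real_derivative 0) (at 0)"
    if d: "d \<in> atlas" and c: "slice_chart S' c i" "u \<in> slice_dom c i" and p: "slice_param c i u \<in> cdom d" for c i k u d
  proof -
    have pS: "slice_param c i u \<in> S'" by (rule slice_param_props[OF c])
    have \<gamma>: "trajectory {-\<epsilon><..<\<epsilon>} (f (slice_param c i u))" "f (slice_param c i u) 0 = slice_param c i u" "0 \<in> {-\<epsilon><..<\<epsilon>}"
      using f pS unfolding is_shift_def by auto
    have "((\<lambda>t. shift_deviation f c i d k u t) has_vector_derivative 0) (at 0)"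
      by (rule has_vector_derivative_cong_eventually[OF has_vector_derivative_const])
         (use trajectory_eventually_chart[OF \<gamma>(1,3) d] \<gamma>(2) p in
           \<open>auto elim!: eventually_mono simp: normal_shift_deviation[OF A(2,4,6) c _ d]\<close>)
    then show ?thesis by (simp add: has_real_derivative_iff_has_vector_derivative)
  qed
  then show "\<exists>S' n \<nu> \<epsilon> f. piece_around p\<^sub>0 S S' \<and>
          unit_normal_field S' n \<and> (\<forall>c\<in>atlas. p\<^sub>0 \<in> cdom c \<longrightarrow> n c p\<^sub>0 = n\<^sub>0 c) \<and>
          transformation_class_fun S' \<nu> \<and> \<nu> p\<^sub>0 = \<nu>\<^sub>0 \<and>
          is_shift S' n \<nu> \<epsilon> f \<and>
          (\<forall>c i k u. \<forall>d\<in>atlas.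
             slice_chart S' c i \<and> k \<noteq> i \<and> u \<in> slice_dom c i \<and> slice_param c i u \<in> cdom d \<longrightarrow>
             ((\<lambda>t. shift_deviation f c i d k u t) has_real_derivative 0) (at 0))"
    using A f by blast
qed

end


section \<open>The weak normality condition\<close>

text \<open>Smoothness gives continuity of the derivative in fixed directions; a moving direction is
  expanded in the basis.\<close>

lemma continuous_on_frechet_derivative_apply:
  fixes f :: "'a::euclidean_space \<Rightarrow> 'b::real_normed_vector"
  assumes f: "smooth_on S f" and h: "continuous_on S h"
  shows "continuous_on S (\<lambda>z. frechet_derivative f (at z) (h z))"
proof -
  have eq: "(\<Sum>b\<in>Basis. (h z \<bullet> b) *\<^sub>R frechet_derivative f (at z) b) = frechet_derivative f (at z) (h z)"
    if "z \<in> S" for z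
  proof -
    have l: "linear (frechet_derivative f (at z))"
      using smooth_on_has_derivative[OF f that] has_derivative_linear by blast
    have "frechet_derivative f (at z) (\<Sum>b\<in>Basis. (h z \<bullet> b) *\<^sub>R b)
        = (\<Sum>b\<in>Basis. (h z \<bullet> b) *\<^sub>R frechet_derivative f (at z) b)"
      by (simp add: linear_sum[OF l] linear_scale[OF l])
    then show ?thesis by (simp add: euclidean_representation)
  qed
  have "continuous_on S (\<lambda>z. \<Sum>b\<in>Basis. (h z \<bullet> b) *\<^sub>R frechet_derivative f (at z) b)"
    by (intro continuous_intros h smooth_on_continuous smooth_on_frechet_derivative f)
  then show ?thesis using eq by (simp cong: continuous_on_cong)
qed

lemma isCont_cong_eventually:
  assumes "isCont f t" "\<forall>\<^sub>F s in nhds t. f s = g s"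
  shows "isCont g t"
  using isCont_cong[OF assms(2)] assms(1) by blast

section \<open>The second derivative of the deviation and the pointwise form of weak
  normality\<close>

context newtonian_system
begin

text \<open>For \<open>\<phi> = (v|\<tau>)\<close> and \<open>\<kappa> = \<nabla>\<^sub>t \<tau>\<close> one has \<open>\<phi>' = (F|\<tau>) + (v|\<kappa>)\<close> and \<open>\<phi>'' = \<beta>(\<tau>) + \<alpha>(\<kappa>)\<close>.\<close>

definition dev_alpha :: "('a, 'n) chart \<Rightarrow> real^'n \<Rightarrow> real^'n \<Rightarrow> real^'n \<Rightarrow> real" where
  "dev_alpha c x v K = 2 * scalar_prod (g c x) (F c x v) K + scalar_prod (g c x) v (DF c x v 0 K)"

definition dev_beta :: "('a, 'n) chart \<Rightarrow> real^'n \<Rightarrow> real^'n \<Rightarrow> real^'n \<Rightarrow> real" where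
  "dev_beta c x v T = scalar_prod (g c x) (DF c x v v (acc c x v) + Gam c x v (F c x v)) T
     + scalar_prod (g c x) v
       (- (DGam c x T v v - DGam c x v T v + Gam c x T (Gam c x v v) - Gam c x v (Gam c x T v))
        + (DF c x v T 0 - DF c x v 0 (Gam c x T v) + Gam c x T (F c x v)))"

text \<open>Pointwise form of \<phi>'' = A \<phi>' + B \<phi>: the coefficients of \<kappa> and of
  \<tau> are compared separately, as if \<tau> and \<kappa> were arbitrary at a single
  point.\<close>

definition normality_equations :: "('a, 'n) chart \<Rightarrow> real^'n \<Rightarrow> real^'n \<Rightarrow> bool" where
  "normality_equations c x v \<longleftrightarrow> (\<exists>A B. (\<forall>K. dev_alpha c x v K = A * scalar_prod (g c x) v K) \<and>
     (\<forall>T. dev_beta c x v T = A * scalar_prod (g c x) (F c x v) T + B * scalar_prod (g c x) v T))"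

text \<open>Two applications of \<open>metric_leibniz\<close> with \<nabla>_t v = F; in the second
  one \<nabla>_t \<nabla>_t \<tau> is eliminated by the equation of variation.\<close>

lemma deviation_derivatives:
  assumes \<gamma>: "trajectory I \<gamma>" and V: "vector_of_variation I \<gamma> \<tau>"
    and t: "t \<in> I" and c: "c \<in> atlas" "\<gamma> t \<in> cdom c"
  defines "x \<equiv> \<lambda>s. coord c (\<gamma> s)" and "v \<equiv> vel c \<gamma>" and "K \<equiv> nabla_t c \<gamma> (\<tau> c)"
  shows "((\<lambda>s. scalar_prod (g c (x s)) (v s) (\<tau> c s)) has_real_derivative
      scalar_prod (g c (x t)) (F c (x t) (v t)) (\<tau> c t) + scalar_prod (g c (x t)) (v t) (K t)) (at t)"
    and "((\<lambda>s. scalar_prod (g c (x s)) (F c (x s) (v s)) (\<tau> c s) + scalar_prod (g c (x s)) (v s) (K s))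
      has_real_derivative dev_beta c (x t) (v t) (\<tau> c t) + dev_alpha c (x t) (v t) (K t)) (at t)"
proof -
  have xt: "x t \<in> coord c ` cdom c" using c by (simp add: x_def)
  have dx: "(x has_vector_derivative v t) (at t)" and dv: "(v has_vector_derivative acc c (x t) (v t)) (at t)"
    using trajectory_phase(2,3)[OF \<gamma> t c] by (simp_all add: x_def v_def)
  have "\<tau> c differentiable (at t)" "K differentiable (at t)"
    using V c t unfolding vector_of_variation_def K_def by blast+
  then have d\<tau>: "(\<tau> c has_vector_derivative vector_derivative (\<tau> c) (at t)) (at t)"
    and dK: "(K has_vector_derivative vector_derivative K (at t)) (at t)"
    using vector_derivative_works by blast+
  have K: "vector_derivative (\<tau> c) (at t) + Gam c (x t) (v t) (\<tau> c t) = K t"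
    by (simp add: K_def nabla_t_Gam x_def v_def)
  have NK: "vector_derivative K (at t) + Gam c (x t) (v t) (K t) = nabla_t c \<gamma> K t"
    by (simp add: nabla_t_Gam x_def v_def)
  have NK_eq: "nabla_t c \<gamma> K t =
     - (DGam c (x t) (\<tau> c t) (v t) (v t) - DGam c (x t) (v t) (\<tau> c t) (v t)
        + Gam c (x t) (\<tau> c t) (Gam c (x t) (v t) (v t)) - Gam c (x t) (v t) (Gam c (x t) (\<tau> c t) (v t)))
     + DF c (x t) (v t) 0 (K t)
     + (DF c (x t) (v t) (\<tau> c t) 0 - DF c (x t) (v t) 0 (Gam c (x t) (\<tau> c t) (v t))
        + Gam c (x t) (\<tau> c t) (F c (x t) (v t)))"
    using vector_of_variation_equation[OF V c(1) t c(2)] by (simp add: Let_def x_def v_def K_def)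
  have aF: "acc c (x t) (v t) + Gam c (x t) (v t) (v t) = F c (x t) (v t)" by (simp add: acc_def)
  show "((\<lambda>s. scalar_prod (g c (x s)) (v s) (\<tau> c s)) has_real_derivative
      scalar_prod (g c (x t)) (F c (x t) (v t)) (\<tau> c t) + scalar_prod (g c (x t)) (v t) (K t)) (at t)"
    using metric_leibniz[OF c(1) xt dx dv d\<tau>] unfolding K aF .
  have "((\<lambda>s. (x s, v s)) has_vector_derivative (v t, acc c (x t) (v t))) (at t)"
    by (rule has_vector_derivative_Pair[OF dx dv])
  from has_derivative_vector_compose[OF this F_has_derivative[OF c(1) xt]]
  have dF: "((\<lambda>s. F c (x s) (v s)) has_vector_derivative DF c (x t) (v t) (v t) (acc c (x t) (v t))) (at t)"
    by simp
  show "((\<lambda>s. scalar_prod (g c (x s)) (F c (x s) (v s)) (\<tau> c s) + scalar_prod (g c (x s)) (v s) (K s))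
      has_real_derivative dev_beta c (x t) (v t) (\<tau> c t) + dev_alpha c (x t) (v t) (K t)) (at t)"
    by (rule DERIV_cong[OF DERIV_add[OF metric_leibniz[OF c(1) xt dx dF d\<tau>] metric_leibniz[OF c(1) xt dx dv dK]]],
        unfold K aF NK NK_eq dev_beta_def dev_alpha_def)
       (simp add: scalar_prod.add_right scalar_prod.diff_right scalar_prod.minus_right algebra_simps)
qed

text \<open>The infinitesimal form of time translation: the flow equation is differentiated in t.
  The deviation of this variation is |v|^2, which is nonzero wherever v is.\<close>

lemma velocity_is_variation:
  assumes \<gamma>: "trajectory I \<gamma>"
  shows "vector_of_variation I \<gamma> (\<lambda>c. vel c \<gamma>)"
proof (rule vector_of_variationI[OF \<gamma>])
  show "vector_along I \<gamma> (\<lambda>c. vel c \<gamma>)"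
    unfolding vector_along_def tangent_vector_def using vel_change[OF \<gamma>] by blast
  fix c t assume t: "c \<in> atlas" "t \<in> I" "\<gamma> t \<in> cdom c"
  note ph = trajectory_phase[OF \<gamma> t(2,1,3)]
  show "(vel c \<gamma> has_vector_derivative acc c (coord c (\<gamma> t)) (vel c \<gamma> t)) (at t)" by (rule ph)
  have "phase c \<gamma> t \<in> coord c ` cdom c \<times> UNIV" using t by (simp add: phase_def)
  from has_derivative_vector_compose[OF ph(1) flow_field_has_derivative[OF t(1) this]]
  have "((\<lambda>s. snd (flow_field c (phase c \<gamma> s))) has_vector_derivative
      snd (flow_linearization c (phase c \<gamma> t) (flow_field c (phase c \<gamma> t)))) (at t)"
    by (rule bounded_linear.has_vector_derivative[OF bounded_linear_snd])
  then show "((\<lambda>s. acc c (coord c (\<gamma> s)) (vel c \<gamma> s)) has_vector_derivative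
      snd (flow_linearization c (phase c \<gamma> t) (vel c \<gamma> t, acc c (coord c (\<gamma> t)) (vel c \<gamma> t)))) (at t)"
    by (simp add: flow_field_def phase_def)
qed

text \<open>The constant curve is a trajectory with the same phase at \<open>t0\<close>, and
  \<open>trajectory_tube\<close> with initial distance zero forces \<gamma> to coincide with
  it.\<close>

lemma zero_velocity_trajectory:
  assumes Z: "\<And>c x. c \<in> atlas \<Longrightarrow> x \<in> coord c ` cdom c \<Longrightarrow> F c x 0 = 0"
    and \<gamma>: "trajectory I \<gamma>" and t0: "t0 \<in> I" "c0 \<in> atlas" "\<gamma> t0 \<in> cdom c0" "vel c0 \<gamma> t0 = 0"
    and t: "t \<in> I" "c \<in> atlas" "\<gamma> t \<in> cdom c"
  shows "vel c \<gamma> t = 0"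
proof -
  define \<gamma>0 where "\<gamma>0 = (\<lambda>s::real. \<gamma> t0)"
  have v0: "vel c \<gamma>0 s = 0" for c s
    unfolding vel_def \<gamma>0_def by (rule vector_derivative_at) (rule has_vector_derivative_const)
  have v0': "vel c \<gamma>0 = (\<lambda>s. 0)" for c using v0 by blast
  have nab: "nabla_t c \<gamma>0 (vel c \<gamma>0) s = 0" for c s
    unfolding nabla_t_Gam v0'
    using vector_derivative_at[OF has_vector_derivative_const[of 0]]
    by (simp add: bounded_bilinear.zero_right[OF Gam_bilinear])
  have T: "trajectory UNIV \<gamma>0"
    unfolding trajectory_def
  proof (intro conjI ballI impI)
    fix c s assume "c \<in> atlas" "\<gamma>0 s \<in> cdom c"
    then show "nabla_t c \<gamma>0 (vel c \<gamma>0) s = F c (coord c (\<gamma>0 s)) (vel c \<gamma>0 s)"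
      using Z by (simp add: nab v0)
    show "(\<lambda>s. coord c (\<gamma>0 s)) differentiable (at s)" by (simp add: \<gamma>0_def)
    show "vel c \<gamma>0 differentiable (at s)" by (simp add: v0')
  qed (auto simp: \<gamma>0_def)
  define a b where "a = min t t0" and "b = max t t0"
  have mem: "t \<in> {a..b}" "t0 \<in> {a..b}" by (auto simp: a_def b_def)
  have ab: "{a..b} \<subseteq> I"
    using \<gamma> t(1) t0(1) unfolding trajectory_def
    by (metis a_def b_def connected_contains_Icc max_def min_def)
  obtain r K where r: "0 < r"
    "\<And>\<gamma> J t1 t. trajectory J \<gamma> \<Longrightarrow> {a..b} \<subseteq> J \<Longrightarrow> t1 \<in> {a..b} \<Longrightarrow> \<gamma> t1 \<in> cdom c0 \<Longrightarrow>
      norm (phase c0 \<gamma> t1 - phase c0 \<gamma>0 t1) < r \<Longrightarrow> t \<in> {a..b} \<Longrightarrow>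
      \<gamma> t \<in> cdom c0 \<and> norm (phase c0 \<gamma> t - phase c0 \<gamma>0 t) \<le> K * norm (phase c0 \<gamma> t1 - phase c0 \<gamma>0 t1)"
    using trajectory_tube[OF T subset_UNIV t0(2), of a b] t0(3) unfolding \<gamma>0_def by metis
  have ph0: "phase c0 \<gamma> t0 - phase c0 \<gamma>0 t0 = 0"
    unfolding phase_def v0 t0(4) by (simp add: \<gamma>0_def zero_prod_def)
  have "\<gamma> t \<in> cdom c0 \<and> norm (phase c0 \<gamma> t - phase c0 \<gamma>0 t) \<le> K * norm (phase c0 \<gamma> t0 - phase c0 \<gamma>0 t0)"
    by (rule r(2)[OF \<gamma> ab mem(2) t0(3) _ mem(1)]) (simp add: ph0 r(1))
  then have "\<gamma> t \<in> cdom c0" "phase c0 \<gamma> t = phase c0 \<gamma>0 t" by (auto simp: ph0)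
  then have "\<gamma> t \<in> cdom c0" "vel c0 \<gamma> t = 0" by (auto simp: phase_def v0)
  then show ?thesis
    using vel_change[OF \<gamma> t(1) t0(2) t(2) _ t(3)] linear_0[OF linear_jac[OF t0(2) t(2) _ t(3)]] by simp
qed

lemma continuous_on_scalar_prod:
  assumes c: "c \<in> atlas" and "continuous_on ((coord c ` cdom c) \<times> UNIV) P" "continuous_on ((coord c ` cdom c) \<times> UNIV) Q"
  shows "continuous_on ((coord c ` cdom c) \<times> (UNIV::(real^'n) set)) (\<lambda>z. scalar_prod (g c (fst z)) (P z) (Q z))"
proof -
  have G: "continuous_on ((coord c ` cdom c) \<times> (UNIV::(real^'n) set)) (\<lambda>z. g c (fst z) $ i $ j)" for i j
    by (rule continuous_on_compose2[OF smooth_on_continuous[OF metric_nth_smooth[OF c]]])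
       (auto intro: continuous_intros)
  then show ?thesis unfolding scalar_prod_def
    by (intro continuous_on_sum continuous_on_mult G
        bounded_linear.continuous_on[OF bounded_linear_vec_nth assms(2)]
        bounded_linear.continuous_on[OF bounded_linear_vec_nth assms(3)])
qed

lemma DF_velocity_radial:
  assumes c: "c \<in> atlas" "x \<in> coord c ` cdom c"
  shows "((\<lambda>s. scalar_prod (g c x) v (F c x (s *\<^sub>R v))) has_real_derivative
    scalar_prod (g c x) v (DF c x v 0 v)) (at 1)"
proof -
  have "((\<lambda>s. (x, s *\<^sub>R v)) has_vector_derivative (0, v)) (at 1)"
    by (intro has_vector_derivative_Pair) (auto intro!: derivative_eq_intros)
  from has_derivative_vector_compose[OF this, of "\<lambda>(x, v). F c x v" "\<lambda>(h, k). DF c x v h k"] F_has_derivative[OF c, of v]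
  have "((\<lambda>s. F c x (s *\<^sub>R v)) has_vector_derivative DF c x v 0 v) (at 1)" by simp
  then show ?thesis
    unfolding has_real_derivative_iff_has_vector_derivative
    by (rule bounded_linear.has_vector_derivative[OF scalar_prod.bounded_linear_right])
qed

text \<open>Taken at K = v, the velocity derivative of F in \<alpha> is radial, so
  \<open>DF_velocity_radial\<close> expresses it through values of F, whose transformation law is
  known.\<close>

lemma dev_alpha_change:
  assumes c: "c \<in> atlas" "d \<in> atlas" "p \<in> cdom c" "p \<in> cdom d"
  shows "dev_alpha d (coord d p) (jac c d (coord c p) v) (jac c d (coord c p) v) = dev_alpha c (coord c p) v v"
proof -
  let ?J = "jac c d (coord c p)"
  have F: "F d (coord d p) (?J w) = ?J (F c (coord c p) w)" for w
    using force_vector[OF c(1,2), of "coord c p" w] c by auto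
  have "scalar_prod (g d (coord d p)) (?J v) (F d (coord d p) (s *\<^sub>R ?J v))
      = scalar_prod (g c (coord c p)) v (F c (coord c p) (s *\<^sub>R v))" for s
    using F[of "s *\<^sub>R v"] scalar_prod_change[OF c] linear_scale[OF linear_jac[OF c]] by metis
  moreover have xc: "coord c p \<in> coord c ` cdom c" "coord d p \<in> coord d ` cdom d" using c by auto
  ultimately have "scalar_prod (g d (coord d p)) (?J v) (DF d (coord d p) (?J v) 0 (?J v))
      = scalar_prod (g c (coord c p)) v (DF c (coord c p) v 0 v)"
    using DF_velocity_radial[OF c(2) xc(2), of "?J v"] DF_velocity_radial[OF c(1) xc(1), of v] DERIV_unique
    by simp
  then show ?thesis unfolding dev_alpha_def F scalar_prod_change[OF c] by simp
qed

text \<open>This function of the phase is half the time derivative of |v|^2.\<close>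

lemma power_smooth:
  assumes c: "c \<in> atlas"
  shows "smooth_on ((coord c ` cdom c) \<times> UNIV)
    (\<lambda>z. scalar_prod (g c (fst z)) (F c (fst z) (snd z)) (snd z))"
proof -
  let ?S = "(coord c ` cdom c) \<times> (UNIV :: (real^'n) set)"
  note o = open_phase[OF c]
  have G: "smooth_on ?S (\<lambda>z. g c (fst z) $ i $ j)" for i j
    by (rule smooth_on_compose[OF o open_coord_cdom[OF c] _ metric_nth_smooth[OF c]
          smooth_on_linear[OF bounded_linear_fst o]]) auto
  have v: "smooth_on ?S snd" by (rule smooth_on_linear[OF bounded_linear_snd o])
  have F: "smooth_on ?S (\<lambda>z. F c (fst z) (snd z))"
    using force_smooth[OF c] by (simp add: case_prod_unfold)
  show ?thesis unfolding scalar_prod_def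
    by (intro smooth_on_sum smooth_on_mult G smooth_on_nth[OF o v] smooth_on_nth[OF o F] o)
qed

lemma dev_alpha_continuous:
  assumes c: "c \<in> atlas"
  shows "continuous_on ((coord c ` cdom c) \<times> UNIV) (\<lambda>z. dev_alpha c (fst z) (snd z) (snd z))"
proof -
  have F: "continuous_on ((coord c ` cdom c) \<times> UNIV) (\<lambda>z. F c (fst z) (snd z))"
    using smooth_on_continuous[OF force_smooth[OF c]] by (simp add: case_prod_unfold)
  have "continuous_on ((coord c ` cdom c) \<times> UNIV) (\<lambda>z. DF c (fst z) (snd z) 0 (snd z))"
    using continuous_on_frechet_derivative_apply[OF force_smooth[OF c], of "\<lambda>z. (0, snd z)"]
    by (simp add: DF_def case_prod_unfold continuous_on_Pair continuous_on_snd)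
  then show ?thesis unfolding dev_alpha_def
    by (intro continuous_intros continuous_on_scalar_prod c F)
qed

text \<open>At each time the pointwise equations give some coefficients, but say nothing about their
  continuity. Evaluation on \<tau> = v recovers them from e = |v|^2, its derivatives and
  \<alpha>(v), all of which are continuous.\<close>

lemma weak_normalityI:
  assumes Z: "\<And>c x. c \<in> atlas \<Longrightarrow> x \<in> coord c ` cdom c \<Longrightarrow> F c x 0 = 0"
    and N: "\<And>c x v. c \<in> atlas \<Longrightarrow> x \<in> coord c ` cdom c \<Longrightarrow> v \<noteq> 0 \<Longrightarrow> normality_equations c x v"
  shows "weak_normality"
  unfolding weak_normality_def
proof (intro allI impI)
  fix I \<gamma> assume \<gamma>: "trajectory I \<gamma>"
  note ev = trajectory_eventually_chart[OF \<gamma>]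
  show "\<exists>A B. continuous_on I A \<and> continuous_on I B \<and>
         (\<forall>\<phi>. function_of_deviation I \<gamma> \<phi> \<longrightarrow>
           (\<exists>\<phi>'. \<forall>t\<in>I. (\<phi> has_real_derivative \<phi>' t) (at t) \<and>
                       (\<phi>' has_real_derivative A t * \<phi>' t + B t * \<phi> t) (at t)))"
  proof (cases "\<exists>t\<in>I. \<exists>c\<in>atlas. \<gamma> t \<in> cdom c \<and> vel c \<gamma> t = 0")
    case True
    \<comment> \<open>Vanishing at one time means vanishing throughout, so every deviation is
      identically zero and A = B = 0 serve.\<close>
    then have v: "vel c \<gamma> t = 0" if "t \<in> I" "c \<in> atlas" "\<gamma> t \<in> cdom c" for t c
      using zero_velocity_trajectory[OF Z \<gamma>] that by blast
    have "(\<phi> has_real_derivative 0) (at t)" if \<phi>: "function_of_deviation I \<gamma> \<phi>" and t: "t \<in> I" for \<phi> t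
    proof -
      have "\<phi> s = 0" if s: "s \<in> I" for s
      proof -
        obtain c where c: "c \<in> atlas" "\<gamma> s \<in> cdom c" using covering by blast
        then obtain \<tau> where "\<phi> s = scalar_prod (g c (coord c (\<gamma> s))) (vel c \<gamma> s) (\<tau> c s)"
          using \<phi> s unfolding function_of_deviation_def by blast
        then show ?thesis using v[OF s c] by (simp add: scalar_prod.zero_left)
      qed
      moreover have "\<forall>\<^sub>F s in nhds t. s \<in> I"
        using \<gamma> t by (intro eventually_nhds_in_open) (auto simp: trajectory_def)
      ultimately have "\<forall>\<^sub>F s in nhds t. 0 = \<phi> s" by (auto elim: eventually_mono)
      then have "(\<phi> has_vector_derivative 0) (at t)"
        by (rule has_vector_derivative_cong_eventually[OF has_vector_derivative_const])
      then show ?thesis by (simp add: has_real_derivative_iff_has_vector_derivative)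
    qed
    then show ?thesis
      by (intro exI[of _ "\<lambda>_. 0"] conjI continuous_on_const allI impI ballI) simp_all
  next
    case False
    then have v0: "vel c \<gamma> t \<noteq> 0" if "t \<in> I" "c \<in> atlas" "\<gamma> t \<in> cdom c" for t c
      using that by blast
    have "\<forall>t. \<exists>c. c \<in> atlas \<and> \<gamma> t \<in> cdom c" using covering by blast
    then obtain ch where ch: "\<And>t. ch t \<in> atlas" "\<And>t. \<gamma> t \<in> cdom (ch t)" by metis
    note V = velocity_is_variation[OF \<gamma>]
    define sq where "sq c t = scalar_prod (g c (coord c (\<gamma> t))) (vel c \<gamma> t) (vel c \<gamma> t)" for c t
    define al where "al c t = dev_alpha c (coord c (\<gamma> t)) (vel c \<gamma> t) (vel c \<gamma> t)" for c t
    obtain e where e: "\<And>t c. t \<in> I \<Longrightarrow> c \<in> atlas \<Longrightarrow> \<gamma> t \<in> cdom c \<Longrightarrow> e t = sq c t"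
      using function_of_deviation_exists[OF \<gamma> V] unfolding sq_def by metis
    define A where "A t = al (ch t) t / e t" for t
    \<comment> \<open>Solves e'' = A e' + B e for B; here e is positive.\<close>
    define B where "B t = (deriv (deriv e) t - A t * deriv e t) / e t" for t
    \<comment> \<open>The derivative e' as a smooth function of the phase, from which e'' and its
      continuity are obtained.\<close>
    define W where "W c z = 2 * scalar_prod (g c (fst z)) (F c (fst z) (snd z)) (snd z)" for c and z :: "(real^'n) \<times> (real^'n)"
    have e_pos: "e t > 0" if "t \<in> I" for t
      using e[OF that ch] metric_pos[OF ch(1), of "coord (ch t) (\<gamma> t)" t "vel (ch t) \<gamma> t"] v0[OF that ch] ch(2)[of t]
      by (simp add: sq_def)
    \<comment> \<open>Independence of the arbitrary charts \<open>ch\<close>, so that continuity at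
      t can be checked in one chart.\<close>
    have A: "A t = al c t / e t" if "t \<in> I" "c \<in> atlas" "\<gamma> t \<in> cdom c" for t c
      using dev_alpha_change[OF that(2) ch(1) that(3) ch(2)] vel_change[OF \<gamma> that(1,2) ch(1) that(3) ch(2)]
      by (simp add: A_def al_def)
    have phc: "isCont (phase c \<gamma>) t" "phase c \<gamma> t \<in> (coord c ` cdom c) \<times> UNIV"
      if "t \<in> I" "c \<in> atlas" "\<gamma> t \<in> cdom c" for t c
      using trajectory_phase(1)[OF \<gamma> that] has_vector_derivative_continuous that(3) by (auto simp: phase_def)
    have lift: "isCont (\<lambda>s. h (phase c \<gamma> s)) t"
      if "t \<in> I" "c \<in> atlas" "\<gamma> t \<in> cdom c" "continuous_on ((coord c ` cdom c) \<times> UNIV) h" for t c and h :: "_ \<Rightarrow> real"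
    proof -
      have "isCont h (phase c \<gamma> t)"
        using that(4) phc(2)[OF that(1-3)] continuous_on_eq_continuous_at[OF open_phase[OF that(2)]] by metis
      with phc(1)[OF that(1-3)] show ?thesis by (rule isCont_o2)
    qed
    have de: "(e has_real_derivative W c (phase c \<gamma> t)) (at t)"
      and dde: "(deriv e has_real_derivative frechet_derivative (W c) (at (phase c \<gamma> t)) (flow_field c (phase c \<gamma> t))) (at t)"
      and dde': "deriv (deriv e) t = dev_beta c (coord c (\<gamma> t)) (vel c \<gamma> t) (vel c \<gamma> t)
          + dev_alpha c (coord c (\<gamma> t)) (vel c \<gamma> t) (F c (coord c (\<gamma> t)) (vel c \<gamma> t))"
      if t: "t \<in> I" "c \<in> atlas" "\<gamma> t \<in> cdom c" for t c
    proof -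
      have nF: "nabla_t c \<gamma> (vel c \<gamma>) s = F c (coord c (\<gamma> s)) (vel c \<gamma> s)" if "s \<in> I" "\<gamma> s \<in> cdom c" for s
        by (rule trajectory_phase(4)[OF \<gamma> that(1) t(2) that(2)])
      have Ws: "scalar_prod (g c (coord c (\<gamma> s))) (F c (coord c (\<gamma> s)) (vel c \<gamma> s)) (vel c \<gamma> s)
          + scalar_prod (g c (coord c (\<gamma> s))) (vel c \<gamma> s) (nabla_t c \<gamma> (vel c \<gamma>) s) = W c (phase c \<gamma> s)"
        if "s \<in> I" "\<gamma> s \<in> cdom c" for s
        using scalar_prod_sym[OF t(2), of "coord c (\<gamma> s)"] that
        by (simp add: nF W_def phase_def)
      have de': "(e has_real_derivative W c (phase c \<gamma> s)) (at s)" if s: "s \<in> I" "\<gamma> s \<in> cdom c" for s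
      proof -
        have "(sq c has_vector_derivative W c (phase c \<gamma> s)) (at s)"
          using deviation_derivatives(1)[OF \<gamma> V s(1) t(2) s(2)]
          unfolding Ws[OF s] has_real_derivative_iff_has_vector_derivative sq_def[abs_def] .
        then have "(e has_vector_derivative W c (phase c \<gamma> s)) (at s)"
          by (rule has_vector_derivative_cong_eventually)
             (use ev[OF s(1) t(2) s(2)] in \<open>auto elim!: eventually_mono simp: e[OF _ t(2)]\<close>)
        then show ?thesis by (simp add: has_real_derivative_iff_has_vector_derivative)
      qed
      show "(e has_real_derivative W c (phase c \<gamma> t)) (at t)" by (rule de'[OF t(1,3)])
      have dW: "\<forall>\<^sub>F s in nhds t. W c (phase c \<gamma> s) = deriv e s"
        using ev[OF t] by eventually_elim (metis DERIV_imp_deriv de')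
      have "smooth_on ((coord c ` cdom c) \<times> UNIV) (W c)"
        unfolding W_def[abs_def] by (intro smooth_on_mult smooth_on_const power_smooth t(2) open_phase)
      from has_derivative_vector_compose[OF trajectory_phase(1)[OF \<gamma> t] smooth_on_has_derivative[OF this phc(2)[OF t]]]
      have "(deriv e has_vector_derivative frechet_derivative (W c) (at (phase c \<gamma> t)) (flow_field c (phase c \<gamma> t))) (at t)"
        by (rule has_vector_derivative_cong_eventually[OF _ dW])
      then show "(deriv e has_real_derivative frechet_derivative (W c) (at (phase c \<gamma> t)) (flow_field c (phase c \<gamma> t))) (at t)"
        by (simp add: has_real_derivative_iff_has_vector_derivative)
      have "\<forall>\<^sub>F s in nhds t. scalar_prod (g c (coord c (\<gamma> s))) (F c (coord c (\<gamma> s)) (vel c \<gamma> s)) (vel c \<gamma> s)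
          + scalar_prod (g c (coord c (\<gamma> s))) (vel c \<gamma> s) (nabla_t c \<gamma> (vel c \<gamma>) s) = deriv e s"
        using ev[OF t] dW by eventually_elim (simp only: Ws)
      from has_vector_derivative_cong_eventually[OF
          deviation_derivatives(2)[OF \<gamma> V t, unfolded has_real_derivative_iff_has_vector_derivative] this]
      have "(deriv e has_real_derivative dev_beta c (coord c (\<gamma> t)) (vel c \<gamma> t) (vel c \<gamma> t)
          + dev_alpha c (coord c (\<gamma> t)) (vel c \<gamma> t) (nabla_t c \<gamma> (vel c \<gamma>) t)) (at t)"
        by (simp add: has_real_derivative_iff_has_vector_derivative)
      then show "deriv (deriv e) t = dev_beta c (coord c (\<gamma> t)) (vel c \<gamma> t) (vel c \<gamma> t)
          + dev_alpha c (coord c (\<gamma> t)) (vel c \<gamma> t) (F c (coord c (\<gamma> t)) (vel c \<gamma> t))"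
        using DERIV_imp_deriv nF[OF t(1,3)] by metis
    qed
    have contA: "isCont A t" and conte2: "isCont (deriv (deriv e)) t" if t: "t \<in> I" for t
    proof -
      obtain c where c: "c \<in> atlas" "\<gamma> t \<in> cdom c" using covering by blast
      have ce: "isCont e t" using de[OF t c] DERIV_isCont by blast
      have "isCont (al c) t"
        using lift[OF t c dev_alpha_continuous[OF c(1)]] by (simp add: al_def[abs_def] phase_def)
      then have "isCont (\<lambda>s. al c s / e s) t" using ce e_pos[OF t] by (intro continuous_intros) auto
      moreover have "\<forall>\<^sub>F s in nhds t. al c s / e s = A s"
        using ev[OF t c] by eventually_elim (simp add: A[OF _ c(1)])
      ultimately show "isCont A t" by (rule isCont_cong_eventually)
      have "smooth_on ((coord c ` cdom c) \<times> UNIV) (W c)"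
        unfolding W_def[abs_def] by (intro smooth_on_mult smooth_on_const power_smooth c(1) open_phase)
      then have "isCont (\<lambda>s. frechet_derivative (W c) (at (phase c \<gamma> s)) (flow_field c (phase c \<gamma> s))) t"
        by (intro lift[OF t c, of "\<lambda>z. frechet_derivative (W c) (at z) (flow_field c z)"]
            continuous_on_frechet_derivative_apply smooth_on_continuous[OF flow_field_smooth[OF c(1)]])
      moreover have "\<forall>\<^sub>F s in nhds t. frechet_derivative (W c) (at (phase c \<gamma> s)) (flow_field c (phase c \<gamma> s)) = deriv (deriv e) s"
        using ev[OF t c] by eventually_elim (metis DERIV_imp_deriv dde c(1))
      ultimately show "isCont (deriv (deriv e)) t" by (rule isCont_cong_eventually)
    qed
    have contB: "isCont B t" if t: "t \<in> I" for t
    proof -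
      obtain c where c: "c \<in> atlas" "\<gamma> t \<in> cdom c" using covering by blast
      show ?thesis
        unfolding B_def[abs_def]
        using contA[OF t] conte2[OF t] DERIV_isCont[OF de[OF t c]] DERIV_isCont[OF dde[OF t c]] e_pos[OF t]
        by (intro continuous_intros) auto
    qed
    have main: "(\<phi> has_real_derivative deriv \<phi> t) (at t) \<and>
        (deriv \<phi> has_real_derivative A t * deriv \<phi> t + B t * \<phi> t) (at t)"
      if \<phi>: "function_of_deviation I \<gamma> \<phi>" and t: "t \<in> I" for \<phi> t
    proof -
      obtain \<tau> where \<tau>: "vector_of_variation I \<gamma> \<tau>"
        "\<And>t c. t \<in> I \<Longrightarrow> c \<in> atlas \<Longrightarrow> \<gamma> t \<in> cdom c \<Longrightarrow>
          \<phi> t = scalar_prod (g c (coord c (\<gamma> t))) (vel c \<gamma> t) (\<tau> c t)"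
        using \<phi> unfolding function_of_deviation_def by blast
      obtain c where c: "c \<in> atlas" "\<gamma> t \<in> cdom c" using covering by blast
      define \<phi>1 where "\<phi>1 s = scalar_prod (g c (coord c (\<gamma> s))) (F c (coord c (\<gamma> s)) (vel c \<gamma> s)) (\<tau> c s)
          + scalar_prod (g c (coord c (\<gamma> s))) (vel c \<gamma> s) (nabla_t c \<gamma> (\<tau> c) s)" for s
      have d1: "(\<phi> has_real_derivative \<phi>1 s) (at s)" if s: "s \<in> I" "\<gamma> s \<in> cdom c" for s
      proof -
        have "(\<phi> has_vector_derivative \<phi>1 s) (at s)"
          by (rule has_vector_derivative_cong_eventually[OF
                deviation_derivatives(1)[OF \<gamma> \<tau>(1) s(1) c(1) s(2), unfolded has_real_derivative_iff_has_vector_derivative, folded \<phi>1_def]])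
             (use ev[OF s(1) c(1) s(2)] in \<open>auto elim!: eventually_mono simp: \<tau>(2)[OF _ c(1)]\<close>)
        then show ?thesis by (simp add: has_real_derivative_iff_has_vector_derivative)
      qed
      have "\<forall>\<^sub>F s in nhds t. \<phi>1 s = deriv \<phi> s"
        using ev[OF t c] by eventually_elim (metis DERIV_imp_deriv d1)
      from has_vector_derivative_cong_eventually[OF deviation_derivatives(2)[OF \<gamma> \<tau>(1) t c,
            unfolded has_real_derivative_iff_has_vector_derivative, folded \<phi>1_def] this]
      have d2: "(deriv \<phi> has_real_derivative dev_beta c (coord c (\<gamma> t)) (vel c \<gamma> t) (\<tau> c t)
          + dev_alpha c (coord c (\<gamma> t)) (vel c \<gamma> t) (nabla_t c \<gamma> (\<tau> c) t)) (at t)"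
        by (simp add: has_real_derivative_iff_has_vector_derivative)
      let ?x = "coord c (\<gamma> t)" and ?v = "vel c \<gamma> t"
      obtain A' B' where AB: "\<And>K. dev_alpha c ?x ?v K = A' * scalar_prod (g c ?x) ?v K"
        "\<And>T. dev_beta c ?x ?v T = A' * scalar_prod (g c ?x) (F c ?x ?v) T + B' * scalar_prod (g c ?x) ?v T"
        using N[OF c(1) _ v0[OF t c], of ?x] c(2) unfolding normality_equations_def by blast
      have et: "e t = scalar_prod (g c ?x) ?v ?v" using e[OF t c] by (simp add: sq_def)
      have A': "A t = A'" using A[OF t c] e_pos[OF t] by (simp add: al_def AB(1) et)
      have "deriv e t = W c (phase c \<gamma> t)" using de[OF t c] by (rule DERIV_imp_deriv)
      then have e1: "deriv e t = scalar_prod (g c ?x) (F c ?x ?v) ?v + scalar_prod (g c ?x) ?v (F c ?x ?v)"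
        using scalar_prod_sym[OF c(1), of ?x] c(2) by (simp add: W_def phase_def)
      \<comment> \<open>The pointwise equations for \<tau> = v, \<kappa> = F.\<close>
      have "deriv (deriv e) t = A' * deriv e t + B' * e t"
        unfolding dde'[OF t c] AB et e1 by (simp add: algebra_simps)
      then have B': "B t = B'" using e_pos[OF t] by (simp add: B_def A')
      have p: "deriv \<phi> t = \<phi>1 t" using d1[OF t c(2)] by (rule DERIV_imp_deriv)
      have "dev_beta c ?x ?v (\<tau> c t) + dev_alpha c ?x ?v (nabla_t c \<gamma> (\<tau> c) t) = A t * deriv \<phi> t + B t * \<phi> t"
        unfolding p AB A' B' \<tau>(2)[OF t c] \<phi>1_def by (simp add: algebra_simps)
      then show ?thesis using d1[OF t c(2)] d2 p by simp
    qed
    have "continuous_on I A" "continuous_on I B"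
      using contA contB by (auto intro: continuous_at_imp_continuous_on)
    moreover have "\<exists>\<phi>'. \<forall>t\<in>I. (\<phi> has_real_derivative \<phi>' t) (at t) \<and>
        (\<phi>' has_real_derivative A t * \<phi>' t + B t * \<phi> t) (at t)"
      if "function_of_deviation I \<gamma> \<phi>" for \<phi>
      by (rule exI[of _ "deriv \<phi>"]) (use main[OF that] in blast)
    ultimately show ?thesis by blast
  qed
qed

end


section \<open>Test hypersurfaces\<close>

lemma smooth_on_inner_const: "open S \<Longrightarrow> smooth_on S f \<Longrightarrow> smooth_on S (\<lambda>x. a \<bullet> f x)"
  by (rule smooth_on_bounded_linear[OF bounded_linear_inner_right])

lemma linear_mult_left: "linear f \<Longrightarrow> linear (\<lambda>x. a * f x :: real)"
  using linear_compose_scale_right[of f a] by simp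

section \<open>Linear algebra of the test data, the test itself, and strong implies weak\<close>

context newtonian_system
begin

lemma linear_dev_alpha:
  assumes "c \<in> atlas" "x \<in> coord c ` cdom c"
  shows "linear (dev_alpha c x v)"
  unfolding dev_alpha_def[abs_def]
  by (intro linear_compose_add linear_mult_left
      bounded_linear.linear[OF scalar_prod.bounded_linear_right]
      linear_compose[OF linear_DF2[OF assms] bounded_linear.linear[OF scalar_prod.bounded_linear_right], unfolded o_def])

lemma linear_DGam1:
  assumes "c \<in> atlas" "x \<in> coord c ` cdom c"
  shows "linear (\<lambda>T. DGam c x T X Y)"
proof -
  have "linear (frechet_derivative (\<lambda>y. Christoffel c y k i j) (at x))" for k i j
    using smooth_on_has_derivative[OF Christoffel_smooth[OF assms(1)] assms(2)] has_derivative_linear by blast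
  then show ?thesis
    unfolding linear_iff DGam_def
    by (simp add: vec_eq_iff bil_def sum.distrib sum_distrib_left algebra_simps)
qed

lemma linear_DGam2: "linear (\<lambda>T. DGam c x X T Y)"
  unfolding linear_iff DGam_def
  by (simp add: vec_eq_iff bilinear_ladd[OF bilinear_bil] bilinear_lmul[OF bilinear_bil])

lemma linear_dev_beta:
  assumes "c \<in> atlas" "x \<in> coord c ` cdom c"
  shows "linear (dev_beta c x v)"
proof -
  interpret G: bounded_bilinear "Gam c x" by (rule Gam_bilinear)
  have l: "linear (\<lambda>T. Gam c x T X)" "linear (\<lambda>T. Gam c x X T)" for X
    using bounded_linear.linear[OF G.bounded_linear_left] bounded_linear.linear[OF G.bounded_linear_right] .
  show ?thesis
    unfolding dev_beta_def[abs_def]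
    by (intro linear_compose_add bounded_linear.linear[OF scalar_prod.bounded_linear_right]
        linear_compose[OF _ bounded_linear.linear[OF scalar_prod.bounded_linear_right], unfolded o_def]
        linear_compose_neg linear_compose_sub l linear_DGam1[OF assms] linear_DGam2 linear_DF1[OF assms]
        linear_compose[OF l(1) l(2), unfolded o_def] linear_compose[OF l(1) linear_DF2[OF assms], unfolded o_def])
qed

lemma dev_alpha_continuous_velocity:
  assumes c: "c \<in> atlas"
  shows "continuous_on ((coord c ` cdom c) \<times> UNIV) (\<lambda>z. dev_alpha c (fst z) (snd z) K)"
proof -
  have F: "continuous_on ((coord c ` cdom c) \<times> UNIV) (\<lambda>z. F c (fst z) (snd z))"
    using smooth_on_continuous[OF force_smooth[OF c]] by (simp add: case_prod_unfold)
  have "continuous_on ((coord c ` cdom c) \<times> UNIV) (\<lambda>z. DF c (fst z) (snd z) 0 K)"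
    using continuous_on_frechet_derivative_apply[OF force_smooth[OF c], of "\<lambda>z. (0, K)"]
    by (simp add: DF_def case_prod_unfold)
  then show ?thesis unfolding dev_alpha_def
    by (intro continuous_intros continuous_on_scalar_prod c F)
qed

text \<open>The first normality equation makes the force orthogonal, in the limit of zero velocity, to every
  vector that is orthogonal to some nonzero velocity direction; in dimension two or more these are
  all vectors.\<close>

lemma force_zero_velocity:
  assumes N: "\<And>v. v \<noteq> 0 \<Longrightarrow> normality_equations c x v"
    and c: "c \<in> atlas" "x \<in> coord c ` cdom c" and n: "CARD('n) \<ge> 2"
  shows "F c x 0 = 0"
proof -
  have z: "scalar_prod (g c x) (F c x 0) K = 0" for K
  proof -
    define \<eta> where "\<eta> = g c x *v K"
    obtain i k :: 'n where ik: "i \<noteq> k"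
      using n card_2_iff' by (metis (full_types) card_le_Suc0_iff_eq finite not_less_eq_eq numeral_2_eq_2 UNIV_I)
    \<comment> \<open>A nonzero vector annihilated by the covector \<eta>, built from two distinct
      indices.\<close>
    define w :: "real^'n" where "w = (if \<eta> $ i = 0 then axis i 1 else \<eta> $ k *\<^sub>R axis i 1 - \<eta> $ i *\<^sub>R axis k 1)"
    have "w $ i \<noteq> 0 \<or> w $ k \<noteq> 0" using ik by (auto simp: w_def axis_def)
    then have w0: "w \<noteq> 0" by auto
    have "w \<bullet> \<eta> = 0" by (auto simp: w_def inner_diff_left inner_axis' mult.commute)
    then have wK: "scalar_prod (g c x) w K = 0" by (simp add: scalar_prod_inner \<eta>_def)
    have "dev_alpha c x (s *\<^sub>R w) K = 0" if "s \<noteq> 0" for s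
      using N[of "s *\<^sub>R w"] w0 that wK unfolding normality_equations_def by (auto simp: scalar_prod.scaleR_left)
    then have "\<forall>\<^sub>F s in at 0. dev_alpha c x (s *\<^sub>R w) K = 0" by (simp add: eventually_at_filter)
    then have l0: "((\<lambda>s. dev_alpha c x (s *\<^sub>R w) K) \<longlongrightarrow> 0) (at 0)" by (rule tendsto_eventually)
    have "(x, 0 *\<^sub>R w) \<in> (coord c ` cdom c) \<times> UNIV" using c(2) by simp
    then have "isCont (\<lambda>z. dev_alpha c (fst z) (snd z) K) (x, 0 *\<^sub>R w)"
      by (rule bspec[OF iffD1[OF continuous_on_eq_continuous_at[OF open_phase[OF c(1)]]
            dev_alpha_continuous_velocity[OF c(1)]]])
    moreover have "isCont (\<lambda>s. (x, s *\<^sub>R w)) 0" by (intro continuous_intros)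
    ultimately have "isCont (\<lambda>s. dev_alpha c (fst (x, s *\<^sub>R w)) (snd (x, s *\<^sub>R w)) K) 0"
      using isCont_o2[of 0 "\<lambda>s. (x, s *\<^sub>R w)" "\<lambda>z. dev_alpha c (fst z) (snd z) K"] by blast
    then have "((\<lambda>s. dev_alpha c x (s *\<^sub>R w) K) \<longlongrightarrow> dev_alpha c x 0 K) (at 0)"
      by (simp add: isCont_def)
    then have "dev_alpha c x 0 K = 0" using l0 LIM_unique by blast
    \<comment> \<open>At zero velocity only the term 2 (F|K) of \<alpha> is left.\<close>
    then show ?thesis by (simp add: dev_alpha_def scalar_prod.zero_left)
  qed
  show ?thesis using metric_pos[OF c, of "F c x 0"] z[of "F c x 0"] by fastforce
qed

text \<open>Linear algebra behind the test. The vectors \<open>T\<close> form a basis of the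
  complement of v. Each admits, for every w, some K with three properties: the differentiated
  normality of the initial velocity, where w stems from the second fundamental form and \<kappa>
  from the scale of the velocity, then \<phi>' = 0, then \<phi>'' = 0. Subtracting the cases w and 0
  isolates \<alpha>.\<close>

lemma normality_equationsI:
  assumes c: "c \<in> atlas" "x \<in> coord c ` cdom c" and v: "v \<noteq> 0"
    and i: "scalar_prod (g c x) (axis i 1) v \<noteq> 0" and k0: "k0 \<noteq> i"
    and P: "\<And>k w. k \<noteq> i \<Longrightarrow> w $ i = 0 \<Longrightarrow> \<exists>K \<kappa>. let
        T = axis k 1 - (scalar_prod (g c x) (axis k 1) v / scalar_prod (g c x) (axis i 1) v) *\<^sub>R axis i 1 in
      (\<forall>\<xi>. scalar_prod (g c x) (Gam c x T \<xi>) v + scalar_prod (g c x) \<xi> K = \<kappa> * scalar_prod (g c x) \<xi> v + w \<bullet> \<xi>)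
      \<and> scalar_prod (g c x) (F c x v) T + scalar_prod (g c x) v K = 0
      \<and> dev_beta c x v T + dev_alpha c x v K = 0"
  shows "normality_equations c x v"
proof -
  let ?g = "scalar_prod (g c x)"
  define T :: "'n \<Rightarrow> real^'n" where "T k = axis k 1 - (?g (axis k 1) v / ?g (axis i 1) v) *\<^sub>R axis i 1" for k
  have P': "\<exists>K \<kappa>. (\<forall>\<xi>. ?g (Gam c x (T k) \<xi>) v + ?g \<xi> K = \<kappa> * ?g \<xi> v + w \<bullet> \<xi>)
      \<and> ?g (F c x v) (T k) + ?g v K = 0 \<and> dev_beta c x v (T k) + dev_alpha c x v K = 0"
    if "k \<noteq> i" "w $ i = 0" for k w
    using P[OF that] unfolding T_def Let_def .
  have sym: "?g X Y = ?g Y X" for X Y by (rule scalar_prod_sym[OF c])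
  have vv: "?g v v > 0" by (rule metric_pos[OF c v])
  note la = linear_dev_alpha[OF c, of v] and lb = linear_dev_beta[OF c, of v]
  have nondeg: "X = Y" if "\<And>\<xi>. ?g \<xi> X = ?g \<xi> Y" for X Y
  proof (rule ccontr)
    assume "X \<noteq> Y"
    then have "?g (X - Y) (X - Y) > 0" using metric_pos[OF c, of "X - Y"] by simp
    then show False using that[of "X - Y"] by (simp add: scalar_prod.diff_right)
  qed
  have orth: "dev_alpha c x v \<delta> = 0" if \<delta>: "?g v \<delta> = 0" for \<delta>
  proof -
    define \<eta> where "\<eta> = g c x *v \<delta>"
    define L where "L = g c x *v v"
    have gL: "?g \<xi> v = L \<bullet> \<xi>" "?g \<xi> \<delta> = \<eta> \<bullet> \<xi>" for \<xi>
      by (simp_all add: scalar_prod_inner L_def \<eta>_def inner_commute)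
    have Li: "L $ i \<noteq> 0" using i unfolding gL by (simp add: inner_axis)
    \<comment> \<open>Admissible w have no i-th component. The multiple of \<open>L\<close> removed
      from \<eta> for this purpose is absorbed into the coefficient of v.\<close>
    define w where "w = \<eta> - (\<eta> $ i / L $ i) *\<^sub>R L"
    have wi: "w $ i = 0" using Li by (simp add: w_def)
    obtain K \<kappa> where K: "\<And>\<xi>. ?g (Gam c x (T k0) \<xi>) v + ?g \<xi> K = \<kappa> * ?g \<xi> v + w \<bullet> \<xi>"
      "?g (F c x v) (T k0) + ?g v K = 0" "dev_beta c x v (T k0) + dev_alpha c x v K = 0"
      using P'[OF k0 wi] by blast
    obtain K0 \<kappa>0 where K0: "\<And>\<xi>. ?g (Gam c x (T k0) \<xi>) v + ?g \<xi> K0 = \<kappa>0 * ?g \<xi> v"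
      "?g (F c x v) (T k0) + ?g v K0 = 0" "dev_beta c x v (T k0) + dev_alpha c x v K0 = 0"
      using P'[OF k0, of 0] by auto
    define r where "r = \<kappa> - \<kappa>0 - \<eta> $ i / L $ i"
    have "?g \<xi> (K - K0) = ?g \<xi> (\<delta> + r *\<^sub>R v)" for \<xi>
    proof -
      have "?g \<xi> (K - K0) = (\<kappa> - \<kappa>0) * ?g \<xi> v + w \<bullet> \<xi>"
        using K(1)[of \<xi>] K0(1)[of \<xi>] by (simp add: scalar_prod.diff_right algebra_simps)
      also have "\<dots> = \<eta> \<bullet> \<xi> + r * (L \<bullet> \<xi>)"
        by (simp add: w_def r_def gL inner_diff_left algebra_simps)
      also have "\<dots> = ?g \<xi> (\<delta> + r *\<^sub>R v)"
        by (simp add: scalar_prod.add_right scalar_prod.scaleR_right gL)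
      finally show ?thesis .
    qed
    then have KK: "K - K0 = \<delta> + r *\<^sub>R v" by (rule nondeg)
    have "?g v (K - K0) = 0" using K(2) K0(2) by (simp add: scalar_prod.diff_right)
    \<comment> \<open>The condition \<phi>' = 0 in both cases fixes the coefficient of v.\<close>
    then have "r = 0" using vv \<delta> unfolding KK by (simp add: scalar_prod.add_right scalar_prod.scaleR_right)
    then have "dev_alpha c x v \<delta> = dev_alpha c x v K - dev_alpha c x v K0"
      using KK linear_diff[OF la, of K K0] by simp
    then show ?thesis using K(3) K0(3) by simp
  qed
  define A where "A = dev_alpha c x v v / ?g v v"
  have alpha: "dev_alpha c x v K = A * ?g v K" for K
  proof -
    define r where "r = ?g v K / ?g v v"
    have "?g v (K - r *\<^sub>R v) = 0" using vv by (simp add: r_def scalar_prod.diff_right scalar_prod.scaleR_right)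
    then have "dev_alpha c x v (K - r *\<^sub>R v) = 0" by (rule orth)
    then have "dev_alpha c x v K = r * dev_alpha c x v v" by (simp add: linear_diff[OF la] linear_scale[OF la])
    then show ?thesis by (simp add: A_def r_def)
  qed
  \<comment> \<open>The part of \<beta> not yet explained by A F. It vanishes on every
    \<open>T k\<close>, hence is a multiple of the covector of v, and the factor B is read off on
    the axis i.\<close>
  define \<gamma> where "\<gamma> X = dev_beta c x v X - A * ?g (F c x v) X" for X
  have l\<gamma>: "linear \<gamma>"
    unfolding \<gamma>_def[abs_def]
    by (intro linear_compose_sub lb linear_mult_left bounded_linear.linear[OF scalar_prod.bounded_linear_right])
  define B where "B = \<gamma> (axis i 1) / ?g (axis i 1) v"
  have \<gamma>ax: "\<gamma> (axis k 1) = B * ?g (axis k 1) v" for k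
  proof (cases "k = i")
    case True
    then show ?thesis using i by (simp add: B_def)
  next
    case False
    obtain K where K: "?g (F c x v) (T k) + ?g v K = 0" "dev_beta c x v (T k) + dev_alpha c x v K = 0"
      using P'[OF False, of 0] by auto
    have "dev_beta c x v (T k) = A * ?g (F c x v) (T k)"
    proof -
      have "dev_beta c x v (T k) = - A * ?g v K" using K(2) by (simp add: alpha)
      also have "?g v K = - ?g (F c x v) (T k)" using K(1) by simp
      finally show ?thesis by simp
    qed
    then have "\<gamma> (T k) = 0" by (simp add: \<gamma>_def)
    then have "\<gamma> (axis k 1) = (?g (axis k 1) v / ?g (axis i 1) v) * \<gamma> (axis i 1)"
      by (simp add: T_def linear_diff[OF l\<gamma>] linear_scale[OF l\<gamma>])
    then show ?thesis by (simp add: B_def)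
  qed
  have "\<gamma> X = B * ?g v X" for X
  proof -
    have "\<gamma> X = (\<Sum>k\<in>UNIV. X $ k *\<^sub>R (B * ?g (axis k 1) v))"
      by (subst linear_apply_axis_sum[OF l\<gamma>]) (simp add: \<gamma>ax)
    also have "\<dots> = B * (\<Sum>k\<in>UNIV. X $ k *\<^sub>R ?g (axis k 1) v)"
      by (simp add: sum_distrib_left mult_ac)
    also have "(\<Sum>k\<in>UNIV. X $ k *\<^sub>R ?g (axis k 1) v) = ?g X v"
      by (rule linear_apply_axis_sum[symmetric]) (rule bounded_linear.linear[OF scalar_prod.bounded_linear_left])
    finally show ?thesis by (simp add: sym)
  qed
  then have "dev_beta c x v X = A * ?g (F c x v) X + B * ?g v X" for X
    unfolding \<gamma>_def by (simp add: algebra_simps)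
  then show ?thesis unfolding normality_equations_def using alpha by blast
qed

text \<open>The chart \<open>d\<close> is \<open>c\<close> followed by \<psi>, so on the overlap
  \<psi> is the transition map.\<close>

lemma jac_modified:
  assumes "c \<in> atlas" "d \<in> atlas" "cdom d \<subseteq> cdom c" "\<And>q. coord d q = \<psi> (coord c q)" "p \<in> cdom d"
    and "(\<psi> has_derivative D) (at (coord c p))"
  shows "jac c d (coord c p) = D"
proof -
  have p: "p \<in> cdom c" using assms by blast
  have "(trans_map c d has_derivative D) (at (coord c p))"
  proof (rule has_derivative_transform_within_open[OF assms(6)])
    show "open (coord c ` (cdom c \<inter> cdom d))" by (rule open_overlap[OF assms(1,2)])
    show "coord c p \<in> coord c ` (cdom c \<inter> cdom d)" using p assms(5) by blast
    show "\<psi> y = trans_map c d y" if y: "y \<in> coord c ` (cdom c \<inter> cdom d)" for y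
    proof -
      obtain q where "q \<in> cdom c" "y = coord c q" using y by blast
      then show ?thesis using assms(1,4) by simp
    qed
  qed
  then show ?thesis
    using has_derivative_unique[OF trans_map_has_derivative[OF assms(1,2) p assms(5)]] by simp
qed

text \<open>The hypersurface used for the test is \<open>L \<cdot> z + q(z) = 0\<close> in the coordinates \<open>z = x - x\<^sub>0\<close>, where the
  quadratic form \<open>q\<close> does not involve \<open>z\<^sup>i\<close> and its Hessian has \<open>k\<close>-th row \<open>w\<close>. Hence along the
  \<open>k\<close>-th coordinate line the normal covector is \<open>L + s w\<close>.\<close>

lemma strong_imp_test:
  assumes strong: "strong_normality"
    and c: "c \<in> atlas" "x0 \<in> coord c ` cdom c" and v0: "v0 \<noteq> 0"
    and i: "scalar_prod (g c x0) (axis i 1) v0 \<noteq> 0" and k: "k \<noteq> i" and w: "w $ i = 0"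
  defines "T \<equiv> axis k 1 - (scalar_prod (g c x0) (axis k 1) v0 / scalar_prod (g c x0) (axis i 1) v0) *\<^sub>R axis i 1"
  shows "\<exists>K \<kappa>. (\<forall>\<xi>. scalar_prod (g c x0) (Gam c x0 T \<xi>) v0 + scalar_prod (g c x0) \<xi> K
        = \<kappa> * scalar_prod (g c x0) \<xi> v0 + w \<bullet> \<xi>)
      \<and> scalar_prod (g c x0) (F c x0 v0) T + scalar_prod (g c x0) v0 K = 0
      \<and> dev_beta c x0 v0 T + dev_alpha c x0 v0 K = 0"
proof -
  \<comment> \<open>The covector of v0, which becomes the conormal of the test hypersurface at
    x0.\<close>
  define L where "L = g c x0 *v v0"
  have gL: "scalar_prod (g c x0) \<xi> v0 = L \<bullet> \<xi>" for \<xi> by (simp add: scalar_prod_inner L_def inner_commute)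
  have Li: "L $ i \<noteq> 0" using i unfolding gL by (simp add: inner_axis)
  have T: "T = axis k 1 - (L $ k / L $ i) *\<^sub>R axis i 1" unfolding T_def gL by (simp add: inner_axis)
  \<comment> \<open>The product z^k (w.z) alone would put 2 w_k on the diagonal of the Hessian; the
    subtracted square restores w_k.\<close>
  define q where "q z = z $ k * (w \<bullet> z) - w $ k / 2 * (z $ k * z $ k)" for z :: "real^'n"
  have ax [simp]: "(axis i 1 :: real^'n) $ k = 0" "(axis k 1 :: real^'n) $ i = 0"
    "(axis m 1 :: real^'n) $ m = 1" for m
    using k by (simp_all add: axis_def)
  have q_i: "q (z + r *\<^sub>R axis i 1) = q z" for z r
    by (simp add: q_def inner_add_right inner_axis w)
  \<comment> \<open>The i-th coordinate is replaced by the defining function. As L_i \<noteq> 0 and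
    q does not involve that coordinate, the function is affine in it, and \<theta> is the explicit
    solution.\<close>
  define \<psi> where "\<psi> x = (x - x0) + (L \<bullet> (x - x0) + q (x - x0) - (x - x0) $ i) *\<^sub>R axis i 1" for x
  define \<theta> where "\<theta> y = x0 + (y + ((y $ i - (L \<bullet> y - L $ i * y $ i) - q y) / L $ i - y $ i) *\<^sub>R axis i 1)" for y
  have \<psi>i: "\<psi> x $ i = L \<bullet> (x - x0) + q (x - x0)" for x by (simp add: \<psi>_def axis_def)
  have inv1: "\<theta> (\<psi> x) = x" for x
  proof -
    let ?z = "x - x0"
    define r where "r = L \<bullet> ?z + q ?z - ?z $ i"
    have y: "\<psi> x = ?z + r *\<^sub>R axis i 1" unfolding \<psi>_def r_def ..
    have "L \<bullet> \<psi> x = L \<bullet> ?z + r * L $ i" by (simp add: y inner_add_right inner_axis)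
    moreover have yi: "\<psi> x $ i = ?z $ i + r" by (simp add: y axis_def)
    moreover have "q (\<psi> x) = q ?z" unfolding y by (rule q_i)
    ultimately have eq: "(\<psi> x $ i - (L \<bullet> \<psi> x - L $ i * \<psi> x $ i) - q (\<psi> x)) / L $ i - \<psi> x $ i = - r"
      using Li by (simp add: field_simps r_def)
    show ?thesis unfolding \<theta>_def eq by (simp add: y)
  qed
  have inv2: "\<psi> (\<theta> y) = y" for y
  proof -
    define \<zeta> where "\<zeta> = (y $ i - (L \<bullet> y - L $ i * y $ i) - q y) / L $ i"
    have z: "\<theta> y - x0 = y + (\<zeta> - y $ i) *\<^sub>R axis i 1" unfolding \<theta>_def \<zeta>_def by simp
    have "(\<theta> y - x0) $ i = \<zeta>" unfolding z by (simp add: axis_def)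
    moreover have "q (\<theta> y - x0) = q y" unfolding z by (rule q_i)
    moreover have "L \<bullet> (\<theta> y - x0) = y $ i - q y"
      unfolding z using Li by (simp add: inner_add_right inner_axis \<zeta>_def field_simps)
    ultimately show ?thesis unfolding \<psi>_def by (simp add: z scaleR_diff_left)
  qed
  have sm_id: "smooth_on UNIV (\<lambda>x::real^'n. x)" by (rule smooth_on_linear) auto
  have sm_q: "smooth_on UNIV (\<lambda>x. q (h x))" if "smooth_on UNIV h" for h :: "real^'n \<Rightarrow> real^'n"
    unfolding q_def
    by (intro smooth_on_diff smooth_on_mult smooth_on_const smooth_on_nth smooth_on_inner_const open_UNIV that)
  have sm\<psi>: "smooth_on UNIV \<psi>"
    unfolding \<psi>_def[abs_def]
    by (intro smooth_on_add smooth_on_diff smooth_on_scaleR smooth_on_const smooth_on_nth smooth_on_inner_const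
        sm_q sm_id open_UNIV)
  have sm\<theta>: "smooth_on UNIV \<theta>"
    unfolding \<theta>_def[abs_def] divide_inverse
    by (intro smooth_on_add smooth_on_diff smooth_on_scaleR smooth_on_mult smooth_on_const smooth_on_nth
        smooth_on_inner_const sm_q sm_id open_UNIV)
  define D\<psi> where "D\<psi> x \<xi> = \<xi> + (L \<bullet> \<xi> + (\<xi> $ k * (w \<bullet> (x - x0)) + (x - x0) $ k * (w \<bullet> \<xi>)
      - w $ k * (x - x0) $ k * \<xi> $ k) - \<xi> $ i) *\<^sub>R axis i 1" for x \<xi>
  have der\<psi>: "(\<psi> has_derivative D\<psi> x) (at x)" for x
  proof -
    have n: "((\<lambda>x. (x - x0) $ j) has_derivative (\<lambda>h. h $ j)) (at x)" for j
      by (rule bounded_linear.has_derivative[OF bounded_linear_vec_nth]) (auto intro!: derivative_eq_intros)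
    have m: "((\<lambda>x. a \<bullet> (x - x0)) has_derivative (\<lambda>h. a \<bullet> h)) (at x)" for a
      by (auto intro!: derivative_eq_intros)
    show ?thesis
      unfolding \<psi>_def[abs_def] q_def D\<psi>_def[abs_def]
      by (rule derivative_eq_intros n m refl | simp)+ (simp add: fun_eq_iff algebra_simps)
  qed
  define p0 where "p0 = cinv c x0"
  have p0: "p0 \<in> cdom c" "coord c p0 = x0" using coord_cinv[OF c] by (auto simp: p0_def)
  have \<psi>0: "\<psi> x0 = 0" by (simp add: \<psi>_def q_def)
  define S where "S = {p \<in> cdom c. \<psi> (coord c p) $ i = 0}"
  \<comment> \<open>\<open>W\<close> will be the open set that cuts the piece out of
    \<open>S\<close>; the choice \<open>UNIV\<close> serves \<open>S\<close> itself.\<close>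
  define ch where "ch W = (cdom c \<inter> W, \<lambda>p. \<psi> (coord c p))" for W :: "'a set"
  have ch: "ch W \<in> atlas" if "open W" for W
    unfolding ch_def by (rule atlas_modify[OF c(1) that sm\<psi> sm\<theta> inv1 inv2])
  have chd: "cdom (ch W) = cdom c \<inter> W" "\<And>p. coord (ch W) p = \<psi> (coord c p)" for W by (simp_all add: ch_def)
  have sliceS: "slice_chart S (ch UNIV) i"
    unfolding slice_chart_def chd using ch[of UNIV] by (auto simp: S_def)
  have hyp: "hypersurface S"
    unfolding hypersurface_def
  proof
    fix p assume "p \<in> S"
    then have "p \<in> cdom (ch UNIV)" by (simp add: S_def chd)
    then show "\<exists>c i. slice_chart S c i \<and> p \<in> cdom c" using sliceS by blast
  qed
  have p0S: "p0 \<in> S" using p0 \<psi>0 by (simp add: S_def)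
  \<comment> \<open>With unit normal v0 / |v0| and \<nu> = |v0| at p0, the trajectory from p0 starts
    with velocity v0.\<close>
  define \<nu>0 where "\<nu>0 = sqrt (scalar_prod (g c x0) v0 v0)"
  have vv: "scalar_prod (g c x0) v0 v0 > 0" by (rule metric_pos[OF c v0])
  then have \<nu>0: "\<nu>0 > 0" "\<nu>0 * \<nu>0 = scalar_prod (g c x0) v0 v0" by (simp_all add: \<nu>0_def)
  define n0 where "n0 e = jac c e x0 (v0 /\<^sub>R \<nu>0)" for e
  have n0c: "n0 c = v0 /\<^sub>R \<nu>0" using jac_self[OF c(1) p0(1)] p0(2) by (simp add: n0_def)
  have unit: "unit_normal S p0 n0"
    unfolding unit_normal_def
  proof (intro conjI ballI allI impI)
    show "tangent_vector p0 n0"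
      by (rule tangent_vectorI[OF c(1) p0(1)]) (simp add: n0c p0(2), simp add: n0_def)
    fix e assume e: "e \<in> atlas" "p0 \<in> cdom e"
    show "scalar_prod (g e (coord e p0)) (n0 e) (n0 e) = 1"
      using scalar_prod_change[OF c(1) e(1) p0(1) e(2), of "v0 /\<^sub>R \<nu>0" "v0 /\<^sub>R \<nu>0"] \<nu>0 vv
      by (simp add: n0_def p0(2) scalar_prod.scaleR_left scalar_prod.scaleR_right field_simps)
  next
    fix e j m assume e: "slice_chart S e j" "p0 \<in> cdom e" "m \<noteq> j"
    note ea = slice_chart_atlas[OF e(1)]
    note u = slice_param_coord[OF e(1) p0S e(2)]
    define \<rho> where "\<rho> s = slice_param e j (coord e p0 + s *\<^sub>R axis m 1)" for s
    have \<rho>0: "\<rho> 0 = p0" using u by (simp add: \<rho>_def)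
    have flat: "flat j (axis m 1) = axis m 1" using e(3) by (simp add: flat_def vec_eq_iff axis_def)
    have d: "((\<lambda>s. coord e (\<rho> s)) has_vector_derivative axis m 1) (at 0)"
      using slice_line_has_derivative[OF e(1) u(1), of "axis m 1"] by (simp add: \<rho>_def flat)
    have ev: "\<forall>\<^sub>F s in nhds 0. \<rho> s \<in> S \<and> \<rho> s \<in> cdom e"
      using slice_line_eventually[OF ea u(1), of "axis m 1"]
      by eventually_elim (auto simp: \<rho>_def intro: slice_param_props[OF e(1)])
    have eve: "\<forall>\<^sub>F s in nhds 0. \<rho> s \<in> cdom e" using ev by (rule eventually_mono) simp
    \<comment> \<open>Orthogonality is required in every slice chart of \<open>S\<close>. A
      coordinate vector of such a chart is carried to \<open>c\<close>, where tangency means L.\<xi>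
      = 0.\<close>
    define \<xi> where "\<xi> = jac e c (coord e p0) (axis m 1)"
    have "((\<lambda>s. coord c (\<rho> s)) has_vector_derivative \<xi>) (at 0)"
      using coord_curve_change[OF ea c(1) _ eve d] p0 by (simp add: \<rho>0 \<xi>_def)
    from has_derivative_vector_compose[OF this der\<psi>]
    have "((\<lambda>s. \<psi> (coord c (\<rho> s)) $ i) has_vector_derivative D\<psi> x0 \<xi> $ i) (at 0)"
      by (intro bounded_linear.has_vector_derivative[OF bounded_linear_vec_nth]) (simp add: \<rho>0 p0)
    moreover have "\<forall>\<^sub>F s in nhds 0. \<psi> (coord c (\<rho> s)) $ i = 0"
      using ev by eventually_elim (simp add: S_def)
    ultimately have "((\<lambda>s. 0) has_vector_derivative D\<psi> x0 \<xi> $ i) (at 0)"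
      by (rule has_vector_derivative_cong_eventually)
    then have "D\<psi> x0 \<xi> $ i = 0" using vector_derivative_unique_at has_vector_derivative_const by blast
    then have "scalar_prod (g c x0) \<xi> v0 = 0" by (simp add: D\<psi>_def gL axis_def)
    then have "scalar_prod (g c (coord c p0)) (v0 /\<^sub>R \<nu>0) \<xi> = 0"
      using scalar_prod_sym[OF c] p0 by (simp add: scalar_prod.scaleR_left)
    moreover have "jac c e (coord c p0) \<xi> = axis m 1"
      unfolding \<xi>_def by (rule jac_inverse[OF ea c(1) e(2) p0(1)])
    ultimately show "scalar_prod (g e (coord e p0)) (n0 e) (axis m 1) = 0"
      using scalar_prod_change[OF c(1) ea p0(1) e(2), of "v0 /\<^sub>R \<nu>0" \<xi>] by (simp add: n0_def p0(2))
  qed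
  obtain S' n \<nu> \<epsilon> f where A: "piece_around p0 S S'" "unit_normal_field S' n"
    "\<And>e. e \<in> atlas \<Longrightarrow> p0 \<in> cdom e \<Longrightarrow> n e p0 = n0 e" "transformation_class_fun S' \<nu>" "\<nu> p0 = \<nu>0"
    "is_normal_shift S' n \<nu> \<epsilon> f"
    using strong hyp p0S unit \<nu>0(1) unfolding strong_normality_def by (metis less_irrefl)
  have f: "is_shift S' n \<nu> \<epsilon> f" using A(6) by (simp add: is_normal_shift_def)
  obtain W where W: "open W" "S' = S \<inter> W"
    using A(1) unfolding piece_around_def openin_open by blast
  have p0S': "p0 \<in> S'" using A(1) by (simp add: piece_around_def)
  define d where "d = ch W"
  have da: "d \<in> atlas" unfolding d_def by (rule ch[OF W(1)])
  have dd: "cdom d = cdom c \<inter> W" "\<And>p. coord d p = \<psi> (coord c p)" by (simp_all add: d_def chd)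
  have slice: "slice_chart S' d i"
    unfolding slice_chart_def dd using da by (auto simp: S_def W(2))
  have p0d: "p0 \<in> cdom d" using p0S' p0(1) W(2) by (simp add: dd)
  have u0: "0 \<in> slice_dom d i" "slice_param d i 0 = p0"
    using slice_param_coord[OF slice p0S' p0d] by (simp_all add: dd p0(2) \<psi>0)
  define \<sigma> where "\<sigma> s = slice_param d i (0 + s *\<^sub>R axis k 1)" for s
  define \<Gamma> where "\<Gamma> s = f (\<sigma> s)" for s
  \<comment> \<open>The k-th coordinate line of the adapted chart seen in the original coordinates,
    that is, \<theta> applied to s times the k-th axis.\<close>
  define X where "X s = x0 + (s *\<^sub>R axis k 1 - ((L $ k * s + w $ k / 2 * (s * s)) / L $ i) *\<^sub>R axis i 1)" for s
  have dX: "(X has_vector_derivative T) (at 0)"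
  proof -
    have r: "((\<lambda>s. (L $ k * s + w $ k / 2 * (s * s)) / L $ i) has_vector_derivative L $ k / L $ i) (at 0)"
      unfolding has_real_derivative_iff_has_vector_derivative[symmetric]
      using Li by (auto intro!: derivative_eq_intros)
    have "(X has_vector_derivative 0 + (1 *\<^sub>R axis k 1 - (L $ k / L $ i) *\<^sub>R axis i 1)) (at 0)"
      unfolding X_def[abs_def]
      by (intro has_vector_derivative_add has_vector_derivative_diff has_vector_derivative_const
          bounded_linear.has_vector_derivative[OF bounded_linear_scaleR_left] r has_vector_derivative_id)
    then show ?thesis by (simp add: T)
  qed
  have flat: "flat i (s *\<^sub>R axis k 1) = s *\<^sub>R axis k 1" for s
    using k by (simp add: flat_def vec_eq_iff axis_def)
  have ev: "\<forall>\<^sub>F s in nhds 0. \<sigma> s \<in> S' \<and> \<sigma> s \<in> cdom d \<and> coord c (\<sigma> s) = X s"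
    using slice_line_eventually[OF da u0(1), of "axis k 1"]
  proof eventually_elim
    case (elim s)
    note p = slice_param_props[OF slice elim]
    have "\<psi> (coord c (\<sigma> s)) = s *\<^sub>R axis k 1" using p(3) flat by (simp add: \<sigma>_def dd)
    then have "coord c (\<sigma> s) = \<theta> (s *\<^sub>R axis k 1)" using inv1 by metis
    also have "\<dots> = X s"
    proof -
      let ?y = "s *\<^sub>R axis k 1 :: real^'n"
      have qy: "q ?y = w $ k / 2 * (s * s)" by (simp add: q_def inner_axis)
      have "(?y $ i - (L \<bullet> ?y - L $ i * ?y $ i) - q ?y) / L $ i - ?y $ i
          = - ((L $ k * s + w $ k / 2 * (s * s)) / L $ i)"
        unfolding qy by (simp add: inner_axis diff_divide_distrib add_divide_distrib)
      then show ?thesis unfolding \<theta>_def X_def by simp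
    qed
    finally show ?case using p by (simp add: \<sigma>_def)
  qed
  define Vs where "Vs s = vel c (\<Gamma> s) 0" for s
  have fS: "f p 0 = p" "p \<in> cdom c \<Longrightarrow> vel c (f p) 0 = \<nu> p *\<^sub>R n c p" "trajectory {-\<epsilon><..<\<epsilon>} (f p)" if "p \<in> S'" for p
    using f that c(1) unfolding is_shift_def by blast+
  have I0: "0 \<in> {-\<epsilon><..<\<epsilon>}" using f by (simp add: is_shift_def)
  have \<sigma>0: "\<sigma> 0 = p0" by (simp add: \<sigma>_def u0)
  have Vs0: "Vs 0 = v0" using fS(2)[OF p0S' p0(1)] A(3)[OF c(1) p0(1)] \<nu>0(1) by (simp add: Vs_def \<Gamma>_def \<sigma>0 A(5) n0c)
  have X0: "X 0 = x0" by (simp add: X_def)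
  note V = shift_variation_props[where k = k, OF A(2,4) f slice u0(1), unfolded u0(2), folded \<sigma>_def, folded \<Gamma>_def]
  note \<gamma> = fS(3)[OF p0S']
  have f0c: "f p0 0 \<in> cdom c" using fS(1)[OF p0S'] p0(1) by simp
  have f00: "coord c (f p0 0) = x0" using fS(1)[OF p0S'] p0(2) by simp
  have vel0: "vel c (f p0) 0 = v0" using Vs0 by (simp add: Vs_def \<Gamma>_def \<sigma>0)
  define \<tau> where "\<tau> = shift_variation f d i c k 0"
  define V' where "V' = vector_derivative (\<lambda>s. vel c (\<Gamma> s) 0) (at 0)"
  have dVs: "(Vs has_vector_derivative V') (at 0)"
    using V(5)[OF c(1) I0 f0c] unfolding Vs_def[abs_def] V'_def .
  have "(X has_vector_derivative \<tau> 0) (at 0)"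
    by (rule has_vector_derivative_cong_eventually[OF V(2)[OF c(1) I0 f0c, folded \<tau>_def]])
       (use ev in eventually_elim, use fS(1) in \<open>simp add: \<Gamma>_def\<close>)
  then have \<tau>0: "\<tau> 0 = T" using dX vector_derivative_unique_at by blast
  define K where "K = nabla_t c (f p0) \<tau> 0"
  \<comment> \<open>The t-derivative of \<tau> is the s-derivative of the velocity, by exchange of
    the two derivatives.\<close>
  have K: "K = V' + Gam c x0 v0 T"
    using vector_derivative_at[OF V(4)[OF c(1) I0 f0c, folded \<tau>_def V'_def]]
    by (simp add: K_def nabla_t_Gam f00 vel0 \<tau>0)
  define \<phi>1 where "\<phi>1 t = scalar_prod (g c (coord c (f p0 t))) (F c (coord c (f p0 t)) (vel c (f p0) t)) (\<tau> t)
      + scalar_prod (g c (coord c (f p0 t))) (vel c (f p0) t) (nabla_t c (f p0) \<tau> t)" for t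
  have \<phi>0: "scalar_prod (g c (coord c (f p0 t))) (vel c (f p0) t) (\<tau> t) = 0"
    if "t \<in> {-\<epsilon><..<\<epsilon>}" "f p0 t \<in> cdom c" for t
    using normal_shift_deviation[where k = k, OF A(2,4,6) slice u0(1) that(1) c(1)]
      shift_deviation_eq[where f = f and c' = d and i = i and u = 0 and t = t and k = k, OF c(1)] that(2)
    by (simp add: u0(2) \<tau>_def)
  have zero_deriv: "D = 0" if "(h has_real_derivative D) (at t)" "\<forall>\<^sub>F s in nhds t. h s = 0" for h D t
  proof -
    from has_vector_derivative_cong_eventually[OF that(1)[unfolded has_real_derivative_iff_has_vector_derivative] that(2)]
    have "((\<lambda>s. 0) has_vector_derivative D) (at t)" .
    then show ?thesis using vector_derivative_unique_at has_vector_derivative_const by blast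
  qed
  have \<phi>10: "\<phi>1 t = 0" if t: "t \<in> {-\<epsilon><..<\<epsilon>}" "f p0 t \<in> cdom c" for t
    by (rule zero_deriv[OF deviation_derivatives(1)[OF \<gamma> V(1) t(1) c(1) t(2), folded \<tau>_def, folded \<phi>1_def]])
       (use trajectory_eventually_chart[OF \<gamma> t(1) c(1) t(2)] in eventually_elim, use \<phi>0 in blast)
  \<comment> \<open>The deviation vanishes for all t near 0: its first derivative at 0 gives
    \<open>E2\<close>, its second gives \<open>E3\<close>.\<close>
  have E2: "scalar_prod (g c x0) (F c x0 v0) T + scalar_prod (g c x0) v0 K = 0"
    using \<phi>10[OF I0 f0c] unfolding \<phi>1_def f00 vel0 \<tau>0 K_def .
  have "dev_beta c (coord c (f p0 0)) (vel c (f p0) 0) (\<tau> 0) + dev_alpha c (coord c (f p0 0)) (vel c (f p0) 0) (nabla_t c (f p0) \<tau> 0) = 0"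
    by (rule zero_deriv[OF deviation_derivatives(2)[OF \<gamma> V(1) I0 c(1) f0c, folded \<tau>_def, folded \<phi>1_def]])
       (use trajectory_eventually_chart[OF \<gamma> I0 c(1) f0c] in eventually_elim, use \<phi>10 in blast)
  then have E3: "dev_beta c x0 v0 T + dev_alpha c x0 v0 K = 0" unfolding f00 vel0 \<tau>0 K_def .
  \<comment> \<open>The covector of the initial velocity is proportional to the conormal L + s w.
    The factor contains the unknown \<nu> and is read off on the axis i, where w contributes
    nothing.\<close>
  define \<mu> where "\<mu> s = scalar_prod (g c (X s)) (axis i 1) (Vs s) / L $ i" for s
  have normal: "\<forall>\<^sub>F s in nhds 0. scalar_prod (g c (X s)) \<xi> (Vs s) = \<mu> s * (L \<bullet> \<xi> + s * (w \<bullet> \<xi>))" for \<xi>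
    using ev
  proof eventually_elim
    case (elim s)
    define p where "p = \<sigma> s"
    have p: "p \<in> S'" "p \<in> cdom d" "p \<in> cdom c" "coord c p = X s" using elim by (auto simp: p_def dd)
    have Vp: "Vs s = \<nu> p *\<^sub>R n c p" using fS(2)[OF p(1,3)] by (simp add: Vs_def \<Gamma>_def p_def)
    have J: "jac c d (coord c p) = D\<psi> (X s)"
      using jac_modified[OF c(1) da _ dd(2) p(2) der\<psi>] dd(1) p(4) by simp
    have un: "unit_normal S' p (\<lambda>c. n c p)" using A(2) p(1) by (simp add: unit_normal_field_def)
    then have "tangent_vector p (\<lambda>c. n c p)" unfolding unit_normal_def by blast
    from tangent_vectorD[OF this c(1) da p(3,2)]
    have nd: "n d p = jac c d (coord c p) (n c p)" .
    \<comment> \<open>Vectors annihilated by L + s w are tangent to the hypersurface: in the adapted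
      chart they have no i-th component.\<close>
    have kill: "scalar_prod (g c (X s)) \<eta> (Vs s) = 0" if \<eta>: "L \<bullet> \<eta> + s * (w \<bullet> \<eta>) = 0" for \<eta>
    proof -
      have "w \<bullet> (X s - x0) = s * w $ k" "(X s - x0) $ k = s"
        using k w by (simp_all add: X_def inner_diff_right inner_axis)
      then have "D\<psi> (X s) \<eta> $ i = 0" using \<eta> by (simp add: D\<psi>_def axis_def)
      moreover have "scalar_prod (g d (coord d p)) (axis m 1) (n d p) = 0" if "m \<noteq> i" for m
      proof -
        have "scalar_prod (g d (coord d p)) (n d p) (axis m 1) = 0"
          using un slice p(2) that unfolding unit_normal_def by blast
        then show ?thesis using scalar_prod_sym[OF da imageI[OF p(2)]] by simp
      qed
      ultimately have "scalar_prod (g d (coord d p)) (D\<psi> (X s) \<eta>) (n d p) = 0" by (rule slice_scalar_prod)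
      then have "scalar_prod (g c (X s)) \<eta> (n c p) = 0"
        unfolding nd using scalar_prod_change[OF c(1) da p(3,2), of \<eta> "n c p"] J by (simp add: p(4))
      then show ?thesis by (simp add: Vp scalar_prod.scaleR_right)
    qed
    define r where "r = (L \<bullet> \<xi> + s * (w \<bullet> \<xi>)) / L $ i"
    have "scalar_prod (g c (X s)) (\<xi> - r *\<^sub>R axis i 1) (Vs s) = 0"
      by (rule kill) (use Li w in \<open>simp add: r_def inner_diff_right inner_axis\<close>)
    then have "scalar_prod (g c (X s)) \<xi> (Vs s) = r * scalar_prod (g c (X s)) (axis i 1) (Vs s)"
      by (simp add: scalar_prod.diff_left scalar_prod.scaleR_left)
    then show ?case by (simp add: \<mu>_def r_def)
  qed
  have X0c: "X 0 \<in> coord c ` cdom c" using c(2) by (simp add: X0)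
  \<comment> \<open>A constant \<xi> has covariant derivative \<Gamma>(T, \<xi>) along the line, and
    that of the velocity is K by symmetry of \<Gamma>. Comparison with the derivative of \<mu> (L +
    s w) yields \<open>E1\<close>.\<close>
  have dg: "((\<lambda>s. scalar_prod (g c (X s)) \<xi> (Vs s)) has_real_derivative
      scalar_prod (g c x0) (Gam c x0 T \<xi>) v0 + scalar_prod (g c x0) \<xi> K) (at 0)" for \<xi>
    using metric_leibniz[where \<xi> = X and t = 0, OF c(1) X0c dX has_vector_derivative_const dVs, of \<xi>]
    by (simp add: X0 Vs0 K Gam_sym[OF c, of T v0])
  have d\<mu>: "(\<mu> has_real_derivative (scalar_prod (g c x0) (Gam c x0 T (axis i 1)) v0
      + scalar_prod (g c x0) (axis i 1) K) / L $ i) (at 0)" (is "(_ has_real_derivative ?\<kappa>) _")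
    unfolding \<mu>_def[abs_def] by (rule DERIV_cdivide[OF dg])
  have \<mu>0: "\<mu> 0 = 1" using Li by (simp add: \<mu>_def X0 Vs0 gL inner_axis)
  have E1: "scalar_prod (g c x0) (Gam c x0 T \<xi>) v0 + scalar_prod (g c x0) \<xi> K = ?\<kappa> * scalar_prod (g c x0) \<xi> v0 + w \<bullet> \<xi>" for \<xi>
  proof -
    have "((\<lambda>s. \<mu> s * (L \<bullet> \<xi> + s * (w \<bullet> \<xi>))) has_real_derivative ?\<kappa> * (L \<bullet> \<xi>) + w \<bullet> \<xi>) (at 0)"
      by (rule derivative_eq_intros d\<mu> refl | simp add: \<mu>0)+
    moreover have "((\<lambda>s. \<mu> s * (L \<bullet> \<xi> + s * (w \<bullet> \<xi>))) has_real_derivative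
        scalar_prod (g c x0) (Gam c x0 T \<xi>) v0 + scalar_prod (g c x0) \<xi> K) (at 0)"
      using has_vector_derivative_cong_eventually[OF dg[unfolded has_real_derivative_iff_has_vector_derivative] normal]
      by (simp add: has_real_derivative_iff_has_vector_derivative)
    ultimately show ?thesis using DERIV_unique unfolding gL by blast
  qed
  show ?thesis using E1 E2 E3 by blast
qed

lemma strong_imp_weak:
  assumes strong: "strong_normality" and n: "CARD('n) \<ge> 2"
  shows "weak_normality"
proof -
  have N: "normality_equations c x v" if c: "c \<in> atlas" "x \<in> coord c ` cdom c" and v: "v \<noteq> 0" for c x v
  proof -
    \<comment> \<open>Otherwise expansion of v along the axes would give (v|v) = 0.\<close>
    have "\<exists>i. scalar_prod (g c x) (axis i 1) v \<noteq> 0"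
      using slice_scalar_prod[of v undefined "g c x" v] metric_pos[OF c v]
        linear_apply_axis_sum[OF bounded_linear.linear[OF scalar_prod.bounded_linear_left], of "g c x" v v]
      by (metis (mono_tags, lifting) less_irrefl scaleR_zero_right sum.neutral)
    then obtain i where i: "scalar_prod (g c x) (axis i 1) v \<noteq> 0" by blast
    \<comment> \<open>A second index provides a tangent direction of the test hypersurface; the
      dimension enters here and in \<open>force_zero_velocity\<close>.\<close>
    have "\<exists>k. k \<noteq> i"
    proof (rule ccontr)
      assume "\<nexists>k. k \<noteq> i"
      then have "UNIV = {i}" by auto
      then have "CARD('n) = 1" by (metis card.empty card.insert empty_iff finite.emptyI One_nat_def)
      then show False using n by simp
    qed
    then obtain k0 where "k0 \<noteq> i" by blast
    then show ?thesis
      using normality_equationsI[OF c v i] strong_imp_test[OF strong c v i] unfolding Let_def by blast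
  qed
  show ?thesis by (rule weak_normalityI[OF force_zero_velocity[OF N _ _ n] N]) 
qed

end

theorem theorem12p1:
  fixes atlas :: "('a::{t2_space, second_countable_topology}, 'n::finite) chart set"
    and g :: "('a, 'n) chart \<Rightarrow> real^'n \<Rightarrow> real^'n^'n"
    and F :: "('a, 'n) chart \<Rightarrow> real^'n \<Rightarrow> real^'n \<Rightarrow> real^'n"
  assumes "newtonian_system atlas g F"
    and "CARD('n) \<ge> 2"
  shows "newtonian_system.complete_normality atlas g F \<longleftrightarrow>
         newtonian_system.strong_normality atlas g F"
proof -
  interpret newtonian_system atlas g F by (rule assms(1))
  show ?thesis
    using complete_imp_strong strong_imp_additional strong_imp_weak[OF _ assms(2)]
    unfolding complete_normality_def by blast
qed

end
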